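(* Let $k \in \mathbb{N}$. Every locally finite graph $G$ has a canonical tree-decomposition $(T, \mathcal{V})$ of adhesion less than $k$ that efficiently distinguishes every two distinct $k$-profiles in $G$, and which has the further property that every separable $k$-block $b$ in $G$ is equal to the unique bag of $(T, \mathcal{V})$ that contains $b$.
   Context: Graphs may be infinite; a graph is locally finite if all its vertices have finite degree. Separations. A separation of a graph $G$ is a set $\{A,B\}$ of subsets of $V(G)$ with $A \cup B = V(G)$ and no edge of $G$ between $A \setminus B$ and $B \setminus A$; its order is $|A \cap B|$. Its orientations are $(A,B)$ and $(B,A)$. For $k \in \mathbb{N} \cup \{\aleph_0\}$, $S_k(G)$ is the set of all separations of $G$ of order $< k$, and $\vec{S}_k(G)$ is the set of all their orientations. Oriented separations are partially ordered by $(A,B) \leq (C,D)$ iff $A \subseteq C$ and $B \supseteq D$. A star is a set $\sigma \subseteq \vec{S}_{\aleph_0}(G) \setminus \{(V(G),V(G))\}$ such that $(A,B) \leq (D,C)$ for any two distinct $(A,B),(C,D) \in \sigma$. Its interior is $\operatorname{int}(\sigma) = \bigcap_{(A,B) \in \sigma} B$ (with $\operatorname{int}(\emptyset) = V(G)$). Profiles. An orientation of $S_k(G)$ is a set $O \subseteq \vec{S}_k(G)$ containing exactly one of $(A,B),(B,A)$ for every $\{A,B\} \in S_k(G)$. It is consistent if it does not contain both $(B,A)$ and $(C,D)$ whenever $(A,B) < (C,D)$ for distinct $\{A,B\},\{C,D\} \in S_k(G)$. A $k$-profile in $G$ is a consistent orientation $P$ of $S_k(G)$ such that for all $(A,B),(C,D)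 \in P$ the separation $(B \cap D, A \cup C)$ does not lie in $P$. A separation distinguishes two profiles if they orient it differently; it distinguishes them efficiently if moreover no separation of $G$ of smaller order distinguishes them. Blocks. A $k$-block in $G$ is a maximal set $b$ of at least $k$ vertices such that no two vertices $v,w \in b$ can be separated in $G$ by removing fewer than $k$ vertices other than $v,w$. A $k$-block $b$ is separable if there is a star $\sigma \subseteq \vec{S}_k(G)$ with $\operatorname{int}(\sigma) = b$. Tree-decompositions. A tree-decomposition of $G$ is a pair $(T,\mathcal{V})$ of a (possibly infinite) tree $T$ and a family $\mathcal{V} = (V_t)_{t \in V(T)}$ of subsets of $V(G)$ (the bags) such that $\bigcup_{t} G[V_t] = G$ and for every $v \in V(G)$ the graph $T[\{t : v \in V_t\}]$ is connected. Its adhesion is the maximal size of a set $V_t \cap V_{t'}$ with $\{t,t'\} \in E(T)$. An edge $e = \{t_1,t_2\}$ of $T$ induces the separation $\{U_1,U_2\}$ of $G$, where $U_i = \bigcup_{s \in V(T_i)} V_s$ and $T_i \ni t_i$ are the two components of $T - e$. $(T,\mathcal{V})$ efficiently distinguishes two profiles if some edge of $T$ induces a separation that distinguishes them efficiently. That $b$ is equal to the unique bag that contains it means: there is exactly one node $t$ of $T$ with $b \subseteq V_t$, and $V_t = b$. Canonicity. A tree-decomposition of $G$ is canonical if it is obtained by a construction $\Psi$ (here defined on all locally finite graphs) which commutes with all graph isomorphisms $\varphi: G \to G'$: with $(T,\mathcal{V}) = \Psi(G)$ and $(T',\mathcal{V}') = \Psi(G')$, $\varphi$ maps the bags $V_t$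 to bags $V'_{t'}$ in such a way that $t \mapsto t'$ is an isomorphism $T \to T'$.
   Formalization: Proved for locally finite graphs that are finite or connected; infinite disconnected graphs are excluded, since the claim fails there (e.g. the edgeless graph on the natural numbers with k = 1, or a double ray plus an isolated vertex with k = 2). *)

theory Defs
  imports Main "HOL-Library.Extended_Nat"
begin

section \<open>Graphs\<close>

record 'a ugraph =
  verts :: "'a set"
  edges :: "'a set set"

definition simple_graph :: "'a ugraph \<Rightarrow> bool" where
  "simple_graph G \<longleftrightarrow> (\<forall>e\<in>edges G. e \<subseteq> verts G \<and> card e = 2)"

definition locally_finite :: "'a ugraph \<Rightarrow> bool" where
  "locally_finite G \<longleftrightarrow> (\<forall>v\<in>verts G. finite {e\<in>edges G. v \<in> e})"

definition induced :: "'a ugraph \<Rightarrow> 'a set \<Rightarrow> 'a ugraph" where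
  "induced G X = \<lparr>verts = verts G \<inter> X, edges = {e\<in>edges G. e \<subseteq> X}\<rparr>"

definition delete_edge :: "'a ugraph \<Rightarrow> 'a set \<Rightarrow> 'a ugraph" where
  "delete_edge G e = \<lparr>verts = verts G, edges = edges G - {e}\<rparr>"

definition reachable :: "'a ugraph \<Rightarrow> 'a \<Rightarrow> 'a \<Rightarrow> bool" where
  "reachable G u v \<longleftrightarrow> u \<in> verts G \<and> v \<in> verts G \<and> (u, v) \<in> {(x, y). {x, y} \<in> edges G}\<^sup>*"

definition component_of :: "'a ugraph \<Rightarrow> 'a \<Rightarrow> 'a set" where
  "component_of G v = {w. reachable G v w}"

text \<open>The graph without vertices counts as connected here; trees are required to be nonempty
  separately.\<close>

definition connected_graph :: "'a ugraph \<Rightarrow> bool" where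
  "connected_graph G \<longleftrightarrow> (\<forall>u\<in>verts G. \<forall>v\<in>verts G. reachable G u v)"

definition is_cycle :: "'a ugraph \<Rightarrow> 'a list \<Rightarrow> bool" where
  "is_cycle G xs \<longleftrightarrow> 3 \<le> length xs \<and> distinct xs \<and>
     (\<forall>i<length xs. {xs ! i, xs ! (Suc i mod length xs)} \<in> edges G)"

definition is_tree :: "'a ugraph \<Rightarrow> bool" where
  "is_tree T \<longleftrightarrow> simple_graph T \<and> verts T \<noteq> {} \<and> connected_graph T \<and> (\<nexists>xs. is_cycle T xs)"

definition graph_iso :: "('a \<Rightarrow> 'b) \<Rightarrow> 'a ugraph \<Rightarrow> 'b ugraph \<Rightarrow> bool" where
  "graph_iso f G H \<longleftrightarrow> bij_betw f (verts G) (verts H) \<and>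
     (\<forall>u\<in>verts G. \<forall>v\<in>verts G. {u, v} \<in> edges G \<longleftrightarrow> {f u, f v} \<in> edges H)"


section \<open>Separations\<close>

definition esize :: "'a set \<Rightarrow> enat" where
  "esize X = (if finite X then enat (card X) else \<infinity>)"

definition is_separation :: "'a ugraph \<Rightarrow> 'a set \<Rightarrow> 'a set \<Rightarrow> bool" where
  "is_separation G A B \<longleftrightarrow> A \<union> B = verts G \<and> (\<forall>u\<in>A - B. \<forall>v\<in>B - A. {u, v} \<notin> edges G)"

text \<open>The value \<open>\<infinity>\<close> of the parameter plays the role of \<open>\<aleph>\<^sub>0\<close>: an order is below \<open>\<infinity>\<close>
  iff it is finite.\<close>

definition seps :: "enat \<Rightarrow> 'a ugraph \<Rightarrow> 'a set set set" where
  "seps k G = {{A, B} |A B. is_separation G A B \<and> esize (A \<inter> B) < k}"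

type_synonym 'a osep = "'a set \<times> 'a set"

definition oseps :: "enat \<Rightarrow> 'a ugraph \<Rightarrow> 'a osep set" where
  "oseps k G = {(A, B). {A, B} \<in> seps k G}"

definition osep_le :: "'a osep \<Rightarrow> 'a osep \<Rightarrow> bool" where
  "osep_le r s \<longleftrightarrow> fst r \<subseteq> fst s \<and> snd s \<subseteq> snd r"

definition osep_less :: "'a osep \<Rightarrow> 'a osep \<Rightarrow> bool" where
  "osep_less r s \<longleftrightarrow> osep_le r s \<and> r \<noteq> s"

definition is_star :: "'a ugraph \<Rightarrow> 'a osep set \<Rightarrow> bool" where
  "is_star G \<sigma> \<longleftrightarrow> \<sigma> \<subseteq> oseps \<infinity> G - {(verts G, verts G)} \<and>
     (\<forall>A B C D. (A, B) \<in> \<sigma> \<and> (C, D) \<in> \<sigma> \<and> (A, B) \<noteq> (C, D) \<longrightarrow> osep_le (A, B) (D, C))"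

text \<open>Intersecting with the vertex set only matters for the empty star.\<close>

definition star_interior :: "'a ugraph \<Rightarrow> 'a osep set \<Rightarrow> 'a set" where
  "star_interior G \<sigma> = verts G \<inter> (\<Inter>(A, B)\<in>\<sigma>. B)"


section \<open>Profiles\<close>

definition is_orientation :: "enat \<Rightarrow> 'a ugraph \<Rightarrow> 'a osep set \<Rightarrow> bool" where
  "is_orientation k G P \<longleftrightarrow> P \<subseteq> oseps k G \<and>
     (\<forall>A B. {A, B} \<in> seps k G \<longrightarrow> (\<exists>!s. s \<in> {(A, B), (B, A)} \<and> s \<in> P))"

definition consistent :: "enat \<Rightarrow> 'a ugraph \<Rightarrow> 'a osep set \<Rightarrow> bool" where
  "consistent k G P \<longleftrightarrow> \<not> (\<exists>A B C D. {A, B} \<in> seps k G \<and> {C, D} \<in> seps k G \<and> {A, B} \<noteq> {C, D} \<and>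
     osep_less (A, B) (C, D) \<and> (B, A) \<in> P \<and> (C, D) \<in> P)"

definition is_profile :: "enat \<Rightarrow> 'a ugraph \<Rightarrow> 'a osep set \<Rightarrow> bool" where
  "is_profile k G P \<longleftrightarrow> is_orientation k G P \<and> consistent k G P \<and>
     (\<forall>A B C D. (A, B) \<in> P \<and> (C, D) \<in> P \<longrightarrow> (B \<inter> D, A \<union> C) \<notin> P)"

definition distinguishes :: "'a ugraph \<Rightarrow> 'a set \<Rightarrow> 'a set \<Rightarrow> 'a osep set \<Rightarrow> 'a osep set \<Rightarrow> bool" where
  "distinguishes G A B P Q \<longleftrightarrow> is_separation G A B \<and> A \<noteq> B \<and>
     ((A, B) \<in> P \<and> (B, A) \<in> Q \<or> (B, A) \<in> P \<and> (A, B) \<in> Q)"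

definition efficiently_distinguishes ::
    "'a ugraph \<Rightarrow> 'a set \<Rightarrow> 'a set \<Rightarrow> 'a osep set \<Rightarrow> 'a osep set \<Rightarrow> bool" where
  "efficiently_distinguishes G A B P Q \<longleftrightarrow> distinguishes G A B P Q \<and>
     \<not> (\<exists>C D. esize (C \<inter> D) < esize (A \<inter> B) \<and> distinguishes G C D P Q)"


section \<open>Blocks\<close>

definition can_separate :: "nat \<Rightarrow> 'a ugraph \<Rightarrow> 'a \<Rightarrow> 'a \<Rightarrow> bool" where
  "can_separate k G v w \<longleftrightarrow> (\<exists>X. X \<subseteq> verts G - {v, w} \<and> finite X \<and> card X < k \<and>
     \<not> reachable (induced G (verts G - X)) v w)"

definition is_inseparable :: "nat \<Rightarrow> 'a ugraph \<Rightarrow> 'a set \<Rightarrow> bool" where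
  "is_inseparable k G b \<longleftrightarrow> b \<subseteq> verts G \<and> enat k \<le> esize b \<and>
     (\<forall>v\<in>b. \<forall>w\<in>b. v \<noteq> w \<longrightarrow> \<not> can_separate k G v w)"

definition is_block :: "nat \<Rightarrow> 'a ugraph \<Rightarrow> 'a set \<Rightarrow> bool" where
  "is_block k G b \<longleftrightarrow> is_inseparable k G b \<and> (\<forall>c. is_inseparable k G c \<and> b \<subseteq> c \<longrightarrow> c = b)"

definition separable_block :: "nat \<Rightarrow> 'a ugraph \<Rightarrow> 'a set \<Rightarrow> bool" where
  "separable_block k G b \<longleftrightarrow> is_block k G b \<and>
     (\<exists>\<sigma>. is_star G \<sigma> \<and> \<sigma> \<subseteq> oseps (enat k) G \<and> star_interior G \<sigma> = b)"


section \<open>Tree-decompositions\<close>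

type_synonym ('t, 'a) treedec = "'t ugraph \<times> ('t \<Rightarrow> 'a set)"

definition is_tree_decomposition :: "'a ugraph \<Rightarrow> 't ugraph \<Rightarrow> ('t \<Rightarrow> 'a set) \<Rightarrow> bool" where
  "is_tree_decomposition G T V \<longleftrightarrow> is_tree T \<and>
     (\<forall>t\<in>verts T. V t \<subseteq> verts G) \<and>
     (\<Union>t\<in>verts T. verts (induced G (V t))) = verts G \<and>
     (\<Union>t\<in>verts T. edges (induced G (V t))) = edges G \<and>
     (\<forall>v\<in>verts G. connected_graph (induced T {t\<in>verts T. v \<in> V t}))"

definition adhesion_less :: "'t ugraph \<Rightarrow> ('t \<Rightarrow> 'a set) \<Rightarrow> nat \<Rightarrow> bool" where
  "adhesion_less T V k \<longleftrightarrow> (\<forall>s t. {s, t} \<in> edges T \<longrightarrow> esize (V s \<inter> V t) < enat k)"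

definition edge_side :: "'t ugraph \<Rightarrow> ('t \<Rightarrow> 'a set) \<Rightarrow> 't \<Rightarrow> 't \<Rightarrow> 'a set" where
  "edge_side T V s t = (\<Union>r\<in>component_of (delete_edge T {s, t}) s. V r)"

definition td_efficiently_distinguishes ::
    "'a ugraph \<Rightarrow> 't ugraph \<Rightarrow> ('t \<Rightarrow> 'a set) \<Rightarrow> 'a osep set \<Rightarrow> 'a osep set \<Rightarrow> bool" where
  "td_efficiently_distinguishes G T V P Q \<longleftrightarrow> (\<exists>s t. {s, t} \<in> edges T \<and>
     efficiently_distinguishes G (edge_side T V s t) (edge_side T V t s) P Q)"

definition canonical_on :: "'a ugraph set \<Rightarrow> ('a ugraph \<Rightarrow> ('t, 'a) treedec) \<Rightarrow> bool" where
  "canonical_on \<C> \<Psi> \<longleftrightarrow> (\<forall>G\<in>\<C>. \<forall>G'\<in>\<C>. \<forall>\<phi>. graph_iso \<phi> G G' \<longrightarrow>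
     (case (\<Psi> G, \<Psi> G') of ((T, V), (T', V')) \<Rightarrow>
        \<exists>h. graph_iso h T T' \<and> (\<forall>t\<in>verts T. V' (h t) = \<phi> ` V t)))"

text \<open>Infinite disconnected graphs must be left out. In the edgeless graph on \<open>\<nat>\<close> every ultrafilter
  \<open>U\<close> on \<open>\<nat>\<close> yields a \<open>1\<close>-profile \<open>{(A, B). A \<inter> B = {} \<and> A \<union> B = UNIV \<and> B \<in> U}\<close>. To tell apart two
  nonprincipal ultrafilters, a tree-decomposition needs an edge inducing a bipartition of \<open>\<nat>\<close> into
  two infinite sets; a canonical one then also induces the images of this bipartition under all
  permutations of \<open>\<nat>\<close>, some of which cross it. Likewise, no canonical tree-decomposition efficiently
  distinguishes all \<open>2\<close>-profiles in the disjoint union of a double ray and a single vertex.\<close>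

definition graph_class :: "'a ugraph set" where
  "graph_class = {G. simple_graph G \<and> locally_finite G \<and> (finite (verts G) \<or> connected_graph G)}"

text \<open>Nodes of decomposition trees are sets of oriented separations. The type only has to be large
  enough: if distinct edges of the tree induce distinct separations, a node is determined by the
  orientations towards it of these separations.\<close>

type_synonym 'a node = "'a osep set"

end

(* A separation of minimal order distinguishing two profiles has a component attached to its whole
   separator on either side, unless it is {V, X} with |X| at most 1. In a connected locally finite
   graph only finitely many such separations of order less than k have a separator containing a
   given vertex, since two vertices have only finitely many minimal separators of each size. So each
   of them crosses only finitely many others, and order by order one may select, for every pair of
   profiles, those efficient distinguishers that are nested with the earlier choices and cross the
   fewest candidates of the same order; uncrossing shows that the choices are nested.
   For every k-block b one then adds, for each component K of G - b with fewer than k neighbours that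
   is not yet cut off from b, the separation of K from b, enlarged so as to be nested with the
   earlier choices. Only finitely many of the selected separations lie between any two of them, so
   their orientations with a maximal element form a tree, whose edges induce these separations. *)

theory Submission
  imports Defs
begin

section \<open>Neighbourhoods, connected sets and components\<close>

text \<open>Canonicity forbids arbitrary choices: wherever a minimum is taken, all minimisers are
  kept, and ties must be shown nested too. This is what counting crossings is for. Two crossing
  efficient distinguishers of one order have opposite corners that, by submodularity, are again
  efficient of that order. A corner is nested with whatever both separations are nested with, and
  with the two separations themselves, so the corners together cross strictly fewer. The counts must
  be finite: this is where connectedness and local finiteness enter. Profiles may be irregular, that
  is, contain some \<open>(V, X)\<close>, because consistency says nothing about a separation and
  its own inverse. This exception accompanies tightness, the order on the chosen set and the
  definition of nodes. What separability adds to being a block is used once: the star bounds the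
  neighbourhood of every component of \<open>G - b\<close>. Block separations of distinct blocks are
  nested because an earlier choice distinguishes the profiles of the two blocks. Nodes are
  orientations rather than abstract points, so that an isomorphism acts on them by taking
  images.\<close>

definition nbhd :: "'a ugraph \<Rightarrow> 'a set \<Rightarrow> 'a set" where
  "nbhd G S = {v \<in> verts G - S. \<exists>u\<in>S. {u, v} \<in> edges G}"

text \<open>Connectedness by cuts instead of paths: it suits arguments that compare a connected set
  with a set of known neighbourhood.\<close>

definition conn_set :: "'a ugraph \<Rightarrow> 'a set \<Rightarrow> bool" where
  "conn_set G K \<longleftrightarrow> K \<noteq> {} \<and> (\<forall>S\<subseteq>K. S \<noteq> {} \<and> nbhd G S \<inter> K = {} \<longrightarrow> S = K)"

definition is_comp :: "'a ugraph \<Rightarrow> 'a set \<Rightarrow> 'a set \<Rightarrow> bool" where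
  "is_comp G X K \<longleftrightarrow> K \<subseteq> verts G - X \<and> conn_set G K \<and> nbhd G K \<subseteq> X"

lemma edge_verts:
  assumes "simple_graph G" "{u, v} \<in> edges G"
  shows "u \<in> verts G" "v \<in> verts G" "u \<noteq> v"
proof -
  have "{u, v} \<subseteq> verts G" "card {u, v} = 2"
    using assms by (auto simp: simple_graph_def)
  then show "u \<in> verts G" "v \<in> verts G" "u \<noteq> v"
    by auto
qed

lemma nbhd_subset: "nbhd G S \<subseteq> verts G" "nbhd G S \<inter> S = {}"
  by (auto simp: nbhd_def)

lemma nbhdI: "simple_graph G \<Longrightarrow> u \<in> S \<Longrightarrow> {u, v} \<in> edges G \<Longrightarrow> v \<notin> S \<Longrightarrow> v \<in> nbhd G S"
  using edge_verts(2) by (fastforce simp: nbhd_def)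

text \<open>A neighbour of \<open>K \<inter> S\<close> that lies in \<open>K\<close> but not in
  \<open>K \<inter> S\<close> lies outside \<open>S\<close>, hence in \<open>nbhd G S\<close>. So
  \<open>K \<inter> S\<close> is closed within \<open>K\<close>.\<close>

lemma conn_set_subset:
  assumes "conn_set G K" "K \<inter> S \<noteq> {}" "nbhd G S \<inter> K = {}"
  shows "K \<subseteq> S"
proof -
  have "nbhd G (K \<inter> S) \<inter> K = {}"
    using assms(3) by (auto simp: nbhd_def)
  then have "K \<inter> S = K"
    using assms(1,2) unfolding conn_set_def by (metis inf_le1)
  then show ?thesis by blast
qed

lemma compD:
  assumes "is_comp G X K"
  shows "K \<subseteq> verts G" "K \<inter> X = {}" "K \<noteq> {}" "conn_set G K" "nbhd G K \<subseteq> X"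
  using assms by (auto simp: is_comp_def conn_set_def)

lemma conn_set_subset_comp:
  assumes "conn_set G L" "is_comp G X K" "L \<inter> X = {}" "L \<inter> K \<noteq> {}"
  shows "L \<subseteq> K"
  using conn_set_subset[of G L K] assms compD(5)[OF assms(2)] by blast

lemma comp_eq:
  assumes "is_comp G X K" "is_comp G X L" "K \<inter> L \<noteq> {}"
  shows "K = L"
  using conn_set_subset_comp[of G K X L] conn_set_subset_comp[of G L X K] compD[OF assms(1)]
    compD[OF assms(2)] assms by blast

text \<open>The passage from reachability, as in the definitions, to neighbourhoods.\<close>

lemma conn_set_reachable:
  assumes "simple_graph G" "v \<in> verts G - X"
  shows "is_comp G X (component_of (induced G (verts G - X)) v)"
proof -
  let ?H = "induced G (verts G - X)"
  let ?R = "{(x, y). {x, y} \<in> edges ?H}"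
  let ?K = "component_of ?H v"
  have K: "?K = {w \<in> verts G - X. (v, w) \<in> ?R\<^sup>*}"
    using assms(2) by (auto simp: component_of_def reachable_def induced_def)
  have v: "v \<in> ?K" using K assms(2) by auto
  have sym: "(x, y) \<in> ?R \<Longrightarrow> (y, x) \<in> ?R" for x y
    by (simp add: insert_commute)
  have symc: "(x, y) \<in> ?R\<^sup>* \<Longrightarrow> (y, x) \<in> ?R\<^sup>*" for x y
    using sym sym_rtrancl[of ?R] unfolding sym_def by blast
  have nb: "nbhd G ?K \<subseteq> X"
  proof
    fix w assume "w \<in> nbhd G ?K"
    then obtain u where w: "w \<in> verts G" "w \<notin> ?K" and u: "u \<in> ?K" "{u, w} \<in> edges G"
      by (auto simp: nbhd_def)
    show "w \<in> X"
    proof (rule ccontr)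
      assume "w \<notin> X"
      then have "(u, w) \<in> ?R" using u w K by (auto simp: induced_def)
      then have "(v, w) \<in> ?R\<^sup>*" using u K by (auto intro: rtrancl_into_rtrancl)
      then show False using w \<open>w \<notin> X\<close> K by auto
    qed
  qed
  have "S = ?K" if S: "S \<subseteq> ?K" "S \<noteq> {}" "nbhd G S \<inter> ?K = {}" for S
  proof -
    obtain s where s: "s \<in> S" using S by auto
    have "w \<in> S" if "(s, w) \<in> ?R\<^sup>*" for w using that
    proof (induction rule: rtrancl_induct)
      case (step y z)
      then have yz: "{y, z} \<in> edges G" "z \<in> verts G - X" by (auto simp: induced_def)
      have "(v, y) \<in> ?R\<^sup>*" using step(3) S(1) K by blast
      then have "(v, z) \<in> ?R\<^sup>*" using step(2) by (rule rtrancl_into_rtrancl)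
      then have "z \<in> ?K" using K yz by auto
      then show ?case using S(3) step yz by (auto simp: nbhd_def)
    qed (use s in auto)
    moreover have "(s, w) \<in> ?R\<^sup>*" if "w \<in> ?K" for w
    proof (rule rtrancl_trans)
      show "(s, v) \<in> ?R\<^sup>*" using s S(1) K symc by blast
      show "(v, w) \<in> ?R\<^sup>*" using that K by blast
    qed
    ultimately show ?thesis using S by auto
  qed
  then have "conn_set G ?K"
    unfolding conn_set_def using v by blast
  then show ?thesis unfolding is_comp_def using nb K by auto
qed

lemma comp_exists:
  assumes "simple_graph G" "v \<in> verts G - X"
  obtains K where "is_comp G X K" "v \<in> K"
proof
  show "is_comp G X (component_of (induced G (verts G - X)) v)"
    by (rule conn_set_reachable) fact+
  show "v \<in> component_of (induced G (verts G - X)) v"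
    using assms(2) by (auto simp: component_of_def reachable_def induced_def)
qed

lemma connected_graph_conn_set:
  assumes "simple_graph G" "connected_graph G" "verts G \<noteq> {}"
  shows "conn_set G (verts G)"
proof -
  obtain v where v: "v \<in> verts G" using assms by auto
  have "{e \<in> edges G. e \<subseteq> verts G} = edges G"
    using assms(1) by (auto simp: simple_graph_def)
  then have "induced G (verts G) = G"
    by (simp add: induced_def)
  then have "component_of (induced G (verts G - {})) v = verts G"
    using assms v by (auto simp: component_of_def connected_graph_def reachable_def)
  then show ?thesis using conn_set_reachable[OF assms(1), of v "{}"] v compD(4) by fastforce
qed

lemma closed_set_connected:
  assumes "simple_graph G" "connected_graph G" "S \<subseteq> verts G" "S \<noteq> {}" "nbhd G S = {}"
  shows "S = verts G"
  using connected_graph_conn_set[OF assms(1,2)] assms(3-5) unfolding conn_set_def by auto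

lemma comp_of_nbhd:
  "is_comp G X K \<Longrightarrow> is_comp G (nbhd G K) K"
  by (auto simp: is_comp_def nbhd_def)

section \<open>Finitely many tight separations near a vertex\<close>

text \<open>\<open>Z\<close> separates \<open>u\<close> from \<open>w\<close>. The witness
  \<open>S\<close> is a union of components of \<open>G - Z\<close>, which again avoids paths; that
  \<open>u\<close> lies outside \<open>Z\<close> is implied.\<close>

definition sepr :: "'a ugraph \<Rightarrow> 'a set \<Rightarrow> 'a \<Rightarrow> 'a \<Rightarrow> bool" where
  "sepr G Z u w \<longleftrightarrow> w \<notin> Z \<and> (\<exists>S\<subseteq>verts G. u \<in> S \<and> w \<notin> S \<and> S \<inter> Z = {} \<and> nbhd G S \<subseteq> Z)"

lemma sepr_mono:
  assumes "sepr G Y u w" "u \<notin> X" "w \<notin> X"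
  shows "sepr G (Y \<union> X) u w"
proof -
  obtain S where S: "S \<subseteq> verts G" "u \<in> S" "w \<notin> S" "S \<inter> Y = {}" "nbhd G S \<subseteq> Y" "w \<notin> Y"
    using assms(1) by (auto simp: sepr_def)
  have "nbhd G (S - X) \<subseteq> Y \<union> X"
    using S(5) by (auto simp: nbhd_def)
  then show ?thesis
    unfolding sepr_def using S assms by (intro conjI exI[of _ "S - X"]) auto
qed

text \<open>\<open>W\<close> plays the role of the vertex set of a path from \<open>u\<close> to
  \<open>w\<close> avoiding \<open>Y\<close>. In the proof, \<open>good z W\<close> says that a
  separator avoiding \<open>W\<close> cannot cut \<open>z\<close> off from \<open>u\<close>. Passing
  from a good vertex to a neighbour outside \<open>Y\<close> enlarges \<open>W\<close> by one
  vertex, so the good vertices have no neighbours outside \<open>Y\<close>; if \<open>w\<close> were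
  not among them, they would witness that \<open>Y\<close> separates.\<close>

lemma finite_connector:
  assumes "simple_graph G" "u \<in> verts G - Y" "w \<in> verts G - Y" "\<not> sepr G Y u w"
  obtains W where "finite W" "\<And>X. X \<inter> W = {} \<Longrightarrow> \<not> sepr G (Y \<union> X) u w"
proof -
  define good where "good = (\<lambda>z W. finite W \<and> (\<forall>X S. X \<inter> W = {} \<and> S \<subseteq> verts G \<and> u \<in> S \<and>
     S \<inter> (Y \<union> X) = {} \<and> nbhd G S \<subseteq> Y \<union> X \<longrightarrow> z \<in> S))"
  define S0 where "S0 = {z \<in> verts G - Y. \<exists>W. good z W}"
  have "good u {}" by (auto simp: good_def)
  then have u: "u \<in> S0" using assms by (auto simp: S0_def)
  have "nbhd G S0 \<subseteq> Y"
  proof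
    fix z assume "z \<in> nbhd G S0"
    then obtain v where z: "z \<in> verts G" "z \<notin> S0" and v: "v \<in> S0" "{v, z} \<in> edges G"
      by (auto simp: nbhd_def)
    obtain W where W: "good v W" using v by (auto simp: S0_def)
    show "z \<in> Y"
    proof (rule ccontr)
      assume zY: "z \<notin> Y"
      have "good z (insert z W)"
        unfolding good_def
      proof (intro conjI allI impI)
        show "finite (insert z W)" using W by (auto simp: good_def)
        fix X S assume *: "X \<inter> insert z W = {} \<and> S \<subseteq> verts G \<and> u \<in> S \<and>
          S \<inter> (Y \<union> X) = {} \<and> nbhd G S \<subseteq> Y \<union> X"
        have "X \<inter> W = {}" using * by blast
        moreover have "\<forall>X S. X \<inter> W = {} \<and> S \<subseteq> verts G \<and> u \<in> S \<and>
            S \<inter> (Y \<union> X) = {} \<and> nbhd G S \<subseteq> Y \<union> X \<longrightarrow> v \<in> S"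
          using W unfolding good_def by (rule conjunct2)
        ultimately have "v \<in> S" using * by meson
        then have "z \<in> S \<or> z \<in> nbhd G S" using nbhdI[OF assms(1), of v S z] v by blast
        then show "z \<in> S" using * zY by blast
      qed
      then show False using z zY by (auto simp: S0_def)
    qed
  qed
  moreover have "S0 \<subseteq> verts G" "S0 \<inter> Y = {}" by (auto simp: S0_def)
  ultimately have "w \<in> S0"
    using assms(3,4) u unfolding sepr_def by blast
  then obtain W where W: "good w W" by (auto simp: S0_def)
  then have W2: "\<forall>X S. X \<inter> W = {} \<and> S \<subseteq> verts G \<and> u \<in> S \<and>
      S \<inter> (Y \<union> X) = {} \<and> nbhd G S \<subseteq> Y \<union> X \<longrightarrow> w \<in> S"
    unfolding good_def by (rule conjunct2)
  have "\<not> sepr G (Y \<union> X) u w" if "X \<inter> W = {}" for X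
    using that W2 unfolding sepr_def by meson
  moreover have "finite W" using W by (simp add: good_def)
  ultimately show ?thesis using that by blast
qed

text \<open>A minimal separator meets any fixed path between \<open>u\<close> and \<open>w\<close>; deleting a common vertex
  reduces the size.\<close>

lemma finite_minimal_separators:
  assumes "simple_graph G"
  shows "finite {X. finite X \<and> card X = n \<and> X \<inter> Y = {} \<and> sepr G (Y \<union> X) u w \<and>
    (\<forall>x\<in>X. \<not> sepr G (Y \<union> (X - {x})) u w)}" (is "finite (?M n Y)")
proof (induction n arbitrary: Y)
  case 0
  have "?M 0 Y \<subseteq> {{}}" by auto
  then show ?case using finite_subset by blast
next
  case (Suc n)
  show ?case
  proof (cases "sepr G Y u w \<or> u \<notin> verts G - Y \<or> w \<notin> verts G - Y")
    \<comment> \<open>\<open>Y\<close> separates already, or an end is missing. Then no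
      \<open>X\<close> of positive size is minimal, since an element of it could be dropped; if
      \<open>w\<close> is not a vertex, any set avoiding the ends separates.\<close>
    case True
    have emp: "?M (Suc n) Y = {}"
    proof (rule ccontr)
      assume "\<not> ?thesis"
      then obtain X where X: "finite X" "card X = Suc n" "X \<inter> Y = {}" "sepr G (Y \<union> X) u w"
        "\<forall>x\<in>X. \<not> sepr G (Y \<union> (X - {x})) u w" by auto
      then obtain x where x: "x \<in> X" by fastforce
      have uw: "u \<notin> Y \<union> X" "w \<notin> Y \<union> X" "u \<in> verts G" using X(4) by (auto simp: sepr_def)
      show False
      proof (cases "w \<in> verts G")
        case True
        then have "sepr G Y u w" using uw \<open>sepr G Y u w \<or> _\<close> by auto
        then show False using sepr_mono[of G Y u w "X - {x}"] uw X(5) x by auto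
      next
        case False
        then have "sepr G (Y \<union> (X - {x})) u w"
          unfolding sepr_def using uw
          by (intro conjI exI[of _ "verts G - (Y \<union> (X - {x}))"]) (auto simp: nbhd_def)
        then show False using X(5) x by auto
      qed
    qed
    show ?thesis unfolding emp by (rule finite.emptyI)
  next
    case False
    then obtain W where W: "finite W" "\<And>X. X \<inter> W = {} \<Longrightarrow> \<not> sepr G (Y \<union> X) u w"
      using finite_connector[OF assms, of u Y w] by auto
    have "?M (Suc n) Y \<subseteq> (\<Union>x\<in>W. insert x ` ?M n (insert x Y))"
    proof
      fix X assume "X \<in> ?M (Suc n) Y"
      then have X: "finite X" "card X = Suc n" "X \<inter> Y = {}" "sepr G (Y \<union> X) u w"
        "\<forall>x\<in>X. \<not> sepr G (Y \<union> (X - {x})) u w" by auto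
      then obtain x where x: "x \<in> X" "x \<in> W" using W(2)[of X] by auto
      have "insert x Y \<union> (X - {x}) = Y \<union> X" using x by auto
      moreover have "insert x Y \<union> (X - {x} - {y}) = Y \<union> (X - {y})" if "y \<in> X - {x}" for y
        using x that by auto
      ultimately have "X - {x} \<in> ?M n (insert x Y)"
        using X x by auto
      moreover have "X = insert x (X - {x})" using x by auto
      ultimately show "X \<in> (\<Union>x\<in>W. insert x ` ?M n (insert x Y))"
        by (intro UN_I[OF x(2)] image_eqI)
    qed
    moreover have "finite (\<Union>x\<in>W. insert x ` ?M n (insert x Y))"
      by (intro finite_UN_I W(1) finite_imageI Suc.IH)
    ultimately show ?thesis by (rule finite_subset)
  qed
qed

definition tight :: "'a ugraph \<Rightarrow> 'a set \<Rightarrow> bool" where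
  "tight G X \<longleftrightarrow> (\<exists>K L. is_comp G X K \<and> is_comp G X L \<and> K \<noteq> L \<and> nbhd G K = X \<and> nbhd G L = X)"

lemma finite_nbhd:
  assumes "simple_graph G" "locally_finite G" "finite S"
  shows "finite (nbhd G S)"
proof -
  have "finite (nbhd G {u})" for u
  proof (cases "u \<in> verts G")
    case True
    have "(\<lambda>v. {u, v}) ` nbhd G {u} \<subseteq> {e \<in> edges G. u \<in> e}"
      by (auto simp: nbhd_def)
    moreover have "inj_on (\<lambda>v. {u, v}) (nbhd G {u})"
      by (auto simp: inj_on_def doubleton_eq_iff)
    ultimately show ?thesis
      using assms(2) True unfolding locally_finite_def by (meson finite_imageD finite_subset)
  next
    case False
    then have "nbhd G {u} = {}" using edge_verts[OF assms(1)] by (auto simp: nbhd_def)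
    then show ?thesis by simp
  qed
  then have "finite (\<Union>u\<in>S. nbhd G {u})" using assms(3) by blast
  moreover have "nbhd G S \<subseteq> (\<Union>u\<in>S. nbhd G {u})" by (auto simp: nbhd_def)
  ultimately show ?thesis by (rule finite_subset[rotated])
qed

text \<open>A tight \<open>X\<close> through \<open>x\<close> is a minimal separator of two
  neighbours \<open>u\<close>, \<open>w\<close> of \<open>x\<close>, taken from two components
  attached to all of \<open>X\<close>: without a vertex \<open>y\<close> of \<open>X\<close> these
  components would be joined through \<open>y\<close>. By local finiteness there are finitely many
  such pairs.\<close>

lemma finite_tight_through:
  assumes G: "simple_graph G" "locally_finite G"
  shows "finite {X. tight G X \<and> finite X \<and> card X = n \<and> x \<in> X}"
proof -
  let ?M = "\<lambda>u w. {X. finite X \<and> card X = n \<and> X \<inter> {} = {} \<and> sepr G ({} \<union> X) u w \<and>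
    (\<forall>x\<in>X. \<not> sepr G ({} \<union> (X - {x})) u w)}"
  let ?N = "nbhd G {x}"
  have "{X. tight G X \<and> finite X \<and> card X = n \<and> x \<in> X} \<subseteq> (\<Union>u\<in>?N. \<Union>w\<in>?N. ?M u w)"
  proof
    fix X assume "X \<in> {X. tight G X \<and> finite X \<and> card X = n \<and> x \<in> X}"
    then obtain K L where X: "finite X" "card X = n" "x \<in> X" and K: "is_comp G X K" "nbhd G K = X"
      and L: "is_comp G X L" "nbhd G L = X" and KL: "K \<noteq> L" by (auto simp: tight_def)
    have disj: "K \<inter> L = {}" using comp_eq K L KL by metis
    obtain u where u: "u \<in> K" "{u, x} \<in> edges G" using X(3) K(2) by (auto simp: nbhd_def)
    obtain w where w: "w \<in> L" "{w, x} \<in> edges G" using X(3) L(2) by (auto simp: nbhd_def)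
    have "u \<in> ?N" "w \<in> ?N"
      using u w compD[OF K(1)] compD[OF L(1)] X(3) by (auto simp: nbhd_def insert_commute)
    moreover have "sepr G X u w"
      unfolding sepr_def using compD[OF K(1)] compD[OF L(1)] u w disj
      by (intro conjI exI[of _ K]) auto
    moreover have "\<not> sepr G (X - {y}) u w" if y: "y \<in> X" for y
    proof (rule notI)
      assume "sepr G (X - {y}) u w"
      then obtain S where S: "u \<in> S" "w \<notin> S" "S \<inter> (X - {y}) = {}" "nbhd G S \<subseteq> X - {y}"
        by (auto simp: sepr_def)
      have sub: "C \<subseteq> S" if "is_comp G X C" "C \<inter> S \<noteq> {}" for C
        using conn_set_subset[of G C S] compD[OF that(1)] that(2) S(4) by blast
      have "K \<subseteq> S" using sub K(1) u S(1) by blast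
      obtain z where z: "z \<in> K" "{z, y} \<in> edges G" using y K(2) by (auto simp: nbhd_def)
      have "y \<in> S" using nbhdI[OF G(1), of z S y] z \<open>K \<subseteq> S\<close> S(4) by blast
      obtain z' where z': "z' \<in> L" "{z', y} \<in> edges G" using y L(2) by (auto simp: nbhd_def)
      then have "z' \<in> S \<or> z' \<in> nbhd G S"
        using nbhdI[OF G(1), of y S z'] \<open>y \<in> S\<close> by (auto simp: insert_commute)
      then have "z' \<in> S" using S(4) z' compD[OF L(1)] by blast
      then show False using sub[OF L(1)] z' w S(2) by blast
    qed
    ultimately show "X \<in> (\<Union>u\<in>?N. \<Union>w\<in>?N. ?M u w)" using X by auto
  qed
  moreover have "finite (\<Union>u\<in>?N. \<Union>w\<in>?N. ?M u w)"
    using finite_nbhd[OF G, of "{x}"] finite_minimal_separators[OF G(1)] by blast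
  ultimately show ?thesis by (rule finite_subset)
qed

text \<open>In a connected graph, a component of \<open>G - X\<close> other than \<open>G\<close>
  itself contains a vertex of the finite set \<open>nbhd G X\<close>, and is determined by
  it.\<close>

lemma finite_comps:
  assumes G: "G \<in> graph_class" and X: "finite X"
  shows "finite {K. is_comp G X K}"
proof (cases "finite (verts G)")
  case True
  then show ?thesis
    by (rule finite_subset[OF _ finite_Pow_iff[THEN iffD2], rotated]) (auto simp: is_comp_def)
next
  case False
  then have s: "simple_graph G" "locally_finite G" "connected_graph G"
    using G by (auto simp: graph_class_def)
  have "{K. is_comp G X K} \<subseteq> insert (verts G) (\<Union>v\<in>nbhd G X. {K. is_comp G X K \<and> v \<in> K})"
  proof
    fix K assume "K \<in> {K. is_comp G X K}"
    then have K: "is_comp G X K" by simp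
    show "K \<in> insert (verts G) (\<Union>v\<in>nbhd G X. {K. is_comp G X K \<and> v \<in> K})"
    proof (cases "nbhd G K = {}")
      case True
      then show ?thesis using closed_set_connected[OF s(1,3)] compD[OF K] by blast
    next
      case False
      then obtain x where xK: "x \<in> nbhd G K" by blast
      then obtain u where "u \<in> K" "{u, x} \<in> edges G" by (auto simp: nbhd_def)
      then have x: "x \<in> X" "u \<in> K" "{u, x} \<in> edges G" using xK compD(5)[OF K] by blast+
      then have "u \<in> nbhd G X" using compD[OF K] by (auto simp: nbhd_def insert_commute)
      then show ?thesis using K x by auto
    qed
  qed
  moreover have "finite {K. is_comp G X K \<and> v \<in> K}" for v
  proof -
    have "{K. is_comp G X K \<and> v \<in> K} \<subseteq> {THE K. is_comp G X K \<and> v \<in> K}"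
      using comp_eq[of G X] by (auto intro!: the_equality[symmetric])
    then show ?thesis by (rule finite_subset) simp
  qed
  ultimately show ?thesis using finite_nbhd[OF s(1,2) X]
    by (meson finite.insertI finite_UN finite_subset)
qed

section \<open>Separations\<close>

lemma sepI_nbhd:
  assumes "simple_graph G" "S \<subseteq> verts G" "X \<subseteq> verts G" "nbhd G S \<subseteq> X"
  shows "is_separation G (S \<union> X) (verts G - S)"
  using assms nbhdI[OF assms(1), of _ S] unfolding is_separation_def by blast

lemma sep_commute: "is_separation G A B \<longleftrightarrow> is_separation G B A"
proof -
  have "is_separation G B A" if s: "is_separation G A B" for A B
    unfolding is_separation_def
  proof (intro conjI ballI)
    show "B \<union> A = verts G" using s by (auto simp: is_separation_def)
    fix u v assume "u \<in> B - A" "v \<in> A - B"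
    then have "{v, u} \<notin> edges G" using s by (auto simp: is_separation_def)
    then show "{u, v} \<notin> edges G" by (simp add: insert_commute[of u v])
  qed
  then show ?thesis by blast
qed

lemma sep_edgeD:
  "is_separation G A B \<Longrightarrow> u \<in> A - B \<Longrightarrow> {u, v} \<in> edges G \<Longrightarrow> v \<in> verts G \<Longrightarrow> v \<in> A"
  unfolding is_separation_def by blast

lemma sep_nbhd: "is_separation G A B \<Longrightarrow> nbhd G (A - B) \<subseteq> A \<inter> B"
  unfolding is_separation_def nbhd_def by blast

lemma sep_verts: "is_separation G A B \<Longrightarrow> A \<union> B = verts G"
  by (simp add: is_separation_def)

lemma sep_comp:
  assumes "is_separation G A B" "conn_set G K" "K \<subseteq> verts G" "K \<inter> (A \<inter> B) = {}"
  shows "K \<subseteq> A - B \<or> K \<subseteq> B - A"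
proof (cases "K \<inter> (A - B) = {}")
  case True
  then show ?thesis using assms sep_verts by blast
next
  case False
  then show ?thesis using conn_set_subset[OF assms(2) False] sep_nbhd[OF assms(1)] assms(4) by blast
qed

lemma sep_corner:
  assumes "is_separation G A B" "is_separation G C D"
  shows "is_separation G (A \<union> C) (B \<inter> D)" "is_separation G (A \<inter> C) (B \<union> D)"
  using assms unfolding is_separation_def by blast+

text \<open>Such a separation is determined by the components of \<open>G - X\<close> that lie on
  its first side.\<close>

lemma finite_seps_with_separator:
  assumes G: "G \<in> graph_class" and X: "finite X"
  shows "finite {(A, B). is_separation G A B \<and> A \<inter> B = X}"
proof -
  have s: "simple_graph G" using G by (simp add: graph_class_def)
  have "{(A, B). is_separation G A B \<and> A \<inter> B = X} \<subseteq>
     (\<lambda>\<K>. (X \<union> \<Union>\<K>, verts G - \<Union>\<K>)) ` Pow {K. is_comp G X K}"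
  proof clarify
    fix A B assume AB: "is_separation G A B" "X = A \<inter> B"
    let ?K = "{K. is_comp G (A \<inter> B) K \<and> K \<subseteq> A - B}"
    have "v \<in> \<Union>?K" if v: "v \<in> A - B" for v
    proof -
      have "v \<in> verts G - A \<inter> B" using v sep_verts[OF AB(1)] by blast
      then obtain K where K: "is_comp G (A \<inter> B) K" "v \<in> K" using comp_exists[OF s] by metis
      then have "K \<subseteq> A - B" using sep_comp[OF AB(1), of K] compD[OF K(1)] v by blast
      then show ?thesis using K by blast
    qed
    then have e: "\<Union>?K = A - B" by blast
    have "(A, B) = ((A \<inter> B) \<union> \<Union>?K, verts G - \<Union>?K)"
      unfolding e using sep_verts[OF AB(1)] by auto
    then show "(A, B) \<in> (\<lambda>\<K>. (A \<inter> B \<union> \<Union>\<K>, verts G - \<Union>\<K>)) ` Pow {K. is_comp G (A \<inter> B) K}"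
      by blast
  qed
  then show ?thesis using finite_comps[OF G X] by (meson finite_Pow_iff finite_imageI finite_subset)
qed

section \<open>Nested and tight separations, finiteness of crossings\<close>

definition nested :: "'a osep \<Rightarrow> 'a osep \<Rightarrow> bool" where
  "nested r s \<longleftrightarrow> osep_le r s \<or> osep_le r (prod.swap s) \<or> osep_le (prod.swap r) s \<or>
     osep_le (prod.swap r) (prod.swap s)"

text \<open>The degenerate case comes from irregular profiles, those containing some \<open>(V, X)\<close>.\<close>

definition half_tight :: "'a ugraph \<Rightarrow> 'a set \<Rightarrow> 'a set \<Rightarrow> bool" where
  "half_tight G A B \<longleftrightarrow> (\<exists>K. is_comp G (A \<inter> B) K \<and> K \<subseteq> A - B \<and> nbhd G K = A \<inter> B) \<or>
     (B = verts G \<and> finite A \<and> card A \<le> 1)"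

definition tight_seps :: "nat \<Rightarrow> 'a ugraph \<Rightarrow> 'a osep set" where
  "tight_seps k G = {(A, B). is_separation G A B \<and> finite (A \<inter> B) \<and> card (A \<inter> B) < k \<and>
     half_tight G A B \<and> half_tight G B A}"

text \<open>If both sides have a component attached to the whole separator, the separator is tight
  and contains some \<open>w\<close> in \<open>W\<close>. Otherwise it has at most one vertex, so it
  is \<open>{w}\<close>; this is why \<open>{w}\<close> is inserted below.\<close>

lemma finite_tight_seps_meeting:
  assumes G: "G \<in> graph_class" and W: "finite W"
  shows "finite {(A, B) \<in> tight_seps k G. A \<inter> B \<inter> W \<noteq> {}}"
proof -
  have s: "simple_graph G" "locally_finite G" using G by (auto simp: graph_class_def)
  let ?X = "\<lambda>w. insert {w} (\<Union>n<k. {X. tight G X \<and> finite X \<and> card X = n \<and> w \<in> X})"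
  have 1: "finite (?X w)" for w using finite_tight_through[OF s] by blast
  have "{(A, B) \<in> tight_seps k G. A \<inter> B \<inter> W \<noteq> {}} \<subseteq>
     (\<Union>w\<in>W. \<Union>X\<in>?X w. {(A, B). is_separation G A B \<and> A \<inter> B = X})"
  proof clarify
    fix A B assume *: "(A, B) \<in> tight_seps k G" "A \<inter> B \<inter> W \<noteq> {}"
    then obtain w where w: "w \<in> A" "w \<in> B" "w \<in> W" by blast
    have AB: "is_separation G A B" "finite (A \<inter> B)" "card (A \<inter> B) < k"
      "half_tight G A B" "half_tight G B A"
      using * by (auto simp: tight_seps_def)
    have "tight G (A \<inter> B) \<or> card (A \<inter> B) \<le> 1"
    proof (cases "(B = verts G \<and> finite A \<and> card A \<le> 1) \<or> (A = verts G \<and> finite B \<and> card B \<le> 1)")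
      case True
      then show ?thesis by (meson card_mono inf_le1 inf_le2 le_trans)
    next
      case False
      then obtain K where K: "is_comp G (A \<inter> B) K" "K \<subseteq> A - B" "nbhd G K = A \<inter> B"
        using AB(4) by (auto simp: half_tight_def)
      moreover obtain L where L: "is_comp G (A \<inter> B) L" "L \<subseteq> B - A" "nbhd G L = A \<inter> B"
        using False AB(5) by (auto simp: half_tight_def Int_commute)
      moreover have "K \<noteq> {}" using compD(3)[OF K(1)] .
      ultimately have "K \<noteq> L" by blast
      then show ?thesis unfolding tight_def using K L by blast
    qed
    moreover have "A \<inter> B = {w}" if "card (A \<inter> B) \<le> 1"
    proof -
      have "card (A \<inter> B) \<noteq> 0" using AB(2) w by auto
      then have "card (A \<inter> B) = 1" using that by linarith
      then obtain y where "A \<inter> B = {y}" by (rule card_1_singletonE)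
      moreover have "w \<in> A \<inter> B" using w by simp
      ultimately show ?thesis by simp
    qed
    ultimately have "A \<inter> B \<in> ?X w" using AB w by auto
    then show "(A, B) \<in> (\<Union>w\<in>W. \<Union>X\<in>?X w. {(A, B). is_separation G A B \<and> A \<inter> B = X})"
      using w(3) AB(1) by blast
  qed
  moreover have "finite (\<Union>w\<in>W. \<Union>X\<in>?X w. {(A, B). is_separation G A B \<and> A \<inter> B = X})"
  proof (intro finite_UN_I W 1)
    fix w X assume "X \<in> ?X w"
    then have "finite X" by auto
    then show "finite {(A, B). is_separation G A B \<and> A \<inter> B = X}"
      by (rule finite_seps_with_separator[OF G])
  qed
  ultimately show ?thesis by (rule finite_subset)
qed

lemma finite_tight_seps_if_finite:
  assumes "finite (verts G)"
  shows "finite (tight_seps k G)"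
proof -
  have "tight_seps k G \<subseteq> Pow (verts G) \<times> Pow (verts G)"
    by (auto simp: tight_seps_def is_separation_def)
  then show ?thesis using assms finite_subset by blast
qed

lemma connected_finite_connector:
  assumes "simple_graph G" "connected_graph G" "u \<in> verts G" "w \<in> verts G"
  obtains W where "finite W" "\<And>X. X \<inter> W = {} \<Longrightarrow> \<not> sepr G X u w"
proof -
  have "\<not> sepr G {} u w"
    using closed_set_connected[OF assms(1,2)] assms(4) by (auto simp: sepr_def)
  then show ?thesis using finite_connector[OF assms(1), of u "{}" w] assms that by auto
qed

lemma sep_sepr:
  "is_separation G A B \<Longrightarrow> u \<in> A - B \<Longrightarrow> w \<in> B - A \<Longrightarrow> sepr G (A \<inter> B) u w"
  using sep_nbhd[of G A B] sep_verts[of G A B] unfolding sepr_def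
  by (intro conjI exI[of _ "A - B"]) auto

text \<open>Unless \<open>v\<close> or \<open>x\<close> lies in the separator, the separator
  separates them and therefore meets the finite connector \<open>W\<close>. This later bounds
  intervals in the nested set.\<close>

lemma finite_tight_seps_between:
  assumes G: "G \<in> graph_class" and v: "v \<in> verts G" "x \<in> verts G"
  shows "finite {(A, B) \<in> tight_seps k G. v \<in> A \<and> x \<in> B}"
proof (cases "finite (verts G)")
  case True
  show ?thesis
    by (rule finite_subset[OF _ finite_tight_seps_if_finite[OF True, of k]]) auto
next
  case False
  then have s: "simple_graph G" "connected_graph G"
    using G by (auto simp: graph_class_def)
  obtain W where W: "finite W" "\<And>X. X \<inter> W = {} \<Longrightarrow> \<not> sepr G X v x"
    using connected_finite_connector[OF s v] by metis
  have "{(A, B) \<in> tight_seps k G. v \<in> A \<and> x \<in> B} \<subseteq>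
     {(A, B) \<in> tight_seps k G. A \<inter> B \<inter> insert v (insert x W) \<noteq> {}}"
  proof clarify
    fix A B assume *: "(A, B) \<in> tight_seps k G" "v \<in> A" "x \<in> B" "A \<inter> B \<inter> insert v (insert x W) = {}"
    then have "sepr G (A \<inter> B) v x" by (intro sep_sepr) (auto simp: tight_seps_def)
    then show False using W(2) * by blast
  qed
  then show ?thesis
    using finite_tight_seps_meeting[OF G] W(1) by (meson finite.insertI finite_subset)
qed

text \<open>At most one vertex always fits on one side of \<open>(C, D)\<close>, and
  \<open>B\<close> contains everything.\<close>

lemma trivial_nested:
  assumes "is_separation G C D" "B = verts G" "finite A" "card A \<le> 1" "A \<subseteq> verts G"
  shows "nested (A, B) (C, D)"
proof -
  have "A \<subseteq> C \<or> A \<subseteq> D"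
  proof (cases "A = {}")
    case False
    then have "card A = 1" using assms(3,4) by (simp add: le_Suc_eq card_eq_0_iff)
    then obtain y where "A = {y}" by (rule card_1_singletonE)
    then show ?thesis using assms sep_verts[OF assms(1)] by blast
  qed simp
  then show ?thesis using sep_verts[OF assms(1)] assms(2) by (auto simp: nested_def osep_le_def)
qed

lemma nested_sym: "nested r s \<longleftrightarrow> nested s r"
  by (auto simp: nested_def osep_le_def)

lemma nested_swap [simp]: "nested (prod.swap r) s \<longleftrightarrow> nested r s"
  "nested r (prod.swap s) \<longleftrightarrow> nested r s"
  by (auto simp: nested_def osep_le_def)

text \<open>A component \<open>L\<close> on the side of \<open>C\<close> attached to all of
  \<open>C \<inter> D\<close> avoids \<open>A \<inter> B\<close>, so it lies in
  \<open>A - B\<close>, say. Then \<open>C \<inter> D\<close> lies there too, and the corner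
  \<open>(C - D) \<inter> (B - A)\<close> has no neighbours. As \<open>G\<close> is connected and
  \<open>A \<inter> B\<close> is not empty, the corner is empty, whence
  \<open>(C, D) \<le> (A, B)\<close>. The degenerate form of \<open>half_tight\<close> is nested
  with everything.\<close>

lemma nested_if_separator_disjoint:
  assumes s: "simple_graph G" "connected_graph G"
    and AB: "is_separation G A B" "A \<inter> B \<noteq> {}"
    and CD: "is_separation G C D" "half_tight G C D" and disj: "A \<inter> B \<subseteq> D - C"
  shows "nested (A, B) (C, D)"
proof (cases "D = verts G \<and> finite C \<and> card C \<le> 1")
  case True
  then show ?thesis
    using trivial_nested[OF AB(1), of D C] sep_verts[OF CD(1)] by (subst nested_sym) auto
next
  case False
  then obtain L where L: "is_comp G (C \<inter> D) L" "L \<subseteq> C - D" "nbhd G L = C \<inter> D"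
    using CD(2) by (auto simp: half_tight_def)
  have "nested (A, B) (C, D)" if AB: "is_separation G A B" "A \<inter> B \<noteq> {}" "A \<inter> B \<subseteq> D - C"
    and LA: "L \<subseteq> A - B" for A B
  proof -
    have "nbhd G L \<subseteq> A"
      using LA sep_nbhd[OF AB(1)] by (fastforce simp: nbhd_def)
    then have CD_A: "C \<inter> D \<subseteq> A - B" using L(3) AB(3) by blast
    let ?S = "(C - D) \<inter> (B - A)"
    have "nbhd G ?S = {}"
    proof (rule ccontr)
      assume "nbhd G ?S \<noteq> {}"
      then obtain u v where uv: "v \<notin> ?S" "u \<in> ?S" "{u, v} \<in> edges G" "v \<in> verts G"
        by (auto simp: nbhd_def)
      have "v \<in> C" using sep_edgeD[OF CD(1), of u v] uv by blast
      moreover have "v \<in> B"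
        using sep_edgeD[of G B A u v] AB(1) sep_commute[of G A B] uv by blast
      ultimately show False using uv CD_A AB(3) by blast
    qed
    then have "?S = {} \<or> ?S = verts G"
      using closed_set_connected[OF s, of ?S] sep_verts[OF AB(1)] by blast
    then have "?S = {}" using AB(2) sep_verts[OF AB(1)] by blast
    then have "C \<subseteq> A" "B \<subseteq> D"
      using CD_A AB(3) sep_verts[OF AB(1)] sep_verts[OF CD(1)] by blast+
    then show ?thesis by (auto simp: nested_def osep_le_def)
  qed
  note key = this
  have "L \<subseteq> A - B \<or> L \<subseteq> B - A"
    using sep_comp[OF AB(1), of L] compD[OF L(1)] L(2) disj by blast
  then show ?thesis
  proof
    assume "L \<subseteq> B - A"
    then have "nested (prod.swap (A, B)) (C, D)"
      using key[of B A] AB disj sep_commute[of G A B] by (simp add: Int_commute)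
    then show ?thesis by (simp only: nested_swap)
  qed (use key AB disj in blast)
qed

text \<open>\<open>W\<close> consists of \<open>A \<inter> B\<close> and finite connectors between
  all pairs of its vertices. A separator avoiding \<open>W\<close> cannot split
  \<open>A \<inter> B\<close>, which then lies strictly on one side, and
  \<open>nested_if_separator_disjoint\<close> applies. So the separator of every crossing tight
  separation meets \<open>W\<close>.\<close>

lemma finite_crossing:
  assumes G: "G \<in> graph_class" and AB: "is_separation G A B" "finite (A \<inter> B)"
  shows "finite {s \<in> tight_seps k G. \<not> nested (A, B) s}"
proof (cases "finite (verts G)")
  case True
  then show ?thesis using finite_tight_seps_if_finite[of G k] by simp
next
  case False
  then have s: "simple_graph G" "connected_graph G"
    using G by (auto simp: graph_class_def)
  have "\<exists>W. finite W \<and> (\<forall>X. X \<inter> W = {} \<longrightarrow> \<not> sepr G X (fst p) (snd p))"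
    if "p \<in> (A \<inter> B) \<times> (A \<inter> B)" for p
  proof -
    have "A \<inter> B \<subseteq> verts G" using sep_verts[OF AB(1)] by blast
    moreover have "fst p \<in> A \<inter> B" "snd p \<in> A \<inter> B" using that by (simp_all only: mem_Times_iff)
    ultimately have p: "fst p \<in> verts G" "snd p \<in> verts G" by blast+
    obtain W where "finite W" "\<And>X. X \<inter> W = {} \<Longrightarrow> \<not> sepr G X (fst p) (snd p)"
      using connected_finite_connector[OF s p] by metis
    then show ?thesis by (intro exI[of _ W]) simp
  qed
  then obtain w where w: "\<And>p. p \<in> (A \<inter> B) \<times> (A \<inter> B) \<Longrightarrow>
      finite (w p) \<and> (\<forall>X. X \<inter> w p = {} \<longrightarrow> \<not> sepr G X (fst p) (snd p))"
    by metis
  define W where "W = (A \<inter> B) \<union> (\<Union>p\<in>(A \<inter> B) \<times> (A \<inter> B). w p)"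
  have "finite W" using w AB(2) unfolding W_def by blast
  have AB_W: "A \<inter> B \<subseteq> W" unfolding W_def by (rule Un_upper1)
  have "C \<inter> D \<inter> W \<noteq> {}" if CD: "(C, D) \<in> tight_seps k G" "\<not> nested (A, B) (C, D)" for C D
  proof
    assume disj: "C \<inter> D \<inter> W = {}"
    have CD': "is_separation G C D" "half_tight G C D" "half_tight G D C"
      using CD by (auto simp: tight_seps_def)
    show False
    proof (cases "A \<inter> B = {}")
      \<comment> \<open>With an empty separator, connectedness makes one side of
        \<open>(A, B)\<close> empty, and such a separation crosses nothing.\<close>
      case True
      have "nbhd G A = {}" using sep_nbhd[OF AB(1)] True by (metis Diff_triv subset_empty)
      then have "A = {} \<or> A = verts G"
        using closed_set_connected[OF s, of A] sep_verts[OF AB(1)] by blast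
      then have "A = {} \<and> B = verts G \<or> B = {} \<and> A = verts G"
        using True sep_verts[OF AB(1)] by blast
      then have "nested (A, B) (C, D)"
        using sep_verts[OF CD'(1)] by (auto simp: nested_def osep_le_def)
      then show False using CD by blast
    next
      case False
      have "\<not> (u \<in> C - D \<and> v \<in> D - C)" if "u \<in> A \<inter> B" "v \<in> A \<inter> B" for u v
      proof -
        have "w (u, v) \<subseteq> W" using that unfolding W_def by blast
        then have "C \<inter> D \<inter> w (u, v) = {}" using disj by blast
        moreover have "\<forall>X. X \<inter> w (u, v) = {} \<longrightarrow> \<not> sepr G X u v"
          using w[of "(u, v)"] that by simp
        ultimately have "\<not> sepr G (C \<inter> D) u v" by simp
        then show ?thesis using sep_sepr[OF CD'(1)] by blast
      qed
      moreover have "A \<inter> B \<subseteq> (C - D) \<union> (D - C)"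
        using disj sep_verts[OF AB(1)] sep_verts[OF CD'(1)] AB_W by blast
      ultimately have "A \<inter> B \<subseteq> C - D \<or> A \<inter> B \<subseteq> D - C" by blast
      then show False
      proof
        assume "A \<inter> B \<subseteq> D - C"
        then show False using nested_if_separator_disjoint[OF s AB(1) False CD'(1,2)] CD by blast
      next
        assume "A \<inter> B \<subseteq> C - D"
        then have "nested (A, B) (prod.swap (C, D))"
          using nested_if_separator_disjoint[OF s AB(1) False, of D C] CD' sep_commute[of G C D]
          by simp
        then show False using CD by (simp only: nested_swap)
      qed
    qed
  qed
  then have "{s \<in> tight_seps k G. \<not> nested (A, B) s} \<subseteq>
      {(C, D) \<in> tight_seps k G. C \<inter> D \<inter> W \<noteq> {}}" by auto
  then show ?thesis using finite_tight_seps_meeting[OF G \<open>finite W\<close>] by (rule finite_subset)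
qed

section \<open>Profiles\<close>

definition fsep :: "nat \<Rightarrow> 'a ugraph \<Rightarrow> 'a set \<Rightarrow> 'a set \<Rightarrow> bool" where
  "fsep k G A B \<longleftrightarrow> is_separation G A B \<and> finite (A \<inter> B) \<and> card (A \<inter> B) < k"

lemma fsepD:
  assumes "fsep k G A B"
  shows "is_separation G A B" "finite (A \<inter> B)" "card (A \<inter> B) < k" "A \<union> B = verts G"
    "A \<subseteq> verts G" "B \<subseteq> verts G"
  using assms by (auto simp: fsep_def is_separation_def)

lemma fsep_commute: "fsep k G A B \<longleftrightarrow> fsep k G B A"
  unfolding fsep_def using sep_commute[of G A B] by (simp add: Int_commute)

lemma esize_less_iff: "esize X < enat k \<longleftrightarrow> finite X \<and> card X < k"
  by (simp add: esize_def)

lemma oseps_iff: "(A, B) \<in> oseps (enat k) G \<longleftrightarrow> fsep k G A B"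
proof -
  have "fsep k G A B" if "{A, B} = {C, D}" "fsep k G C D" for C D
  proof -
    have "A = C \<and> B = D \<or> A = D \<and> B = C" using that(1) by (simp add: doubleton_eq_iff)
    then show ?thesis using that(2) fsep_commute by blast
  qed
  moreover have "(A, B) \<in> oseps (enat k) G \<longleftrightarrow> (\<exists>C D. {A, B} = {C, D} \<and> fsep k G C D)"
    unfolding oseps_def seps_def fsep_def esize_less_iff by simp
  ultimately show ?thesis by metis
qed

lemma seps_iff: "{A, B} \<in> seps (enat k) G \<longleftrightarrow> fsep k G A B"
  using oseps_iff[of A B k G] by (simp add: oseps_def)

abbreviation (input) profile :: "nat \<Rightarrow> 'a ugraph \<Rightarrow> 'a osep set \<Rightarrow> bool" where
  "profile k G P \<equiv> is_profile (enat k) G P"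

abbreviation (input) eff_dist :: "'a ugraph \<Rightarrow> 'a set \<Rightarrow> 'a set \<Rightarrow> 'a osep set \<Rightarrow> 'a osep set \<Rightarrow> bool"
  where
  "eff_dist \<equiv> efficiently_distinguishes"

lemma profile_fsep:
  assumes "profile k G P" "(A, B) \<in> P"
  shows "fsep k G A B"
proof -
  have "P \<subseteq> oseps (enat k) G" using assms(1) by (simp add: is_profile_def is_orientation_def)
  then have "(A, B) \<in> oseps (enat k) G" using assms(2) by blast
  then show ?thesis by (simp only: oseps_iff)
qed

lemma profile_corner:
  "profile k G P \<Longrightarrow> (A, B) \<in> P \<Longrightarrow> (C, D) \<in> P \<Longrightarrow> (B \<inter> D, A \<union> C) \<notin> P"
  by (simp add: is_profile_def)

lemma profile_total:
  assumes "profile k G P" "fsep k G A B"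
  shows "(A, B) \<in> P \<or> (B, A) \<in> P"
proof -
  have "\<exists>!s. s \<in> {(A, B), (B, A)} \<and> s \<in> P"
    using assms seps_iff[of A B k G] unfolding is_profile_def is_orientation_def by simp
  then show ?thesis by blast
qed

lemma profile_asym:
  assumes "profile k G P" "(A, B) \<in> P"
  shows "(B, A) \<notin> P"
proof
  assume BA: "(B, A) \<in> P"
  have "\<exists>!s. s \<in> {(A, B), (B, A)} \<and> s \<in> P"
    using assms profile_fsep[OF assms] seps_iff[of A B k G]
    unfolding is_profile_def is_orientation_def by simp
  then have "(A, B) = (B, A)" using BA assms(2) by auto
  \<comment> \<open>The orientation axiom alone would admit a pair \<open>(A, A)\<close>; the corner
    property for twice the same separation excludes it.\<close>
  then have "A = B" by (rule Pair_inject)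
  then have "(B \<inter> B, A \<union> A) \<in> P" using assms(2) by simp
  then show False using profile_corner[OF assms(1) assms(2) assms(2)] by simp
qed

text \<open>The exception is genuine: consistency concerns distinct separations only, and
  \<open>(D, C)\<close> lies below \<open>(C, D)\<close> when \<open>C\<close> is the whole vertex
  set.\<close>

lemma profile_down:
  assumes P: "profile k G P" "(C, D) \<in> P" "fsep k G A B" "A \<subseteq> C" "D \<subseteq> B"
    "(A, B) \<noteq> (D, C)"
  shows "(A, B) \<in> P"
proof (rule ccontr)
  assume n: "(A, B) \<notin> P"
  then have BA: "(B, A) \<in> P" using profile_total[OF P(1,3)] by blast
  have ne: "(A, B) \<noteq> (C, D)" using n P(2) by blast
  have "{A, B} \<noteq> {C, D}" using ne P(6) by (auto simp: doubleton_eq_iff)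
  moreover have "osep_less (A, B) (C, D)" using P(4,5) ne by (simp add: osep_less_def osep_le_def)
  moreover have "{A, B} \<in> seps (enat k) G" "{C, D} \<in> seps (enat k) G"
    using P(3) profile_fsep[OF P(1,2)] by (simp_all add: seps_iff)
  ultimately show False using P(1,2) BA unfolding is_profile_def consistent_def by blast
qed

lemma profile_join:
  assumes P: "profile k G P" "(A, B) \<in> P" "(C, D) \<in> P"
    and c: "card ((A \<union> C) \<inter> (B \<inter> D)) < k"
  shows "(A \<union> C, B \<inter> D) \<in> P"
proof -
  have AB: "fsep k G A B" "fsep k G C D" using P profile_fsep by metis+
  have "finite ((A \<union> C) \<inter> (B \<inter> D))"
    by (rule finite_subset[of _ "(A \<inter> B) \<union> (C \<inter> D)"]) (use AB fsepD(2) in auto)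
  then have "fsep k G (A \<union> C) (B \<inter> D)"
    using c sep_corner(1)[OF fsepD(1)[OF AB(1)] fsepD(1)[OF AB(2)]] by (simp add: fsep_def)
  then show ?thesis using profile_total[OF P(1)] profile_corner[OF P(1-3)] by blast
qed

text \<open>If \<open>X \<subseteq> C \<inter> D\<close>, then \<open>(X, V)\<close> lies below both \<open>(C, D)\<close> and \<open>(D, C)\<close>, so consistency
  forbids either orientation.\<close>

lemma irregular_profile:
  assumes P: "profile k G P" "(verts G, X) \<in> P"
    and CD: "fsep k G C D" "X \<subseteq> C \<inter> D"
  shows "(C, D) = (X, verts G) \<or> (D, C) = (X, verts G)"
proof (rule ccontr)
  assume "\<not> ?thesis"
  then have ne: "(C, D) \<noteq> (X, verts G)" "(D, C) \<noteq> (X, verts G)" by blast+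
  have "(C, D) \<in> P" using profile_down[OF P CD(1) fsepD(5)[OF CD(1)] _ ne(1)] CD(2) by blast
  moreover have "(D, C) \<in> P"
    using profile_down[OF P _ fsepD(6)[OF CD(1)] _ ne(2)] CD fsep_commute[of k G C D] by blast
  ultimately show False using profile_asym[OF P(1)] by blast
qed

lemma distinguishes_iff:
  assumes "profile k G P" "profile k G Q"
  shows "distinguishes G A B P Q \<longleftrightarrow> (A, B) \<in> P \<and> (B, A) \<in> Q \<or> (B, A) \<in> P \<and> (A, B) \<in> Q"
    (is "_ \<longleftrightarrow> ?R")
proof
  assume ?R
  moreover from this have "fsep k G A B" "A \<noteq> B"
    using profile_fsep[OF assms(1)] profile_fsep[OF assms(2)] profile_asym[OF assms(1)] by blast+
  ultimately show "distinguishes G A B P Q"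
    unfolding distinguishes_def using fsepD(1) by blast
qed (auto simp: distinguishes_def)

lemma distinguishes_commute:
  "distinguishes G A B P Q \<longleftrightarrow> distinguishes G B A P Q"
  "distinguishes G A B P Q \<longleftrightarrow> distinguishes G A B Q P"
  using sep_commute[of G A B] unfolding distinguishes_def by blast+

lemma distinguishes_fsep:
  "profile k G P \<Longrightarrow> distinguishes G A B P Q \<Longrightarrow> fsep k G A B"
  using profile_fsep fsep_commute unfolding distinguishes_def by blast

lemma eff_commute:
  "eff_dist G A B P Q \<longleftrightarrow> eff_dist G B A P Q"
  "eff_dist G A B P Q \<longleftrightarrow> eff_dist G A B Q P"
  unfolding efficiently_distinguishes_def
  using distinguishes_commute[of G A B P Q] distinguishes_commute(2)[of G _ _ P Q]
  by (simp_all add: Int_commute)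

lemma eff_iff:
  assumes P: "profile k G P"
  shows "eff_dist G A B P Q \<longleftrightarrow> distinguishes G A B P Q \<and>
    (\<forall>C D. distinguishes G C D P Q \<longrightarrow> card (A \<inter> B) \<le> card (C \<inter> D))"
proof (cases "distinguishes G A B P Q")
  case True
  have "esize (C \<inter> D) < esize (A \<inter> B) \<longleftrightarrow> card (C \<inter> D) < card (A \<inter> B)"
    if "distinguishes G C D P Q" for C D
    using fsepD(2)[OF distinguishes_fsep[OF P that]] fsepD(2)[OF distinguishes_fsep[OF P True]]
    by (simp add: esize_def)
  then show ?thesis unfolding efficiently_distinguishes_def using True by (meson not_le)
qed (simp add: efficiently_distinguishes_def)

lemma exists_eff:
  assumes P: "profile k G P" "profile k G Q" "P \<noteq> Q"
  obtains A B where "eff_dist G A B P Q"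
proof -
  have "\<exists>A B. distinguishes G A B P Q" if "s \<in> P" "s \<notin> Q" "profile k G P"
    "profile k G Q" for s P Q
  proof -
    obtain A B where s: "s = (A, B)" by (cases s)
    then have "(B, A) \<in> Q" using profile_total[OF that(4) profile_fsep[OF that(3)]] that by blast
    then show ?thesis using distinguishes_iff[OF that(3,4)] that s by blast
  qed
  note * = this
  obtain s where "s \<in> P \<and> s \<notin> Q \<or> s \<in> Q \<and> s \<notin> P" using P(3) by blast
  then obtain A0 B0 where AB0: "distinguishes G A0 B0 P Q"
    using *[of s P Q] *[of s Q P] P(1,2) distinguishes_commute(2)[of G _ _ P Q] by blast
  define n where "n = (LEAST n. \<exists>A B. distinguishes G A B P Q \<and> card (A \<inter> B) = n)"
  have "\<exists>n A B. distinguishes G A B P Q \<and> card (A \<inter> B) = n" using AB0 by blast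
  then have "\<exists>A B. distinguishes G A B P Q \<and> card (A \<inter> B) = n"
    unfolding n_def by (rule LeastI_ex)
  moreover have "n \<le> card (A \<inter> B)" if "distinguishes G A B P Q" for A B
    unfolding n_def using that by (intro Least_le) blast
  ultimately show ?thesis using that eff_iff[OF P(1)] by metis
qed

text \<open>Suppose no component \<open>K\<close> in \<open>A - B\<close> is attached to all of
  \<open>A \<inter> B\<close>. Then cutting off \<open>K\<close> along its neighbourhood has smaller
  order than \<open>A \<inter> B\<close> and lies below \<open>(A, B)\<close>, so it is in
  \<open>Q\<close> and, by efficiency, in \<open>P\<close>. Joining these finitely many separations
  to \<open>(B, A)\<close> within \<open>P\<close> keeps the separator inside
  \<open>A \<inter> B\<close> and ends with \<open>(V, A \<inter> B)\<close> in \<open>P\<close>.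
  Only the degenerate case survives this.\<close>

lemma eff_half_tight:
  assumes G: "G \<in> graph_class"
    and P: "profile k G P" "profile k G Q"
    and AB: "(A, B) \<in> Q" "(B, A) \<in> P"
    and min: "\<And>C D. (C, D) \<in> Q \<Longrightarrow> (D, C) \<in> P \<Longrightarrow> card (A \<inter> B) \<le> card (C \<inter> D)"
  shows "half_tight G A B"
proof (rule ccontr)
  assume nt: "\<not> half_tight G A B"
  have s: "simple_graph G" using G by (simp add: graph_class_def)
  have fAB: "fsep k G A B" using profile_fsep[OF P(2) AB(1)] .
  note AB' = fsepD[OF fAB]
  have small: "(C, D) \<in> P"
    if "(C, D) \<in> Q" "card (C \<inter> D) < card (A \<inter> B)" for C D
    using that min[of C D] profile_total[OF P(1) profile_fsep[OF P(2) that(1)]] by auto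
  have join_all: "(B \<union> \<Union>\<K>, A - \<Union>\<K>) \<in> P"
    if "finite \<K>" "\<And>K. K \<in> \<K> \<Longrightarrow> is_comp G (A \<inter> B) K \<and> K \<subseteq> A - B" for \<K>
    using that
  proof (induction \<K> rule: finite_induct)
    case empty
    then show ?case using AB by simp
  next
    case (insert K \<K>)
    have K: "is_comp G (A \<inter> B) K" "K \<subseteq> A - B" using insert.prems by auto
    note K' = compD[OF K(1)]
    have IH: "(B \<union> \<Union>\<K>, A - \<Union>\<K>) \<in> P" using insert by blast
    have psub: "nbhd G K \<subset> A \<inter> B" using K' K nt by (auto simp: half_tight_def)
    let ?C = "K \<union> nbhd G K" and ?D = "verts G - K"
    have int: "?C \<inter> ?D = nbhd G K" using nbhd_subset[of G K] K' by blast
    have sm: "card (?C \<inter> ?D) < card (A \<inter> B)"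
      unfolding int using psub AB'(2) by (rule psubset_card_mono[rotated])
    have "fsep k G ?C ?D"
      unfolding fsep_def using sepI_nbhd[OF s, of K "nbhd G K"] K' nbhd_subset[of G K] sm AB'(2,3)
        int psub by (metis finite_subset less_trans order_refl psubset_imp_subset)
    moreover have "(?C, ?D) \<noteq> (B, A)" using K K'(3) by blast
    moreover have "?C \<subseteq> A" "B \<subseteq> ?D" using K K' AB'(6) by blast+
    ultimately have "(?C, ?D) \<in> Q" using profile_down[OF P(2) AB(1)] by blast
    then have CP: "(?C, ?D) \<in> P" using small sm by blast
    have "B \<union> \<Union>\<K> \<union> ?C = B \<union> \<Union>(insert K \<K>)" using K'(5) by auto
    moreover have "(A - \<Union>\<K>) \<inter> ?D = A - \<Union>(insert K \<K>)" using AB'(5) by auto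
    moreover have "(B \<union> \<Union>(insert K \<K>)) \<inter> (A - \<Union>(insert K \<K>)) \<subseteq> A \<inter> B" by auto
    ultimately show ?case
      using profile_join[OF P(1) IH CP] card_mono[OF AB'(2)] AB'(3) by (metis le_less_trans)
  qed
  let ?\<K> = "{K. is_comp G (A \<inter> B) K \<and> K \<subseteq> A - B}"
  have "finite ?\<K>"
    using finite_comps[OF G AB'(2)] by (rule rev_finite_subset) blast
  then have "(B \<union> \<Union>?\<K>, A - \<Union>?\<K>) \<in> P" by (rule join_all) blast
  moreover have "\<Union>?\<K> = A - B"
  proof (intro equalityI subsetI)
    fix v assume v: "v \<in> A - B"
    then have "v \<in> verts G - A \<inter> B" using AB'(5) by blast
    then obtain K where K: "is_comp G (A \<inter> B) K" "v \<in> K" using comp_exists[OF s] by metis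
    then have "K \<subseteq> A - B" using sep_comp[OF AB'(1), of K] compD[OF K(1)] v by blast
    then show "v \<in> \<Union>?\<K>" using K by blast
  qed blast
  moreover have "B \<union> (A - B) = verts G" "A - (A - B) = A \<inter> B" using AB'(4) by blast+
  ultimately have irr: "(verts G, A \<inter> B) \<in> P" by simp
  \<comment> \<open>\<open>(A, B)\<close> lies below \<open>(V, A \<inter> B)\<close> but is not in
    \<open>P\<close>, so it must be the inverse, the exception in
    \<open>profile_down\<close>.\<close>
  have triv: "A = A \<inter> B" "B = verts G"
    using profile_down[OF P(1) irr fAB AB'(5)] profile_asym[OF P(1) AB(2)] by blast+
  then have "finite A" using AB'(2) by simp
  then have "\<not> card A \<le> 1" using nt triv by (simp add: half_tight_def)
  then obtain x where x: "x \<in> A" by fastforce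
  \<comment> \<open>A set \<open>A\<close> of at least two vertices splits into two proper parts.
    Both are cut off with smaller order, so \<open>P\<close> agrees with \<open>Q\<close> on them;
    joining them puts \<open>(A, V)\<close> into \<open>P\<close>, against
    \<open>(B, A)\<close>.\<close>
  have part: "(Y, verts G) \<in> P" if "Y \<subset> A" for Y
  proof -
    have "card (Y \<inter> verts G) < card (A \<inter> B)"
      using triv that AB'(5) \<open>finite A\<close> by (metis inf.absorb1 psubset_card_mono psubset_imp_subset
        subset_trans)
    moreover have "is_separation G Y (verts G)" using that AB'(5) by (auto simp: is_separation_def)
    ultimately have "fsep k G Y (verts G)"
      using that AB'(3) \<open>finite A\<close> by (auto simp: fsep_def intro: finite_subset)
    then have "(Y, verts G) \<in> Q"
      using profile_down[OF P(2) AB(1), of Y "verts G"] that triv(2) by blast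
    then show ?thesis using small \<open>card (Y \<inter> verts G) < card (A \<inter> B)\<close> by blast
  qed
  have "A \<noteq> {x}" using \<open>\<not> card A \<le> 1\<close> by auto
  then have "({x}, verts G) \<in> P" "(A - {x}, verts G) \<in> P" using part x by blast+
  moreover have "({x} \<union> (A - {x})) = A" using x by blast
  ultimately have "(A, verts G) \<in> P"
    using profile_join[OF P(1), of "{x}" "verts G" "A - {x}" "verts G"] triv AB'(3) by simp
  then show False using profile_asym[OF P(1)] AB(2) triv by blast
qed

definition eff_seps :: "nat \<Rightarrow> 'a ugraph \<Rightarrow> nat \<Rightarrow> 'a osep set" where
  "eff_seps k G n = {(A, B). card (A \<inter> B) = n \<and>
     (\<exists>P Q. profile k G P \<and> profile k G Q \<and> eff_dist G A B P Q)}"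

lemma eff_sepsE:
  assumes "(A, B) \<in> eff_seps k G n"
  obtains P Q where "profile k G P" "profile k G Q"
    "eff_dist G A B P Q" "(A, B) \<in> Q" "(B, A) \<in> P" "card (A \<inter> B) = n"
proof -
  obtain P Q where PQ: "profile k G P" "profile k G Q"
    "eff_dist G A B P Q" "card (A \<inter> B) = n"
    using assms by (auto simp: eff_seps_def)
  then consider "(A, B) \<in> Q" "(B, A) \<in> P" | "(A, B) \<in> P" "(B, A) \<in> Q"
    unfolding efficiently_distinguishes_def distinguishes_def by blast
  then show thesis
    using that PQ eff_commute(2)[of G A B P Q] by cases simp_all
qed

lemma eff_seps_swap: "prod.swap r \<in> eff_seps k G n \<longleftrightarrow> r \<in> eff_seps k G n"
proof (cases r)
  case (Pair A B)
  then show ?thesis using eff_commute(1)[of G A B] by (simp add: eff_seps_def Int_commute)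
qed

lemma eff_seps_tight:
  assumes G: "G \<in> graph_class"
  shows "eff_seps k G n \<subseteq> tight_seps k G"
proof clarify
  fix A B assume AB: "(A, B) \<in> eff_seps k G n"
  have "half_tight G A B" if e: "(A, B) \<in> eff_seps k G n" for A B
  proof -
    obtain P Q where P: "profile k G P" "profile k G Q"
      "eff_dist G A B P Q" "(A, B) \<in> Q" "(B, A) \<in> P"
      by (rule eff_sepsE[OF e]) blast
    show ?thesis
      by (rule eff_half_tight[OF G P(1,2,4,5)])
        (use P eff_iff[OF P(1)] distinguishes_iff[OF P(1,2)] in blast)
  qed
  moreover have "(B, A) \<in> eff_seps k G n" using AB eff_seps_swap[of "(A, B)"] by simp
  moreover have "fsep k G A B" using AB profile_fsep by (rule_tac eff_sepsE[OF AB]) blast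
  ultimately show "(A, B) \<in> tight_seps k G" using AB by (simp add: tight_seps_def fsep_def)
qed

section \<open>A canonical nested set distinguishing the profiles\<close>

lemma eff_fsep:
  "profile k G P \<Longrightarrow> eff_dist G A B P Q \<Longrightarrow> fsep k G A B"
  unfolding efficiently_distinguishes_def using distinguishes_fsep by blast

section \<open>Corners of crossing separations\<close>

lemma nested_iff:
  "nested (A, B) (C, D) \<longleftrightarrow> (A \<subseteq> C \<and> D \<subseteq> B) \<or> (A \<subseteq> D \<and> C \<subseteq> B) \<or> (B \<subseteq> C \<and> D \<subseteq> A) \<or> (B \<subseteq> D \<and> C \<subseteq> A)"
  by (simp add: nested_def osep_le_def)

lemma nested_commute:
  "nested (A, B) r \<longleftrightarrow> nested (B, A) r" "nested r (A, B) \<longleftrightarrow> nested r (B, A)"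
  using nested_swap[of "(A, B)" r] nested_swap[of r "(A, B)"] by simp_all

text \<open>The fish lemma. The only position of \<open>t\<close> that could fail is between
  \<open>(A, B)\<close> and \<open>(D, C)\<close>, and then these two would be nested.\<close>

lemma nested_corner:
  assumes "nested t (A, B)" "nested t (C, D)" "\<not> nested (A, B) (C, D)"
  shows "nested t (A \<union> C, B \<inter> D)"
proof -
  obtain E F where t: "t = (E, F)" by (cases t)
  have up: "E \<subseteq> A \<union> C \<and> B \<inter> D \<subseteq> F" if "E \<subseteq> A \<and> B \<subseteq> F \<or> E \<subseteq> C \<and> D \<subseteq> F" for E F using that by blast
  have down: "E \<subseteq> B \<inter> D \<and> A \<union> C \<subseteq> F" if "E \<subseteq> B \<and> A \<subseteq> F" "E \<subseteq> D \<and> C \<subseteq> F" for E F using that by blast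
  have cross: "\<not> (A \<subseteq> D \<and> C \<subseteq> B)" using assms(3) unfolding nested_iff by argo
  then have split: "\<not> (E \<subseteq> B \<and> A \<subseteq> F \<and> F \<subseteq> D \<and> C \<subseteq> E)" for E F by blast
  show ?thesis
    using assms(1,2) up[of E F] up[of F E] down[of E F] down[of F E] split[of E F] split[of F E]
    unfolding t nested_iff by argo
qed

text \<open>A side of \<open>t\<close> contained in \<open>A\<close> puts \<open>t\<close> below the
  union corner; one contained in \<open>B\<close> puts it below the inverse of the opposite
  corner.\<close>

lemma nested_corner':
  assumes "nested t (A, B)"
  shows "nested t (A \<union> C, B \<inter> D) \<or> nested t (A \<inter> C, B \<union> D)"
proof -
  obtain E F where t: "t = (E, F)" by (cases t)
  have 1: "E \<subseteq> A \<union> C \<and> B \<inter> D \<subseteq> F" if "E \<subseteq> A \<and> B \<subseteq> F" for E F using that by blast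
  have 2: "E \<subseteq> B \<union> D \<and> A \<inter> C \<subseteq> F" if "E \<subseteq> B \<and> A \<subseteq> F" for E F using that by blast
  show ?thesis
    using assms 1[of E F] 1[of F E] 2[of E F] 2[of F E] unfolding t nested_iff by argo
qed

lemma nested_own_corner:
  "nested (A, B) (A \<union> C, B \<inter> D)" "nested (A, B) (A \<inter> C, B \<union> D)"
  "nested (C, D) (A \<union> C, B \<inter> D)" "nested (C, D) (A \<inter> C, B \<union> D)"
  unfolding nested_iff by blast+

text \<open>Submodularity of the order: the union and the intersection of the two corner separators
  lie in the union and the intersection of the given separators.\<close>

lemma corner_order:
  assumes "fsep k G A B" "fsep k G C D"
  shows "card ((A \<union> C) \<inter> (B \<inter> D)) + card ((A \<inter> C) \<inter> (B \<union> D)) \<le> card (A \<inter> B) + card (C \<inter> D)"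
    "finite ((A \<union> C) \<inter> (B \<inter> D))" "finite ((A \<inter> C) \<inter> (B \<union> D))"
proof -
  let ?X = "(A \<union> C) \<inter> (B \<inter> D)" and ?Y = "(A \<inter> C) \<inter> (B \<union> D)" and ?S = "A \<inter> B" and ?T = "C \<inter> D"
  have f: "finite ?S" "finite ?T" using assms fsepD(2) by blast+
  have u: "?X \<union> ?Y \<subseteq> ?S \<union> ?T" "?X \<inter> ?Y \<subseteq> ?S \<inter> ?T" by blast+
  have fu: "finite (?S \<union> ?T)" using f by simp
  show fX: "finite ?X" by (rule finite_subset[OF _ fu]) blast
  show fY: "finite ?Y" by (rule finite_subset[OF _ fu]) blast
  have "card ?X + card ?Y = card (?X \<union> ?Y) + card (?X \<inter> ?Y)"
    using card_Un_Int[OF fX fY] .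
  also have "\<dots> \<le> card (?S \<union> ?T) + card (?S \<inter> ?T)"
    by (intro add_mono card_mono fu u finite_Int[OF disjI1[OF f(1)]])
  also have "\<dots> = card ?S + card ?T" using card_Un_Int[OF f] by simp
  finally show "card ?X + card ?Y \<le> card ?S + card ?T" .
qed

text \<open>\<open>Q\<close> contains the join of its two elements, while the inverse of the join
  lies below \<open>(B, A)\<close> and hence is in \<open>P\<close>. Crossing rules out the
  exception in \<open>profile_down\<close>.\<close>

lemma corner_distinguishes:
  assumes P: "profile k G P" "profile k G Q"
    and AB: "(A, B) \<in> Q" "(B, A) \<in> P" and CD: "(C, D) \<in> Q"
    and cross: "\<not> nested (A, B) (C, D)"
    and c: "card ((A \<union> C) \<inter> (B \<inter> D)) < k"
  shows "distinguishes G (A \<union> C) (B \<inter> D) P Q"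
proof -
  have 1: "(A \<union> C, B \<inter> D) \<in> Q" by (rule profile_join[OF P(2) AB(1) CD c])
  then have f: "fsep k G (B \<inter> D) (A \<union> C)"
    using profile_fsep[OF P(2)] fsep_commute by blast
  have "(B \<inter> D, A \<union> C) \<noteq> (A, B)"
  proof
    assume "(B \<inter> D, A \<union> C) = (A, B)"
    then have "A \<subseteq> D" "C \<subseteq> B" by blast+
    then show False using cross by (simp add: nested_iff)
  qed
  then have "(B \<inter> D, A \<union> C) \<in> P"
    using profile_down[OF P(1) AB(2) f] by blast
  then show ?thesis using 1 distinguishes_iff[OF P] by blast
qed

text \<open>The bound is needed because profiles orient only the separations of order less than \<open>k\<close>. A
  corner that violates it has a large order, so that the opposite corner has a small one.\<close>

definition corner_dist :: "nat \<Rightarrow> 'a ugraph \<Rightarrow> 'a osep set \<Rightarrow> 'a osep set \<Rightarrow> 'a set \<Rightarrow> 'a set \<Rightarrow> 'a set \<Rightarrow>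
    'a set \<Rightarrow> bool"
  where "corner_dist k G P Q A B C D \<longleftrightarrow>
    (card ((A \<union> C) \<inter> (B \<inter> D)) < k \<longrightarrow> distinguishes G (A \<union> C) (B \<inter> D) P Q)"

lemma corner_dist_commute: "corner_dist k G P Q A B C D \<longleftrightarrow> corner_dist k G P Q C D A B"
  by (simp add: corner_dist_def Un_commute Int_commute)

text \<open>A corner qualifies as soon as one profile contains both separations whose join it is. If
  \<open>P\<close> and \<open>Q\<close> orient \<open>{C, D}\<close> differently, each contributes
  one of two opposite corners; if they agree, both corners lie on the same side of
  \<open>{C, D}\<close>.\<close>

lemma corner_dist_cases:
  assumes P: "profile k G P" "profile k G Q"
    and AB: "distinguishes G A B P Q" and CD: "fsep k G C D"
    and cross: "\<not> nested (A, B) (C, D)"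
  shows "distinguishes G C D P Q \<Longrightarrow>
      corner_dist k G P Q A B C D \<and> corner_dist k G P Q B A D C \<or>
      corner_dist k G P Q A B D C \<and> corner_dist k G P Q B A C D" (is "_ \<Longrightarrow> ?dist")
    and "\<not> distinguishes G C D P Q \<Longrightarrow>
      corner_dist k G P Q A B C D \<and> corner_dist k G P Q B A C D \<or>
      corner_dist k G P Q A B D C \<and> corner_dist k G P Q B A D C" (is "_ \<Longrightarrow> ?same")
proof -
  have c: "\<not> nested (A, B) (D, C)" "\<not> nested (B, A) (C, D)" "\<not> nested (B, A) (D, C)"
    using cross nested_commute by blast+
  have *: "corner_dist k G P Q A B C D"
    if "(A, B) \<in> Q \<and> (B, A) \<in> P \<and> (C, D) \<in> Q \<or> (A, B) \<in> P \<and> (B, A) \<in> Q \<and> (C, D) \<in> P"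
       "\<not> nested (A, B) (C, D)" for A B C D
    using that corner_distinguishes[OF P, of A B C D] corner_distinguishes[OF P(2,1), of A B C D]
      distinguishes_commute(2)[of G "A \<union> C" "B \<inter> D" P Q]
    unfolding corner_dist_def by blast
  have CDP: "(C, D) \<in> P \<or> (D, C) \<in> P" "(C, D) \<in> Q \<or> (D, C) \<in> Q"
    using profile_total[OF P(1) CD] profile_total[OF P(2) CD] .
  have AB': "(A, B) \<in> Q \<and> (B, A) \<in> P \<or> (A, B) \<in> P \<and> (B, A) \<in> Q"
    using AB distinguishes_iff[OF P] by blast
  show ?dist if "distinguishes G C D P Q"
  proof -
    have "(C, D) \<in> P \<and> (D, C) \<in> Q \<or> (D, C) \<in> P \<and> (C, D) \<in> Q"
      using that distinguishes_iff[OF P] by blast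
    then show ?thesis
      using AB' *[of A B C D] *[of B A D C] *[of A B D C] *[of B A C D] cross c by metis
  qed
  show ?same if "\<not> distinguishes G C D P Q"
  proof -
    have "(C, D) \<in> P \<and> (C, D) \<in> Q \<or> (D, C) \<in> P \<and> (D, C) \<in> Q"
      using that distinguishes_iff[OF P] CDP by blast
    then show ?thesis
      using AB' *[of A B C D] *[of B A D C] *[of A B D C] *[of B A C D] cross c by metis
  qed
qed

text \<open>By efficiency of \<open>(C, D)\<close>, the opposite corner has order at least
  \<open>card (C \<inter> D)\<close>; if it is not oriented at all, its order is at least
  \<open>k\<close>, which is even larger. Submodularity bounds the order of the corner
  \<open>A \<union> C\<close> by that of \<open>(A, B)\<close>, and efficiency of
  \<open>(A, B)\<close> turns this into equality.\<close>

lemma corner_eff: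
  assumes P: "profile k G P" "eff_dist G A B P Q"
    and P': "profile k G P'" "eff_dist G C D P' Q'"
    and le: "card (C \<inter> D) \<le> card (A \<inter> B)"
    and d1: "corner_dist k G P Q A B C D" and d2: "corner_dist k G P' Q' B A D C"
  shows "eff_dist G (A \<union> C) (B \<inter> D) P Q \<and> card ((A \<union> C) \<inter> (B \<inter> D)) = card (A \<inter> B)"
proof -
  let ?x = "card ((A \<union> C) \<inter> (B \<inter> D))" and ?y = "card ((A \<inter> C) \<inter> (B \<union> D))"
  have dist: "distinguishes G A B P Q" "distinguishes G C D P' Q'"
    using P(2) P'(2) by (simp_all add: efficiently_distinguishes_def)
  have f: "fsep k G A B" "fsep k G C D"
    using distinguishes_fsep[OF P(1) dist(1)] distinguishes_fsep[OF P'(1) dist(2)] .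
  have sum: "?x + ?y \<le> card (A \<inter> B) + card (C \<inter> D)" by (rule corner_order(1)[OF f])
  have k: "card (A \<inter> B) < k" "card (C \<inter> D) < k" using f fsepD(3) by blast+
  have swap: "(B \<union> D) \<inter> (A \<inter> C) = (A \<inter> C) \<inter> (B \<union> D)" by blast
  have "card (C \<inter> D) \<le> ?y"
  proof (cases "?y < k")
    case True
    then have "distinguishes G (B \<union> D) (A \<inter> C) P' Q'" using d2 swap by (simp add: corner_dist_def)
    then show ?thesis using P'(2) eff_iff[OF P'(1)] swap by metis
  qed (use k in simp)
  then have "?x \<le> card (A \<inter> B)" using sum by simp
  moreover from this have "distinguishes G (A \<union> C) (B \<inter> D) P Q" using d1 k
    by (simp add: corner_dist_def)
  moreover from this have "card (A \<inter> B) \<le> ?x" using P(2) eff_iff[OF P(1)] by metis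
  ultimately show ?thesis using P(2) eff_iff[OF P(1)] by simp
qed

text \<open>If, say, \<open>{C, D}\<close> does not distinguish \<open>P\<close> and
  \<open>Q\<close>, their two good corners are adjacent, and any two corners that are good for
  \<open>P'\<close> and \<open>Q'\<close> include the opposite of one of them. If each separation
  distinguishes both pairs, the good corners could form the two different diagonals; this is the
  excluded case.\<close>

lemma opposite_corners:
  assumes P: "profile k G P" "profile k G Q" "distinguishes G A B P Q"
    and P': "profile k G P'" "profile k G Q'" "distinguishes G C D P' Q'"
    and cross: "\<not> nested (A, B) (C, D)"
    and nd: "\<not> (distinguishes G C D P Q \<and> distinguishes G A B P' Q')"
  shows "corner_dist k G P Q A B C D \<and> corner_dist k G P' Q' B A D C \<or>
    corner_dist k G P Q B A D C \<and> corner_dist k G P' Q' A B C D \<or>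
    corner_dist k G P Q B A C D \<and> corner_dist k G P' Q' A B D C \<or>
    corner_dist k G P Q A B D C \<and> corner_dist k G P' Q' B A C D"
proof -
  have f: "fsep k G A B" "fsep k G C D"
    using distinguishes_fsep[OF P(1,3)] distinguishes_fsep[OF P'(1,3)] .
  have cross': "\<not> nested (C, D) (A, B)" using cross nested_sym by blast
  note 1 = corner_dist_cases[OF P f(2) cross]
  note 2 = corner_dist_cases[OF P' f(1) cross', unfolded corner_dist_commute[of k G P' Q' C D]
    corner_dist_commute[of k G P' Q' D C]]
  show ?thesis using 1 2 nd by argo
qed

section \<open>Selecting distinguishers order by order\<close>

definition crossing :: "nat \<Rightarrow> 'a ugraph \<Rightarrow> nat \<Rightarrow> 'a osep \<Rightarrow> nat" where
  "crossing k G n r = card {t \<in> eff_seps k G n. \<not> nested r t}"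

lemma crossing_swap: "crossing k G n (prod.swap r) = crossing k G n r"
  by (simp add: crossing_def)

text \<open>Makes \<open>crossing\<close> a genuine count: the cardinality of an infinite set would
  be 0, and minimising it would mean nothing.\<close>

lemma finite_crossing_eff:
  assumes "G \<in> graph_class" "fsep k G A B"
  shows "finite {t \<in> eff_seps k G n. \<not> nested (A, B) t}"
  using finite_crossing[OF assms(1) fsepD(1,2)[OF assms(2)], of k] eff_seps_tight[OF assms(1), of
    k n]
  by (rule_tac finite_subset[rotated]) blast+

text \<open>What crosses a corner crosses one of the two separations, and what crosses both corners
  crosses both separations. The inequality is strict because \<open>(A, B)\<close> itself crosses
  \<open>(C, D)\<close> but neither corner.\<close>

lemma crossing_corners:
  assumes G: "G \<in> graph_class"
    and AB: "(A, B) \<in> eff_seps k G n" and f: "fsep k G A B" "fsep k G C D"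
    and cross: "\<not> nested (A, B) (C, D)"
  shows "crossing k G n (A \<union> C, B \<inter> D) + crossing k G n (A \<inter> C, B \<union> D)
    < crossing k G n (A, B) + crossing k G n (C, D)"
proof -
  let ?c = "\<lambda>r. {t \<in> eff_seps k G n. \<not> nested r t}"
  let ?U = "?c (A \<union> C, B \<inter> D)" and ?L = "?c (A \<inter> C, B \<union> D)" and ?R = "?c (A, B)"
    and ?S = "?c (C, D)"
  have fin: "finite ?R" "finite ?S" using finite_crossing_eff[OF G] f by blast+
  have cross': "\<not> nested (B, A) (D, C)" using cross nested_commute by blast
  have n1: "nested (A \<union> C, B \<inter> D) t" if "nested (A, B) t" "nested (C, D) t" for t
    using nested_corner[of t A B C D] that cross nested_sym by blast
  have n2: "nested (A \<inter> C, B \<union> D) t" if "nested (A, B) t" "nested (C, D) t" for t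
    using nested_corner[of t B A D C] that cross' nested_sym nested_commute by metis
  have sub: "?U \<union> ?L \<subseteq> ?R \<union> ?S" using n1 n2 by blast
  have "(A, B) \<in> ?R \<union> ?S" using AB cross nested_sym by blast
  moreover have "(A, B) \<notin> ?U \<union> ?L"
    using nested_own_corner(1,2)[of A B C D] nested_sym by blast
  ultimately have ps: "?U \<union> ?L \<subset> ?R \<union> ?S" using sub by blast
  have inter: "?U \<inter> ?L \<subseteq> ?R \<inter> ?S"
  proof
    fix t assume t: "t \<in> ?U \<inter> ?L"
    then have nt: "\<not> nested t (A \<union> C, B \<inter> D)" "\<not> nested t (A \<inter> C, B \<union> D)" "t \<in> eff_seps k G n"
      using nested_sym by blast+
    have "\<not> nested t (A, B)"
    proof
      assume "nested t (A, B)"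
      moreover have "\<not> nested t (C, D)"
        using nested_corner[of t A B C D] calculation cross nt(1) by blast
      ultimately show False using nested_corner' nt by blast
    qed
    moreover have "\<not> nested t (C, D)"
    proof
      assume "nested t (C, D)"
      then show False
        using nested_corner'[of t C D A B] nt by (simp add: Un_commute Int_commute)
    qed
    ultimately show "t \<in> ?R \<inter> ?S" using nt(3) nested_sym by blast
  qed
  have finU: "finite (?R \<union> ?S)" using fin by simp
  have fUL: "finite ?U" "finite ?L" using finite_subset[OF sub finU] by simp_all
  have "card ?U + card ?L = card (?U \<union> ?L) + card (?U \<inter> ?L)" using card_Un_Int[OF fUL] .
  also have "\<dots> < card (?R \<union> ?S) + card (?R \<inter> ?S)"
    using psubset_card_mono[OF finU ps] card_mono[OF _ inter] fin by (simp add: add_less_le_mono)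
  also have "\<dots> = card ?R + card ?S" using card_Un_Int[OF fin] by simp
  finally show ?thesis unfolding crossing_def .
qed

definition candidates :: "'a ugraph \<Rightarrow> nat \<Rightarrow> 'a osep set \<Rightarrow> 'a osep set \<Rightarrow> 'a osep set \<Rightarrow> 'a osep set"
  where
  "candidates G n N P Q = {(A, B). eff_dist G A B P Q \<and> card (A \<inter> B) = n \<and>
     (\<forall>t\<in>N. nested (A, B) t)}"

text \<open>All minimisers for all pairs of profiles: singling one out would destroy
  canonicity.\<close>

definition optimal :: "nat \<Rightarrow> 'a ugraph \<Rightarrow> nat \<Rightarrow> 'a osep set \<Rightarrow> 'a osep set" where
  "optimal k G n N = {r. \<exists>P Q. profile k G P \<and> profile k G Q \<and>
     r \<in> candidates G n N P Q \<and> (\<forall>q\<in>candidates G n N P Q. crossing k G n r \<le> crossing k G n q)}"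

fun levels :: "nat \<Rightarrow> 'a ugraph \<Rightarrow> nat \<Rightarrow> 'a osep set" where
  "levels k G 0 = {}"
| "levels k G (Suc n) = levels k G n \<union> optimal k G n (levels k G n)"

lemma candidates_swap: "prod.swap r \<in> candidates G n N P Q \<longleftrightarrow> r \<in> candidates G n N P Q"
  "r \<in> candidates G n N P Q \<longleftrightarrow> r \<in> candidates G n N Q P"
proof (atomize(full), cases r)
  case (Pair A B)
  show "(prod.swap r \<in> candidates G n N P Q \<longleftrightarrow> r \<in> candidates G n N P Q) \<and>
    (r \<in> candidates G n N P Q \<longleftrightarrow> r \<in> candidates G n N Q P)"
    unfolding Pair candidates_def
    using eff_commute[of G A B P Q] nested_commute(1)[of A B] by (simp add: Int_commute)
qed

lemma optimal_swap: "r \<in> optimal k G n N \<Longrightarrow> prod.swap r \<in> optimal k G n N"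
  unfolding optimal_def by (simp add: candidates_swap(1) crossing_swap)

lemma optimal_eff: "optimal k G n N \<subseteq> eff_seps k G n"
  by (auto simp: optimal_def eff_seps_def candidates_def)

lemma levels_eff: "levels k G n \<subseteq> (\<Union>m<n. eff_seps k G m)"
proof (induction n)
  case (Suc n)
  then show ?case using optimal_eff[of k G n] by (auto simp: lessThan_Suc)
qed simp

lemma levels_swap: "r \<in> levels k G n \<Longrightarrow> prod.swap r \<in> levels k G n"
  by (induction n) (auto dest: optimal_swap)

lemma optimalE:
  assumes "(A, B) \<in> optimal k G n N"
  obtains P Q where "profile k G P" "profile k G Q"
    "(A, B) \<in> candidates G n N P Q"
    "\<And>q. q \<in> candidates G n N P Q \<Longrightarrow> crossing k G n (A, B) \<le> crossing k G n q"
  using assms by (auto simp: optimal_def)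

text \<open>Both corners are efficient of order \<open>n\<close> and, by the fish lemma, nested with
  \<open>N\<close>, so they are candidates for their pairs. Minimality of \<open>(A, B)\<close> and
  \<open>(C, D)\<close> then contradicts \<open>crossing_corners\<close>.\<close>

lemma optimal_corner_step:
  assumes G: "G \<in> graph_class"
    and P: "profile k G P" "profile k G Q" "(A, B) \<in> candidates G n N P Q"
    and P': "profile k G P'" "profile k G Q'" "(C, D) \<in> candidates G n N P' Q'"
    and cross: "\<not> nested (A, B) (C, D)"
    and d: "corner_dist k G P Q A B C D" "corner_dist k G P' Q' B A D C"
    and m: "\<And>q. q \<in> candidates G n N P Q \<Longrightarrow> crossing k G n (A, B) \<le> crossing k G n q"
      "\<And>q. q \<in> candidates G n N P' Q' \<Longrightarrow> crossing k G n (C, D) \<le> crossing k G n q"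
  shows False
proof -
  have e: "eff_dist G A B P Q" "card (A \<inter> B) = n"
    "eff_dist G C D P' Q'" "card (C \<inter> D) = n"
    and N: "\<forall>t\<in>N. nested (A, B) t" "\<forall>t\<in>N. nested (C, D) t"
    using P(3) P'(3) by (simp_all add: candidates_def)
  have "distinguishes G A B P Q" "distinguishes G C D P' Q'"
    using e by (simp_all add: efficiently_distinguishes_def)
  then have f: "fsep k G A B" "fsep k G C D"
    using distinguishes_fsep[OF P(1)] distinguishes_fsep[OF P'(1)] by blast+
  have cross': "\<not> nested (B, A) (D, C)" "\<not> nested (D, C) (B, A)"
    using cross nested_commute nested_sym by blast+
  have e': "eff_dist G D C P' Q'" "eff_dist G B A P Q"
    using e eff_commute(1) by blast+
  have c1: "eff_dist G (A \<union> C) (B \<inter> D) P Q \<and> card ((A \<union> C) \<inter> (B \<inter> D)) = n"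
    using corner_eff[OF P(1) e(1) P'(1) e(3) _ d] e by simp
  have c2: "eff_dist G (D \<union> B) (C \<inter> A) P' Q' \<and> card ((D \<union> B) \<inter> (C \<inter> A)) = n"
    using corner_eff[OF P'(1) e'(1) P(1) e'(2)] d e corner_dist_commute
    by (metis Int_commute order_refl)
  have "nested (A \<union> C, B \<inter> D) t" "nested (D \<union> B, C \<inter> A) t" if "t \<in> N" for t
  proof -
    have t: "nested t (A, B)" "nested t (C, D)" "nested t (B, A)" "nested t (D, C)"
      using N that nested_sym nested_commute(2) by blast+
    show "nested (A \<union> C, B \<inter> D) t" using nested_corner[OF t(1,2) cross] nested_sym by blast
    show "nested (D \<union> B, C \<inter> A) t" using nested_corner[OF t(4,3) cross'(2)] nested_sym by blast
  qed
  then have "(A \<union> C, B \<inter> D) \<in> candidates G n N P Q" "(D \<union> B, C \<inter> A) \<in> candidates G n N P' Q'"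
    using c1 c2 by (simp_all add: candidates_def)
  then have "crossing k G n (A, B) \<le> crossing k G n (A \<union> C, B \<inter> D)"
    "crossing k G n (C, D) \<le> crossing k G n (D \<union> B, C \<inter> A)"
    using m by blast+
  moreover have "crossing k G n (D \<union> B, C \<inter> A) = crossing k G n (A \<inter> C, B \<union> D)"
    using crossing_swap[of k G n "(A \<inter> C, B \<union> D)"] by (simp add: Int_commute Un_commute)
  moreover have "(A, B) \<in> eff_seps k G n" using e P by (auto simp: eff_seps_def)
  ultimately show False
    using crossing_corners[OF G _ f cross, of n] by simp
qed

lemma candidates_commute: "(A, B) \<in> candidates G n N P Q \<longleftrightarrow> (B, A) \<in> candidates G n N P Q"
  using candidates_swap[of "(A, B)"] by simp

lemma crossing_commute: "crossing k G n (A, B) = crossing k G n (B, A)"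
  using crossing_swap[of k G n "(A, B)"] by simp

lemma optimal_nested:
  assumes G: "G \<in> graph_class" and r: "r \<in> optimal k G n N" "s \<in> optimal k G n N"
  shows "nested r s"
proof -
  obtain A B C D where rs: "r = (A, B)" "s = (C, D)" by (cases r, cases s)
  obtain P Q where P: "profile k G P" "profile k G Q"
    "(A, B) \<in> candidates G n N P Q"
    and m: "\<And>q. q \<in> candidates G n N P Q \<Longrightarrow> crossing k G n (A, B) \<le> crossing k G n q"
    using r(1) unfolding rs by (rule optimalE) blast
  obtain P' Q' where P': "profile k G P'" "profile k G Q'"
    "(C, D) \<in> candidates G n N P' Q'"
    and m': "\<And>q. q \<in> candidates G n N P' Q' \<Longrightarrow> crossing k G n (C, D) \<le> crossing k G n q"
    using r(2) unfolding rs by (rule optimalE) blast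
  have e: "distinguishes G A B P Q" "distinguishes G C D P' Q'"
    using P(3) P'(3) by (simp_all add: candidates_def efficiently_distinguishes_def)
  have P2: "(B, A) \<in> candidates G n N P Q" and P2': "(D, C) \<in> candidates G n N P' Q'"
    using P(3) P'(3) candidates_commute by blast+
  have m2: "\<And>q. q \<in> candidates G n N P Q \<Longrightarrow> crossing k G n (B, A) \<le> crossing k G n q"
    and m2': "\<And>q. q \<in> candidates G n N P' Q' \<Longrightarrow> crossing k G n (D, C) \<le> crossing k G n q"
    using m m' crossing_commute[of k G n A B] crossing_commute[of k G n C D] by simp_all
  have "nested (A, B) (C, D)"
  proof (rule ccontr)
    assume cross: "\<not> nested (A, B) (C, D)"
    have c: "\<not> nested (A, B) (D, C)" "\<not> nested (B, A) (C, D)" "\<not> nested (B, A) (D, C)"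
      using cross nested_commute by blast+
    show False
    proof (cases "distinguishes G C D P Q \<and> distinguishes G A B P' Q'")
      case False
      note step = optimal_corner_step[OF G P(1,2) _ P'(1,2)]
      note opposite_corners[OF P(1,2) e(1) P'(1,2) e(2) cross False]
      then show False
        using step[OF P(3) P'(3) cross _ _ m m'] step[OF P2 P2' c(3) _ _ m2 m2']
          step[OF P2 P'(3) c(2) _ _ m2 m'] step[OF P(3) P2' c(1) _ _ m m2'] by blast
    next
      \<comment> \<open>Here each separation is a candidate for the other pair as well, so they have
        equally many crossings and both are optimal for \<open>P\<close> and \<open>Q\<close>. The
        two opposite corners are then taken for this single pair.\<close>
      case True
      have "card (A \<inter> B) = n" "card (C \<inter> D) = n" "eff_dist G A B P Q"
        "eff_dist G C D P' Q'"
        and N: "\<forall>t\<in>N. nested (A, B) t" "\<forall>t\<in>N. nested (C, D) t"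
        using P(3) P'(3) by (simp_all add: candidates_def)
      then have CDc: "(C, D) \<in> candidates G n N P Q" and "(A, B) \<in> candidates G n N P' Q'"
        using True eff_iff[OF P(1), of _ _ Q] eff_iff[OF P'(1), of _ _ Q']
          by (simp_all add: candidates_def)
      then have "crossing k G n (C, D) = crossing k G n (A, B)" using m m'
        by (simp add: order_antisym)
      then have mC: "\<And>q. q \<in> candidates G n N P Q \<Longrightarrow> crossing k G n (C, D) \<le> crossing k G n q"
        "\<And>q. q \<in> candidates G n N P Q \<Longrightarrow> crossing k G n (D, C) \<le> crossing k G n q"
        using m crossing_commute[of k G n C D] by simp_all
      have DCc: "(D, C) \<in> candidates G n N P Q" using CDc candidates_commute by blast
      have "fsep k G C D" by (rule distinguishes_fsep[OF P'(1) e(2)])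
      note corner_dist_cases(1)[OF P(1,2) e(1) this cross]
      then show False
        using optimal_corner_step[OF G P P(1,2) CDc cross _ _ m mC(1)]
          optimal_corner_step[OF G P P(1,2) DCc c(1) _ _ m mC(2)] True by blast
    qed
  qed
  then show ?thesis by (simp add: rs)
qed

lemma eff_sepsD:
  assumes "(A, B) \<in> eff_seps k G n"
  shows "card (A \<inter> B) = n" "fsep k G A B" "n < k" "A \<noteq> B"
proof -
  obtain P Q where P: "profile k G P" "profile k G Q"
    "eff_dist G A B P Q" "card (A \<inter> B) = n"
    by (rule eff_sepsE[OF assms]) blast
  then show "fsep k G A B" "card (A \<inter> B) = n" "A \<noteq> B"
    using distinguishes_fsep[OF P(1)] by (auto simp: efficiently_distinguishes_def
      distinguishes_def)
  then show "n < k" using fsepD(3) by blast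
qed

text \<open>Being of smaller order, \<open>(C, D)\<close> cannot distinguish \<open>P\<close> and
  \<open>Q\<close>, so suitable opposite corners exist. The one belonging to \<open>P\<close> and
  \<open>Q\<close> keeps the order of \<open>(A, B)\<close>, is nested with \<open>(C, D)\<close>
  and acquires no new crossings among separations nested with \<open>(C, D)\<close>.\<close>

lemma lower_corner:
  assumes P: "profile k G P" "profile k G Q" "eff_dist G A B P Q"
    and CD: "(C, D) \<in> eff_seps k G m" "m < card (A \<inter> B)"
    and cross: "\<not> nested (A, B) (C, D)"
  obtains E F where "eff_dist G E F P Q" "card (E \<inter> F) = card (A \<inter> B)"
    "nested (E, F) (C, D)" "\<And>t. nested (A, B) t \<Longrightarrow> nested (C, D) t \<Longrightarrow> nested (E, F) t"
proof -
  obtain P' Q' where P': "profile k G P'" "profile k G Q'"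
    "eff_dist G C D P' Q'" "card (C \<inter> D) = m"
    by (rule eff_sepsE[OF CD(1)]) blast
  have c: "\<not> nested (A, B) (D, C)" "\<not> nested (B, A) (C, D)" "\<not> nested (B, A) (D, C)"
    using cross nested_commute by blast+
  have d: "distinguishes G A B P Q" "distinguishes G C D P' Q'"
    using P(3) P' by (simp_all add: efficiently_distinguishes_def)
  have d3: "\<not> distinguishes G C D P Q"
    using P(3) P'(4) CD(2) eff_iff[OF P(1)] leD by metis
  have e: "eff_dist G B A P Q" "eff_dist G D C P' Q'"
    using P(3) P'(3) eff_commute(1) by blast+
  have le: "card (C \<inter> D) \<le> card (A \<inter> B)" "card (D \<inter> C) \<le> card (A \<inter> B)"
    "card (C \<inter> D) \<le> card (B \<inter> A)" "card (D \<inter> C) \<le> card (B \<inter> A)"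
    using CD(2) P'(4) by (simp_all add: Int_commute)
  let ?good = "\<lambda>A B C D E F. eff_dist G E F P Q \<and> card (E \<inter> F) = card (A \<inter> B) \<and>
    nested (E, F) (C, D) \<and> (\<forall>t. nested (A, B) t \<and> nested (C, D) t \<longrightarrow> nested (E, F) t)"
  have corner: "?good A B C D (A \<union> C) (B \<inter> D)"
    if "eff_dist G (A \<union> C) (B \<inter> D) P Q \<and> card ((A \<union> C) \<inter> (B \<inter> D)) = card (A \<inter> B)"
      "\<not> nested (A, B) (C, D)" for A B C D
  proof (intro conjI allI impI)
    show "nested (A \<union> C, B \<inter> D) (C, D)" by (subst nested_sym) (rule nested_own_corner(3))
    fix t assume "nested (A, B) t \<and> nested (C, D) t"
    then show "nested (A \<union> C, B \<inter> D) t"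
      using nested_corner[of t A B C D] that(2) nested_sym by blast
  qed (use that in blast)+
  note flip = nested_commute(1)[of B A] nested_commute(1)[of D C] nested_commute(2)[of _ D C]
    Int_commute[of B A]
  consider "corner_dist k G P Q A B C D" "corner_dist k G P' Q' B A D C"
    | "corner_dist k G P Q B A D C" "corner_dist k G P' Q' A B C D"
    | "corner_dist k G P Q B A C D" "corner_dist k G P' Q' A B D C"
    | "corner_dist k G P Q A B D C" "corner_dist k G P' Q' B A C D"
    using opposite_corners[OF P(1,2) d(1) P'(1,2) d(2) cross] d3 by blast
  then have "\<exists>E F. ?good A B C D E F"
  proof cases
    case 1
    show ?thesis
      by (intro exI) (rule corner[OF corner_eff[OF P(1,3) P'(1,3) le(1) 1] cross])
  next
    case 2
    show ?thesis
      using corner[OF corner_eff[OF P(1) e(1) P'(1) e(2) le(4) 2] c(3)] unfolding flip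
        by (intro exI)
  next
    case 3
    show ?thesis
      using corner[OF corner_eff[OF P(1) e(1) P'(1,3) le(3) 3] c(2)] unfolding flip by (intro exI)
  next
    case 4
    show ?thesis
      using corner[OF corner_eff[OF P(1,3) P'(1) e(2) le(2) 4] c(1)] unfolding flip by (intro exI)
  qed
  then show thesis using that by blast
qed

lemma levels_nested:
  assumes G: "G \<in> graph_class" and r: "r \<in> levels k G n" "s \<in> levels k G n"
  shows "nested r s"
  using r
proof (induction n)
  case (Suc n)
  have "nested r s" if "r \<in> optimal k G n (levels k G n)" "s \<in> levels k G n" for r s
    using that by (auto simp: optimal_def candidates_def)
  note old_new = this
  consider "r \<in> levels k G n" "s \<in> levels k G n"
    | "r \<in> optimal k G n (levels k G n)" "s \<in> optimal k G n (levels k G n)"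
    | "r \<in> optimal k G n (levels k G n)" "s \<in> levels k G n"
    | "s \<in> optimal k G n (levels k G n)" "r \<in> levels k G n"
    using Suc.prems by auto
  then show ?case
    by cases (use Suc.IH optimal_nested[OF G] old_new nested_sym in blast)+
qed simp

text \<open>Take an efficient distinguisher crossing as few earlier choices as possible. If it still
  crossed one of them, \<open>lower_corner\<close> would provide another that crosses fewer, the
  earlier choices being nested with each other.\<close>

lemma candidates_nonempty:
  assumes G: "G \<in> graph_class"
    and P: "profile k G P" "profile k G Q"
    and AB: "eff_dist G A B P Q" "card (A \<inter> B) = n"
  shows "candidates G n (levels k G n) P Q \<noteq> {}"
proof -
  let ?N = "levels k G n"
  let ?c = "\<lambda>(A, B). {t \<in> ?N. \<not> nested (A, B) t}"
  let ?ok = "\<lambda>(A, B). eff_dist G A B P Q \<and> card (A \<inter> B) = n"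
  have fin: "finite (?c (A, B))" if "?ok (A, B)" for A B
  proof -
    have "fsep k G A B" using eff_fsep[OF P(1)] that by blast
    then have "finite (\<Union>m<n. {t \<in> eff_seps k G m. \<not> nested (A, B) t})"
      using finite_crossing_eff[OF G] by blast
    then show ?thesis by (rule rev_finite_subset) (use levels_eff[of k G n] in auto)
  qed
  define r where "r = arg_min (\<lambda>r. card (?c r)) ?ok"
  have ok: "?ok r" and min: "\<And>q. ?ok q \<Longrightarrow> card (?c r) \<le> card (?c q)"
    unfolding r_def using arg_min_nat_lemma[of ?ok "(A, B)" "\<lambda>r. card (?c r)"] AB by auto
  obtain C D where r: "r = (C, D)" by (cases r)
  have "?c r = {}"
  proof (rule ccontr)
    assume "?c r \<noteq> {}"
    then obtain E F where EF: "(E, F) \<in> ?N" "\<not> nested (C, D) (E, F)" using r by auto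
    then obtain m where m: "(E, F) \<in> eff_seps k G m" "m < n" using levels_eff by blast
    have CD: "eff_dist G C D P Q" "card (C \<inter> D) = n" using ok r by auto
    obtain X Y where XY: "eff_dist G X Y P Q" "card (X \<inter> Y) = card (C \<inter> D)"
      "nested (X, Y) (E, F)" "\<And>t. nested (C, D) t \<Longrightarrow> nested (E, F) t \<Longrightarrow> nested (X, Y) t"
      using lower_corner[OF P CD(1) m(1) _ EF(2)] m(2) CD(2) by metis
    have "?c (X, Y) \<subseteq> ?c r" using XY(4) levels_nested[OF G EF(1)] r by auto
    moreover have "(E, F) \<in> ?c r" "(E, F) \<notin> ?c (X, Y)" using EF XY(3) r by auto
    ultimately have "?c (X, Y) \<subset> ?c r" by blast
    then have "card (?c (X, Y)) < card (?c r)"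
      using psubset_card_mono fin[of C D] ok r by blast
    moreover have "?ok (X, Y)" using XY CD by simp
    ultimately show False using min[of "(X, Y)"] by simp
  qed
  then have "(C, D) \<in> candidates G n ?N P Q" using ok r by (auto simp: candidates_def)
  then show ?thesis by blast
qed

lemma levels_mono: "n \<le> m \<Longrightarrow> levels k G n \<subseteq> levels k G m"
  by (induction m) (auto simp: le_Suc_eq)

lemma levels_distinguish:
  assumes G: "G \<in> graph_class"
    and P: "profile k G P" "profile k G Q" "P \<noteq> Q"
  obtains A B where "(A, B) \<in> levels k G k" "eff_dist G A B P Q"
proof -
  obtain A B where AB: "eff_dist G A B P Q" using exists_eff[OF P] by metis
  define n where "n = card (A \<inter> B)"
  have "fsep k G A B" using eff_fsep[OF P(1) AB] .
  then have nk: "n < k" using fsepD(3) n_def by blast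
  let ?C = "candidates G n (levels k G n) P Q"
  obtain q where "q \<in> ?C" using candidates_nonempty[OF G P(1,2) AB] n_def by auto
  then obtain r where r: "r \<in> ?C" "\<And>q. q \<in> ?C \<Longrightarrow> crossing k G n r \<le> crossing k G n q"
    using arg_min_nat_lemma[of "\<lambda>q. q \<in> ?C" q "crossing k G n"] by blast
  then have "r \<in> optimal k G n (levels k G n)" unfolding optimal_def using P(1,2) by blast
  then have "r \<in> levels k G (Suc n)" by simp
  then have "r \<in> levels k G k" using levels_mono[of "Suc n" k k G] nk by auto
  moreover obtain C D where "r = (C, D)" by (cases r)
  ultimately show thesis using that r(1) by (auto simp: candidates_def)
qed

section \<open>Blocks\<close>

lemma card_subset_less: "X \<subseteq> Y \<Longrightarrow> finite Y \<Longrightarrow> card Y < k \<Longrightarrow> finite X \<and> card X < k"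
  by (meson card_mono finite_subset le_less_trans)

definition inseparable :: "nat \<Rightarrow> 'a ugraph \<Rightarrow> 'a set \<Rightarrow> bool" where
  "inseparable k G b \<longleftrightarrow> b \<subseteq> verts G \<and> enat k \<le> esize b \<and> (\<forall>A B. fsep k G A B \<longrightarrow> b \<subseteq> A \<or> b \<subseteq> B)"

lemma inseparable_not_subset_separator:
  assumes "inseparable k G b" "finite X" "card X < k"
  shows "\<not> b \<subseteq> X"
proof
  assume b: "b \<subseteq> X"
  then have "card b \<le> card X" "finite b" using assms(2) card_mono finite_subset by blast+
  then show False using assms by (simp add: inseparable_def esize_def)
qed

lemma inseparable_fsep:
  assumes "inseparable k G b" "fsep k G A B"
  shows "b \<subseteq> A \<longleftrightarrow> \<not> b \<subseteq> B" "A \<noteq> B"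
proof -
  have "\<not> b \<subseteq> A \<inter> B"
    by (rule inseparable_not_subset_separator[OF assms(1) fsepD(2,3)[OF assms(2)]])
  moreover have "b \<subseteq> A \<or> b \<subseteq> B" using assms by (simp add: inseparable_def)
  ultimately show "b \<subseteq> A \<longleftrightarrow> \<not> b \<subseteq> B" "A \<noteq> B" by blast+
qed

text \<open>A set \<open>X\<close> separating \<open>v\<close> from \<open>w\<close> becomes the
  separation \<open>(K \<union> X, V - K)\<close>, where \<open>K\<close> is the component of
  \<open>v\<close> in \<open>G - X\<close>; conversely, that component for
  \<open>X = A \<inter> B\<close> stays inside \<open>A - B\<close>.\<close>

lemma is_inseparable_iff:
  assumes s: "simple_graph G"
  shows "is_inseparable k G b \<longleftrightarrow> inseparable k G b"
proof -
  have 1: "can_separate k G v w" if f: "fsep k G A B" "v \<in> A - B" "w \<in> B - A" for A B v w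
  proof -
    note AB = fsepD[OF f(1)]
    let ?K = "component_of (induced G (verts G - A \<inter> B)) v"
    have "v \<in> verts G - A \<inter> B" using f(2) AB(5) by blast
    then have K: "is_comp G (A \<inter> B) ?K" by (rule conn_set_reachable[OF s])
    have "v \<in> ?K" using f(2) AB(5) by (auto simp: component_of_def reachable_def induced_def)
    then have "?K \<subseteq> A - B" using sep_comp[OF AB(1), of ?K] compD[OF K] f(2) by blast
    then have "\<not> reachable (induced G (verts G - A \<inter> B)) v w"
      using f(3) by (auto simp: component_of_def)
    moreover have "A \<inter> B \<subseteq> verts G - {v, w}" using AB(5) f by blast
    ultimately show ?thesis unfolding can_separate_def using AB(2,3) by blast
  qed
  have 2: "\<exists>A B. fsep k G A B \<and> v \<in> A - B \<and> w \<in> B - A"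
    if vw: "can_separate k G v w" "v \<in> verts G" "w \<in> verts G" for v w
  proof -
    obtain X where X: "X \<subseteq> verts G - {v, w}" "finite X" "card X < k"
      "\<not> reachable (induced G (verts G - X)) v w"
      using vw(1) by (auto simp: can_separate_def)
    let ?K = "component_of (induced G (verts G - X)) v"
    have v: "v \<in> verts G - X" using X vw by blast
    have K: "is_comp G X ?K" by (rule conn_set_reachable[OF s v])
    have "v \<in> ?K" using v by (auto simp: component_of_def reachable_def induced_def)
    moreover have "w \<notin> ?K" using X(4) by (simp add: component_of_def)
    moreover have "is_separation G (?K \<union> X) (verts G - ?K)"
      by (rule sepI_nbhd[OF s]) (use compD[OF K] X in auto)
    moreover have "(?K \<union> X) \<inter> (verts G - ?K) = X" using compD[OF K] X(1) by blast
    ultimately show ?thesis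
      using X vw v by (intro exI[of _ "?K \<union> X"] exI[of _ "verts G - ?K"]) (auto simp: fsep_def)
  qed
  have "(\<forall>v\<in>b. \<forall>w\<in>b. v \<noteq> w \<longrightarrow> \<not> can_separate k G v w) \<longleftrightarrow>
      (\<forall>A B. fsep k G A B \<longrightarrow> b \<subseteq> A \<or> b \<subseteq> B)" (is "?L \<longleftrightarrow> ?R") if b: "b \<subseteq> verts G"
  proof
    assume L: ?L
    show ?R
    proof (intro allI impI)
      fix A B assume f: "fsep k G A B"
      show "b \<subseteq> A \<or> b \<subseteq> B"
      proof (rule ccontr)
        assume "\<not> ?thesis"
        then obtain v w where vw: "v \<in> b" "v \<notin> B" "w \<in> b" "w \<notin> A" by (auto simp: subset_iff)
        then have *: "v \<in> A - B" "w \<in> B - A" using fsepD(4)[OF f] b by blast+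
        then have "v \<noteq> w" by blast
        then show False using 1[OF f *] L vw by blast
      qed
    qed
  next
    assume R: ?R
    show ?L
    proof (intro ballI impI notI)
      fix v w assume vw: "v \<in> b" "w \<in> b" "can_separate k G v w"
      then obtain A B where "fsep k G A B" "v \<in> A - B" "w \<in> B - A" using 2[of v w] b by blast
      then show False using R vw by blast
    qed
  qed
  then show ?thesis unfolding is_inseparable_def inseparable_def by blast
qed

section \<open>Blocks as profiles\<close>

definition block_profile :: "nat \<Rightarrow> 'a ugraph \<Rightarrow> 'a set \<Rightarrow> 'a osep set" where
  "block_profile k G b = {(A, B). fsep k G A B \<and> b \<subseteq> B}"

text \<open>With at least \<open>k\<close> vertices, \<open>b\<close> does not fit into a separator,
  so exactly one side of each separation contains it. All axioms follow from this.\<close>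

lemma block_profile_is_profile:
  assumes b: "inseparable k G b"
  shows "profile k G (block_profile k G b)" (is "profile _ _ ?P")
  unfolding is_profile_def
proof (intro conjI allI impI)
  show "is_orientation (enat k) G ?P"
    unfolding is_orientation_def
  proof (intro conjI allI impI)
    show "?P \<subseteq> oseps (enat k) G" using oseps_iff by (fastforce simp: block_profile_def)
    fix A B assume "{A, B} \<in> seps (enat k) G"
    then have f: "fsep k G A B" "fsep k G B A" using seps_iff fsep_commute by metis+
    note i = inseparable_fsep[OF b f(1)]
    show "\<exists>!s. s \<in> {(A, B), (B, A)} \<and> s \<in> ?P"
    proof (cases "b \<subseteq> B")
      case True
      then show ?thesis using f i by (intro ex1I[of _ "(A, B)"]) (auto simp: block_profile_def)
    next
      case False
      then show ?thesis using f i by (intro ex1I[of _ "(B, A)"]) (auto simp: block_profile_def)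
    qed
  qed
  show "consistent (enat k) G ?P"
    unfolding consistent_def
  proof (rule notI, elim exE conjE)
    fix A B C D assume "osep_less (A, B) (C, D)" "(B, A) \<in> ?P" "(C, D) \<in> ?P"
    then have "b \<subseteq> C" "b \<subseteq> D" "fsep k G C D"
      by (auto simp: block_profile_def osep_less_def osep_le_def)
    then show False using inseparable_fsep(1)[OF b] by blast
  qed
  fix A B C D assume *: "(A, B) \<in> ?P \<and> (C, D) \<in> ?P"
  show "(B \<inter> D, A \<union> C) \<notin> ?P"
  proof
    assume "(B \<inter> D, A \<union> C) \<in> ?P"
    then have "fsep k G (B \<inter> D) (A \<union> C)" "b \<subseteq> A \<union> C" by (auto simp: block_profile_def)
    moreover have "b \<subseteq> B \<inter> D" using * by (auto simp: block_profile_def)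
    ultimately show False using inseparable_fsep(1)[OF b] by blast
  qed
qed

lemma blockD:
  assumes "simple_graph G" "is_block k G b"
  shows "inseparable k G b" "\<And>c. inseparable k G c \<Longrightarrow> b \<subseteq> c \<Longrightarrow> c = b"
  using assms(2) is_inseparable_iff[OF assms(1)] by (auto simp: is_block_def)

text \<open>If every separation has both blocks on the same side, their union is inseparable, and
  maximality makes each block equal to it.\<close>

lemma block_profile_inj:
  assumes s: "simple_graph G" and b: "is_block k G b" "is_block k G c"
    and eq: "block_profile k G b = block_profile k G c"
  shows "b = c"
proof -
  note b' = blockD[OF s b(1)] and c' = blockD[OF s b(2)]
  have "inseparable k G (b \<union> c)"
    unfolding inseparable_def
  proof (intro conjI allI impI)
    show "b \<union> c \<subseteq> verts G" using b'(1) c'(1) by (simp add: inseparable_def)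
    have "enat k \<le> esize b" using b'(1) by (simp add: inseparable_def)
    also have "\<dots> \<le> esize (b \<union> c)" by (auto simp: esize_def intro: card_mono)
    finally show "enat k \<le> esize (b \<union> c)" .
    fix A B assume f: "fsep k G A B"
    then have f': "fsep k G B A" using fsep_commute by blast
    have iff: "b \<subseteq> B \<longleftrightarrow> c \<subseteq> B" if "fsep k G A B" for A B
      using eq that by (auto simp: block_profile_def set_eq_iff)
    have "b \<subseteq> A \<or> b \<subseteq> B" using inseparable_fsep(1)[OF b'(1) f] by blast
    then show "b \<union> c \<subseteq> A \<or> b \<union> c \<subseteq> B" using iff[OF f] iff[OF f'] by blast
  qed
  then have "b \<union> c = b" "b \<union> c = c" using b'(2) c'(2) by blast+
  then show ?thesis by simp
qed

text \<open>Here the star is used. Some \<open>(A, B)\<close> in it has a vertex of \<open>K\<close>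
  outside \<open>B\<close>. A vertex of \<open>K\<close> in \<open>A \<inter> B\<close> would be
  outside \<open>D\<close> for another \<open>(C, D)\<close> in the star, although
  \<open>A \<subseteq> D\<close>. So \<open>K\<close> lies in \<open>A - B\<close>, and its
  neighbourhood, being contained in \<open>b\<close> and hence in \<open>B\<close>, lies in
  \<open>A \<inter> B\<close>.\<close>

lemma separable_block_comp:
  assumes b: "separable_block k G b" and K: "is_comp G b K"
  shows "finite (nbhd G K)" "card (nbhd G K) < k"
proof -
  obtain \<sigma> where \<sigma>: "is_star G \<sigma>" "\<sigma> \<subseteq> oseps (enat k) G" "star_interior G \<sigma> = b"
    using b by (auto simp: separable_block_def)
  note K' = compD[OF K]
  obtain v where v: "v \<in> K" using K'(3) by blast
  have ex: "\<exists>A B. (A, B) \<in> \<sigma> \<and> x \<notin> B" if "x \<in> K" for x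
    using that K'(1,2) \<sigma>(3) by (auto simp: star_interior_def)
  obtain A B where AB: "(A, B) \<in> \<sigma>" "v \<notin> B" using ex[OF v] by blast
  have "(A, B) \<in> oseps (enat k) G" using AB(1) \<sigma>(2) by blast
  then have f: "fsep k G A B" by (simp only: oseps_iff)
  have "x \<notin> K" if x: "x \<in> A \<inter> B" for x
  proof
    assume "x \<in> K"
    then obtain C D where CD: "(C, D) \<in> \<sigma>" "x \<notin> D" using ex by blast
    then have "(A, B) \<noteq> (C, D)" using x by blast
    then have "osep_le (A, B) (D, C)" using \<sigma>(1) AB(1) CD(1) unfolding is_star_def by blast
    then show False using x CD(2) by (auto simp: osep_le_def)
  qed
  then have "K \<subseteq> A - B \<or> K \<subseteq> B - A" using sep_comp[OF fsepD(1)[OF f] K'(4,1)] by blast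
  then have "K \<subseteq> A - B" using v AB(2) by blast
  then have "nbhd G K \<subseteq> (A - B) \<union> nbhd G (A - B)" by (auto simp: nbhd_def)
  then have "nbhd G K \<subseteq> A" using sep_nbhd[OF fsepD(1)[OF f]] by blast
  moreover have "nbhd G K \<subseteq> B" using K'(5) \<sigma>(3) AB(1) by (auto simp: star_interior_def)
  ultimately have "nbhd G K \<subseteq> A \<inter> B" by blast
  then show "finite (nbhd G K)" "card (nbhd G K) < k"
    using card_subset_less[OF _ fsepD(2,3)[OF f]] by blast+
qed

text \<open>\<open>L\<close> avoids \<open>b\<close>, so it lies in one component \<open>K\<close>
  of \<open>G - b\<close>, and the separator \<open>nbhd G L\<close> lies in \<open>K\<close> or its
  neighbourhood. Every other component of \<open>G - b\<close> avoids the separator and is not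
  split.\<close>

lemma tight_side_structure:
  assumes s: "simple_graph G" and CD: "is_separation G C D"
    and L: "is_comp G (C \<inter> D) L" "L \<subseteq> C - D" "nbhd G L = C \<inter> D" and b: "b \<subseteq> D"
  obtains K where "is_comp G b K" "L \<subseteq> K" "C \<inter> D \<subseteq> K \<union> nbhd G K"
    "\<And>K'. is_comp G b K' \<Longrightarrow> K' \<noteq> K \<Longrightarrow> K' \<subseteq> C - D \<or> K' \<inter> C = {}"
proof -
  note L' = compD[OF L(1)]
  obtain l where l: "l \<in> L" using L'(3) by blast
  have Lb: "L \<inter> b = {}" using L(2) b by blast
  obtain K where K: "is_comp G b K" "l \<in> K" using comp_exists[OF s, of l b] l L'(1) Lb by blast
  have LK: "L \<subseteq> K" using conn_set_subset_comp[OF L'(4) K(1) Lb] l K(2) by blast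
  have "nbhd G L \<subseteq> K \<union> nbhd G K" using LK by (auto simp: nbhd_def)
  then have CDK: "C \<inter> D \<subseteq> K \<union> nbhd G K" by (simp only: L(3))
  have "K' \<subseteq> C - D \<or> K' \<inter> C = {}" if K': "is_comp G b K'" "K' \<noteq> K" for K'
  proof -
    have "K' \<inter> K = {}" using comp_eq[OF K'(1) K(1)] K'(2) by blast
    moreover have "K' \<inter> nbhd G K = {}" using compD[OF K'(1)] compD[OF K(1)] by blast
    ultimately have "K' \<inter> (C \<inter> D) = {}" using CDK by blast
    then show ?thesis using sep_comp[OF CD, of K'] compD[OF K'(1)] by blast
  qed
  then show thesis using that K(1) LK CDK by blast
qed

section \<open>Separating the remaining components from a block\<close>

definition uncovered :: "'a ugraph \<Rightarrow> 'a osep set \<Rightarrow> 'a set \<Rightarrow> 'a set \<Rightarrow> bool" where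
  "uncovered G N b K \<longleftrightarrow> is_comp G b K \<and> (\<forall>C D. (C, D) \<in> N \<and> b \<subseteq> D \<longrightarrow> \<not> K \<subseteq> C - D)"

text \<open>The separation of a component \<open>K\<close> of \<open>G - b\<close> from \<open>b\<close> may cross \<open>N\<close>, but only because the far
  side of a separation in \<open>N\<close> meets \<open>K\<close> and contains further, whole components of \<open>G - b\<close>. Adding
  these to \<open>K\<close> does not change the neighbourhood.\<close>

definition enlarged :: "'a osep set \<Rightarrow> 'a set \<Rightarrow> 'a set \<Rightarrow> 'a set" where
  "enlarged N b K = K \<union> \<Union>{C - D |C D. (C, D) \<in> N \<and> b \<subseteq> D \<and> (C - D) \<inter> K \<noteq> {}}"

lemma in_enlarged:
  "x \<in> enlarged N b K \<longleftrightarrow> x \<in> K \<or> (\<exists>C D. (C, D) \<in> N \<and> b \<subseteq> D \<and> (C - D) \<inter> K \<noteq> {} \<and> x \<in> C - D)"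
  unfolding enlarged_def by blast

text \<open>Transitivity through \<open>(C, D)\<close>. The hypotheses have the shape provided by
  \<open>enlarged_vs_N\<close> for two blocks on different sides of \<open>(C, D)\<close>.\<close>

lemma nested_via:
  assumes "D \<subseteq> A \<and> B \<subseteq> C \<or> A \<subseteq> C \<and> D \<subseteq> B" "C \<subseteq> A' \<and> B' \<subseteq> D \<or> A' \<subseteq> D \<and> C \<subseteq> B'"
  shows "nested (A, B) (A', B')"
  using assms subset_trans[of B C A'] subset_trans[of B' D A] subset_trans[of A' D A]
    subset_trans[of B C B'] subset_trans[of A C A'] subset_trans[of B' D B] subset_trans[of A C B']
    subset_trans[of A' D B]
  unfolding nested_iff by argo

locale nested_tight =
  fixes G :: "'a ugraph" and k :: nat and N :: "'a osep set"
  assumes G: "G \<in> graph_class"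
    and tight: "N \<subseteq> tight_seps k G"
    and nested: "r \<in> N \<Longrightarrow> s \<in> N \<Longrightarrow> nested r s"
begin

lemma simple: "simple_graph G"
  using G by (simp add: graph_class_def)

lemma N_fsep: "(A, B) \<in> N \<Longrightarrow> fsep k G A B"
  using tight by (auto simp: tight_seps_def fsep_def)

lemma N_half_tight: "(A, B) \<in> N \<Longrightarrow> half_tight G A B"
  using tight by (auto simp: tight_seps_def)

lemma N_side_structure:
  assumes CD: "(C, D) \<in> N" "D \<noteq> verts G" "b \<subseteq> D"
  obtains K where "is_comp G b K" "K \<inter> (C - D) \<noteq> {}" "C \<inter> D \<subseteq> K \<union> nbhd G K"
    "\<And>K'. is_comp G b K' \<Longrightarrow> K' \<noteq> K \<Longrightarrow> K' \<subseteq> C - D \<or> K' \<inter> C = {}"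
proof -
  obtain L where L: "is_comp G (C \<inter> D) L" "L \<subseteq> C - D" "nbhd G L = C \<inter> D"
    using N_half_tight[OF CD(1)] CD(2) by (auto simp: half_tight_def)
  obtain K where "is_comp G b K" "L \<subseteq> K" "C \<inter> D \<subseteq> K \<union> nbhd G K"
    "\<And>K'. is_comp G b K' \<Longrightarrow> K' \<noteq> K \<Longrightarrow> K' \<subseteq> C - D \<or> K' \<inter> C = {}"
    by (rule tight_side_structure[OF simple fsepD(1)[OF N_fsep[OF CD(1)]] L CD(3)]) blast
  moreover have "L \<noteq> {}" using compD[OF L(1)] by blast
  ultimately show thesis using that L(2) by blast
qed

text \<open>Every component of \<open>G - b\<close> that meets \<open>C - D\<close>, except the
  distinguished one from \<open>N_side_structure\<close>, lies in \<open>C - D\<close> and is thus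
  covered. So \<open>K\<close> is the distinguished one.\<close>

lemma N_meets_uncovered:
  assumes K: "uncovered G N b K" and CD: "(C, D) \<in> N" "b \<subseteq> D" "(C - D) \<inter> K \<noteq> {}"
  shows "C \<inter> D \<subseteq> K \<union> nbhd G K" "\<And>K'. is_comp G b K' \<Longrightarrow> K' \<noteq> K \<Longrightarrow> K' \<subseteq> C - D \<or> K' \<inter> C = {}"
proof -
  have "D \<noteq> verts G" using CD(3) fsepD(5)[OF N_fsep[OF CD(1)]] by blast
  then obtain K0 where K0: "is_comp G b K0" "C \<inter> D \<subseteq> K0 \<union> nbhd G K0"
    "\<And>K'. is_comp G b K' \<Longrightarrow> K' \<noteq> K0 \<Longrightarrow> K' \<subseteq> C - D \<or> K' \<inter> C = {}"
    using N_side_structure[OF CD(1) _ CD(2)] by metis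
  have "K = K0" using K0(3)[of K] K CD unfolding uncovered_def by blast
  then show "C \<inter> D \<subseteq> K \<union> nbhd G K" "\<And>K'. is_comp G b K' \<Longrightarrow> K' \<noteq> K \<Longrightarrow> K' \<subseteq> C - D \<or> K' \<inter> C = {}"
    using K0 by blast+
qed

lemma enlarged_basic:
  assumes K: "uncovered G N b K"
  shows "K \<subseteq> enlarged N b K" "enlarged N b K \<subseteq> verts G" "enlarged N b K \<inter> b = {}"
    "nbhd G (enlarged N b K) \<subseteq> nbhd G K" "nbhd G K \<subseteq> b"
    "is_separation G (enlarged N b K \<union> nbhd G K) (verts G - enlarged N b K)"
    "(enlarged N b K \<union> nbhd G K) \<inter> (verts G - enlarged N b K) = nbhd G K"
proof -
  let ?Z = "enlarged N b K"
  have c: "is_comp G b K" using K by (simp add: uncovered_def)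
  note c' = compD[OF c]
  show 1: "K \<subseteq> ?Z" by (simp add: enlarged_def)
  show 2: "?Z \<subseteq> verts G" using c'(1) N_fsep fsepD(5) unfolding enlarged_def by blast
  show 3: "?Z \<inter> b = {}" using c'(2) unfolding enlarged_def by blast
  show 5: "nbhd G K \<subseteq> b" by (rule c'(5))
  show 4: "nbhd G ?Z \<subseteq> nbhd G K"
  proof
    fix v assume "v \<in> nbhd G ?Z"
    then obtain u where v: "v \<in> verts G" "v \<notin> ?Z" and u: "u \<in> ?Z" "{u, v} \<in> edges G"
      by (auto simp: nbhd_def)
    have vK: "v \<notin> K" using v 1 by blast
    from u(1) consider "u \<in> K" | C D where "(C, D) \<in> N" "b \<subseteq> D" "(C - D) \<inter> K \<noteq> {}" "u \<in> C - D"
      unfolding enlarged_def by blast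
    then show "v \<in> nbhd G K"
    proof cases
      case 1
      then show ?thesis using nbhdI[OF simple _ u(2) vK] by blast
    next
      \<comment> \<open>An edge leaving an added side ends in \<open>C \<inter> D\<close>, hence in
        \<open>K\<close> or its neighbourhood.\<close>
      case 2
      have "v \<in> C" by (rule sep_edgeD[OF fsepD(1)[OF N_fsep[OF 2(1)]] 2(4) u(2) v(1)])
      moreover have "v \<notin> C - D" using v(2) 2(1-3) unfolding enlarged_def by blast
      ultimately show ?thesis using N_meets_uncovered(1)[OF K 2(1-3)] vK by blast
    qed
  qed
  show "is_separation G (?Z \<union> nbhd G K) (verts G - ?Z)"
    by (rule sepI_nbhd[OF simple 2 _ 4]) (rule nbhd_subset)
  show "(?Z \<union> nbhd G K) \<inter> (verts G - ?Z) = nbhd G K"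
    using 3 5 nbhd_subset(1)[of G K] by blast
qed

text \<open>On the side of the enlarged set, \<open>K\<close> itself is attached to the whole
  separator. On the other side, some \<open>v\<close> in \<open>b\<close> is outside the separator
  for reasons of size; let \<open>L\<close> be its component. A separator vertex \<open>y\<close>
  not adjacent to \<open>L\<close> would be separated by \<open>nbhd G L\<close> from
  \<open>v\<close>, but both belong to \<open>b\<close>.\<close>

lemma enlarged_tight:
  assumes K: "uncovered G N b K" and b: "inseparable k G b"
    and small: "finite (nbhd G K)" "card (nbhd G K) < k"
  shows "(enlarged N b K \<union> nbhd G K, verts G - enlarged N b K) \<in> tight_seps k G"
proof -
  let ?Z = "enlarged N b K"
  let ?A = "?Z \<union> nbhd G K" and ?B = "verts G - ?Z"
  note e = enlarged_basic[OF K]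
  have c: "is_comp G b K" using K by (simp add: uncovered_def)
  have "half_tight G ?A ?B"
    unfolding half_tight_def e(7) using comp_of_nbhd[OF c] e by blast
  moreover have "half_tight G ?B ?A"
  proof -
    obtain v where v: "v \<in> b" "v \<notin> nbhd G K"
      using inseparable_not_subset_separator[OF b small] by blast
    have bV: "b \<subseteq> verts G" using b by (simp add: inseparable_def)
    then obtain L where L: "is_comp G (nbhd G K) L" "v \<in> L"
      using comp_exists[OF simple, of v "nbhd G K"] v by blast
    note L' = compD[OF L(1)]
    have "y \<in> nbhd G L" if y: "y \<in> nbhd G K" for y
    proof (rule ccontr)
      assume ny: "y \<notin> nbhd G L"
      have int: "(L \<union> nbhd G L) \<inter> (verts G - L) = nbhd G L" using nbhd_subset[of G L] by blast
      have "is_separation G (L \<union> nbhd G L) (verts G - L)"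
        using sepI_nbhd[OF simple L'(1) nbhd_subset(1)] by blast
      moreover have "finite (nbhd G L)" "card (nbhd G L) < k"
        using card_subset_less[OF L'(5) small] by blast+
      ultimately have "fsep k G (L \<union> nbhd G L) (verts G - L)" by (simp add: fsep_def int)
      then have "b \<subseteq> L \<union> nbhd G L \<or> b \<subseteq> verts G - L" using b by (simp add: inseparable_def)
      then show False using v(1) L(2) y e(5) ny L'(2) by blast
    qed
    then have "nbhd G L = nbhd G K" using L'(5) by blast
    moreover have "L \<subseteq> ?B - ?A"
    proof -
      have "L \<subseteq> ?A - ?B \<or> L \<subseteq> ?B - ?A" using sep_comp[OF e(6) L'(4,1)] L'(2) e(7) by blast
      moreover have "v \<notin> ?A" using v e(3) by blast
      ultimately show ?thesis using L(2) by blast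
    qed
    moreover have "?B \<inter> ?A = nbhd G K" using e(7) by blast
    ultimately show ?thesis unfolding half_tight_def using L(1) by metis
  qed
  ultimately show ?thesis using e(6,7) small by (simp add: tight_seps_def)
qed

text \<open>If \<open>E - F\<close> meets \<open>K\<close>, it was added and
  \<open>(E, F) \<le> (A, B)\<close>. Otherwise, apart from the degenerate case, \<open>K\<close>
  misses \<open>E\<close>. Then either \<open>(E, F)\<close> lies below a side that was added, or
  each added side points away from \<open>(E, F)\<close>; in that case the enlarged set avoids
  \<open>E\<close> and \<open>(A, B) \<le> (F, E)\<close>.\<close>

lemma enlarged_vs_N:
  assumes K: "uncovered G N b K" and b: "inseparable k G b" and EF: "(E, F) \<in> N" "b \<subseteq> F"
  defines "A \<equiv> enlarged N b K \<union> nbhd G K" and "B \<equiv> verts G - enlarged N b K"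
  shows "E \<subseteq> A \<and> B \<subseteq> F \<or> A \<subseteq> F \<and> E \<subseteq> B"
proof -
  let ?Z = "enlarged N b K"
  note e = enlarged_basic[OF K]
  note EF' = fsepD[OF N_fsep[OF EF(1)]]
  have c: "is_comp G b K" using K by (simp add: uncovered_def)
  have AB: "A \<union> B = verts G" "A \<subseteq> verts G" unfolding A_def B_def using e(2) nbhd_subset(1)[of G K]
    by blast+
  show ?thesis
  proof (cases "F = verts G")
    case True
    then have "E - F = {}" using EF'(5) by blast
    then have "finite E" "card E \<le> 1"
      using N_half_tight[OF EF(1)] compD(3)[of G "E \<inter> F"] unfolding half_tight_def by blast+
    then have "nested (E, F) (A, B)"
      using trivial_nested[of G A B F E] True e(6) EF'(5) unfolding A_def B_def by blast
    moreover have "F \<subseteq> A \<Longrightarrow> E \<subseteq> A" "F \<subseteq> B \<Longrightarrow> E \<subseteq> B" using True EF'(5) by blast+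
    ultimately have "E \<subseteq> A \<or> E \<subseteq> B" unfolding nested_iff by argo
    then show ?thesis using True AB unfolding B_def by blast
  next
    case False
    show ?thesis
    proof (cases "(E - F) \<inter> K = {}")
      case False
      have "E \<inter> F \<subseteq> K \<union> nbhd G K" by (rule N_meets_uncovered(1)[OF K EF False])
      moreover have "E - F \<subseteq> ?Z" using EF False unfolding enlarged_def by blast
      ultimately show ?thesis unfolding A_def B_def using e(1) EF'(4) by blast
    next
      case True
      obtain K0 where K0: "K0 \<inter> (E - F) \<noteq> {}"
        "\<And>K'. is_comp G b K' \<Longrightarrow> K' \<noteq> K0 \<Longrightarrow> K' \<subseteq> E - F \<or> K' \<inter> E = {}"
        using N_side_structure[OF EF(1) False EF(2)] by metis
      have "K \<noteq> K0" using K0(1) True by blast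
      then have KE: "K \<inter> E = {}" using K0(2)[OF c] compD(3)[OF c] True by blast
      show ?thesis
      proof (cases "\<exists>C D. (C, D) \<in> N \<and> b \<subseteq> D \<and> (C - D) \<inter> K \<noteq> {} \<and> E \<subseteq> C \<and> D \<subseteq> F")
        case True
        then obtain C D where CD: "(C, D) \<in> N" "b \<subseteq> D" "(C - D) \<inter> K \<noteq> {}" "E \<subseteq> C" "D \<subseteq> F" by blast
        have "C \<inter> D \<subseteq> K \<union> nbhd G K" by (rule N_meets_uncovered(1)[OF K CD(1-3)])
        moreover have "C - D \<subseteq> ?Z" using CD unfolding enlarged_def by blast
        moreover have "C \<union> D = verts G" by (rule fsepD(4)[OF N_fsep[OF CD(1)]])
        ultimately show ?thesis unfolding A_def B_def using e(1) CD(4,5) by blast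
      next
        case no: False
        have "C \<subseteq> F \<and> E \<subseteq> D" if CD: "(C, D) \<in> N" "b \<subseteq> D" "(C - D) \<inter> K \<noteq> {}" for C D
        proof -
          have "\<not> (C \<subseteq> E \<and> F \<subseteq> D)" using CD(3) True by blast
          moreover have "\<not> (D \<subseteq> E \<and> F \<subseteq> C)"
            using inseparable_fsep(1)[OF b N_fsep[OF CD(1)]] CD(2) EF(2) by blast
          moreover have "\<not> (E \<subseteq> C \<and> D \<subseteq> F)" using no CD by blast
          ultimately show ?thesis using nested[OF CD(1) EF(1)] unfolding nested_iff by argo
        qed
        then have "?Z \<subseteq> F" "?Z \<inter> E = {}"
          unfolding enlarged_def using KE compD(1)[OF c] EF'(4) by blast+
        moreover have "nbhd G K \<subseteq> F" using e(5) EF(2) by blast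
        ultimately show ?thesis unfolding A_def B_def using EF'(5) by blast
      qed
    qed
  qed
qed

text \<open>A side added to one component misses the other one altogether, since it does not split
  it and must not cover it. Sides added to different components are therefore incomparable, and
  being nested with \<open>b\<close> behind both, they are disjoint.\<close>

lemma enlarged_disjoint:
  assumes K: "uncovered G N b K" "uncovered G N b K'" "K \<noteq> K'" and b: "inseparable k G b"
  shows "enlarged N b K \<inter> enlarged N b K' = {}"
proof -
  have c: "is_comp G b K" "is_comp G b K'" using K by (simp_all add: uncovered_def)
  have KK: "K \<inter> K' = {}" using comp_eq[OF c] K(3) by blast
  have far: "K \<inter> C = {}" if "(C, D) \<in> N" "b \<subseteq> D" "(C - D) \<inter> K' \<noteq> {}" "uncovered G N b K"
    "uncovered G N b K'" "K \<noteq> K'" for C D K K'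
  proof -
    have "is_comp G b K" using that(4) by (simp add: uncovered_def)
    then have "K \<subseteq> C - D \<or> K \<inter> C = {}" using N_meets_uncovered(2)[OF that(5,1-3)] that(6) by blast
    then show ?thesis using that(1,2,4) unfolding uncovered_def by blast
  qed
  have 3: "(C - D) \<inter> (C' - D') = {}"
    if 1: "(C, D) \<in> N" "b \<subseteq> D" "(C - D) \<inter> K \<noteq> {}"
      and 2: "(C', D') \<in> N" "b \<subseteq> D'" "(C' - D') \<inter> K' \<noteq> {}"
    for C D C' D'
  proof -
    have "K \<inter> C' = {}" using far[OF 2 K] .
    moreover have "K' \<inter> C = {}" using far[OF 1 K(2,1)] K(3) by blast
    moreover have "\<not> (D \<subseteq> C' \<and> D' \<subseteq> C)"
      using inseparable_fsep(1)[OF b N_fsep[OF 2(1)]] 1(2) 2(2) by blast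
    ultimately show ?thesis using nested[OF 1(1) 2(1)] 1(3) 2(3) unfolding nested_iff by blast
  qed
  have 4: "K \<inter> (C - D) = {}" if "(C, D) \<in> N" "b \<subseteq> D" "(C - D) \<inter> K' \<noteq> {}" for C D
    using far[OF that K] by blast
  have 5: "K' \<inter> (C - D) = {}" if "(C, D) \<in> N" "b \<subseteq> D" "(C - D) \<inter> K \<noteq> {}" for C D
    using far[OF that K(2,1)] K(3) by blast
  show ?thesis
  proof (rule ccontr)
    assume "\<not> ?thesis"
    then obtain x where "x \<in> enlarged N b K" "x \<in> enlarged N b K'" by blast
    then consider "x \<in> K" "x \<in> K'"
      | C D where "x \<in> K" "(C, D) \<in> N" "b \<subseteq> D" "(C - D) \<inter> K' \<noteq> {}" "x \<in> C - D"
      | C D where "x \<in> K'" "(C, D) \<in> N" "b \<subseteq> D" "(C - D) \<inter> K \<noteq> {}" "x \<in> C - D"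
      | C D C' D' where "(C, D) \<in> N" "b \<subseteq> D" "(C - D) \<inter> K \<noteq> {}" "x \<in> C - D"
          "(C', D') \<in> N" "b \<subseteq> D'" "(C' - D') \<inter> K' \<noteq> {}" "x \<in> C' - D'"
      unfolding in_enlarged by metis
    then show False
    proof cases
      case 4
      then show ?thesis using 3[of C D C' D'] by blast
    qed (use KK 4 5 in blast)+
  qed
qed

end

section \<open>The complete nested set\<close>

definition block_seps :: "nat \<Rightarrow> 'a ugraph \<Rightarrow> 'a osep set \<Rightarrow> 'a osep set" where
  "block_seps k G N = {(enlarged N b K \<union> nbhd G K, verts G - enlarged N b K) |b K.
     is_block k G b \<and> uncovered G N b K \<and> finite (nbhd G K) \<and> card (nbhd G K) < k}"

definition tree_set :: "nat \<Rightarrow> 'a ugraph \<Rightarrow> 'a osep set" where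
  "tree_set k G = (let N = levels k G k in N \<union> block_seps k G N \<union> prod.swap ` block_seps k G N)"

lemma nested_tight_levels:
  assumes G: "G \<in> graph_class"
  shows "nested_tight G k (levels k G k)"
proof
  show "levels k G k \<subseteq> tight_seps k G"
    using levels_eff[of k G k] eff_seps_tight[OF G, of k] by blast
qed (use G levels_nested in auto)

lemma separable_blockD:
  assumes "simple_graph G" "separable_block k G b"
  shows "is_block k G b" "inseparable k G b"
  using assms blockD by (auto simp: separable_block_def)

lemma block_seps_levels:
  assumes G: "G \<in> graph_class" and r: "r \<in> block_seps k G (levels k G k)" and t: "t \<in> levels k G k"
  shows "nested r t"
proof -
  let ?N = "levels k G k"
  interpret nested_tight G k ?N by (rule nested_tight_levels[OF G])
  obtain b K where b: "is_block k G b" "uncovered G ?N b K"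
    "r = (enlarged ?N b K \<union> nbhd G K, verts G - enlarged ?N b K)"
    using r by (auto simp: block_seps_def)
  note i = blockD(1)[OF simple b(1)]
  have "nested r (E, F)" if "(E, F) \<in> ?N" "b \<subseteq> F" for E F
    using enlarged_vs_N[OF b(2) i that] unfolding b(3) nested_iff by argo
  note * = this
  obtain C D where CD: "t = (C, D)" by (cases t)
  then have DC: "(D, C) \<in> ?N" using t levels_swap by fastforce
  show ?thesis
  proof (cases "b \<subseteq> D")
    case True
    then show ?thesis using * t CD by blast
  next
    case False
    then have "b \<subseteq> C" using inseparable_fsep(1)[OF i N_fsep[of C D]] t CD by blast
    then show ?thesis using *[OF DC] nested_commute(2)[of r C D] CD by blast
  qed
qed

text \<open>For one block, the enlarged sets of two components are disjoint. For two blocks, their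
  profiles are distinguished by some \<open>(C, D)\<close> among the earlier choices; each block
  separation is nested with it in a way controlled by the side on which its block lies.\<close>

lemma block_seps_nested:
  assumes G: "G \<in> graph_class"
    and r: "r \<in> block_seps k G (levels k G k)" "s \<in> block_seps k G (levels k G k)"
  shows "nested r s"
proof -
  let ?N = "levels k G k"
  interpret nested_tight G k ?N by (rule nested_tight_levels[OF G])
  let ?A = "\<lambda>b K. enlarged ?N b K \<union> nbhd G K" and ?B = "\<lambda>b K. verts G - enlarged ?N b K"
  obtain b K where b: "is_block k G b" "uncovered G ?N b K" "r = (?A b K, ?B b K)"
    using r(1) by (auto simp: block_seps_def)
  obtain b' K' where b': "is_block k G b'" "uncovered G ?N b' K'" "s = (?A b' K', ?B b' K')"
    using r(2) by (auto simp: block_seps_def)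
  note i = blockD(1)[OF simple b(1)] and i' = blockD(1)[OF simple b'(1)]
  show ?thesis
  proof (cases "b = b'")
    case True
    show ?thesis
    proof (cases "K = K'")
      case False
      have d: "enlarged ?N b K \<inter> enlarged ?N b K' = {}"
        using enlarged_disjoint[OF b(2) _ False i] b'(2) True by blast
      have "?A b K \<subseteq> ?B b K'" "?A b K' \<subseteq> ?B b K"
        using d enlarged_basic[OF b(2)] enlarged_basic[OF b'(2)] True by blast+
      then show ?thesis unfolding b(3) b'(3) True nested_iff by blast
    next
      case same: True
      show ?thesis unfolding b(3) b'(3) True same nested_iff by blast
    qed
  next
    case False
    let ?P = "block_profile k G b" and ?P' = "block_profile k G b'"
    have P: "profile k G ?P" "profile k G ?P'" "?P \<noteq> ?P'"
      using block_profile_is_profile i i' block_profile_inj[OF simple b(1) b'(1)] False by blast+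
    obtain C D where CD: "(C, D) \<in> ?N" "distinguishes G C D ?P ?P'"
      using levels_distinguish[OF G P] unfolding efficiently_distinguishes_def by metis
    have "(D, C) \<in> ?N" using CD(1) levels_swap by fastforce
    then obtain C D where CD: "(C, D) \<in> ?N" "(D, C) \<in> ?N" "b \<subseteq> C" "b' \<subseteq> D"
      using CD distinguishes_iff[OF P(1,2), of C D] by (auto simp: block_profile_def)
    show ?thesis unfolding b(3) b'(3)
      by (rule nested_via[OF enlarged_vs_N[OF b(2) i CD(2,3)] enlarged_vs_N[OF b'(2) i' CD(1,4)]])
  qed
qed

lemma block_sepsE:
  assumes G: "G \<in> graph_class" and r: "(A, B) \<in> block_seps k G (levels k G k)"
  obtains b where "inseparable k G b" "b \<subseteq> B" "(A, B) \<in> tight_seps k G" "B \<noteq> verts G"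
proof -
  let ?N = "levels k G k"
  interpret nested_tight G k ?N by (rule nested_tight_levels[OF G])
  obtain b K where b: "is_block k G b" "uncovered G ?N b K"
    "A = enlarged ?N b K \<union> nbhd G K" "B = verts G - enlarged ?N b K"
    and small: "finite (nbhd G K)" "card (nbhd G K) < k"
    using r by (auto simp: block_seps_def)
  note i = blockD(1)[OF simple b(1)] and e = enlarged_basic[OF b(2)]
  have c: "is_comp G b K" using b(2) by (simp add: uncovered_def)
  have "(A, B) \<in> tight_seps k G"
    unfolding b(3,4) using enlarged_tight[OF b(2) i small] .
  moreover have "b \<subseteq> B" using i e(3) unfolding b(4) inseparable_def by blast
  moreover have "B \<noteq> verts G" using e(1,2) compD(3)[OF c] b(4) by blast
  ultimately show thesis using that i by blast
qed

lemma tree_set_cases: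
  assumes "r \<in> tree_set k G"
  obtains "r \<in> levels k G k" | "r \<in> block_seps k G (levels k G k)"
    | "prod.swap r \<in> block_seps k G (levels k G k)"
  using assms by (auto simp: tree_set_def Let_def)

lemma tree_set_nested:
  assumes G: "G \<in> graph_class" and r: "r \<in> tree_set k G" "s \<in> tree_set k G"
  shows "nested r s"
proof -
  let ?N = "levels k G k"
  have *: "nested r s" if "r \<in> ?N \<union> block_seps k G ?N" "s \<in> ?N \<union> block_seps k G ?N" for r s
    using that levels_nested[OF G] block_seps_nested[OF G] block_seps_levels[OF G] nested_sym
    by blast
  have "r \<in> ?N \<union> block_seps k G ?N \<or> prod.swap r \<in> ?N \<union> block_seps k G ?N" if "r \<in> tree_set k G"
    for r
    using that by (rule tree_set_cases) auto
  then show ?thesis using *[of r s] *[of "prod.swap r" s] *[of r "prod.swap s"]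
    *[of "prod.swap r" "prod.swap s"] r nested_swap by metis
qed

lemma tree_set_swap: "(A, B) \<in> tree_set k G \<Longrightarrow> (B, A) \<in> tree_set k G"
  using levels_swap[of "(A, B)" k G k] by (force simp: tree_set_def Let_def)

lemma tree_set_tight:
  assumes G: "G \<in> graph_class"
  shows "tree_set k G \<subseteq> tight_seps k G"
proof clarify
  fix A B assume "(A, B) \<in> tree_set k G"
  moreover have swap: "(B, A) \<in> tight_seps k G" if "(A, B) \<in> tight_seps k G" for A B
    using that sep_commute[of G A B] by (auto simp: tight_seps_def Int_commute)
  moreover have blocks: "(A, B) \<in> tight_seps k G" if r: "(A, B) \<in> block_seps k G (levels k G k)"
    for A B
    by (rule block_sepsE[OF G r]) blast
  ultimately show "(A, B) \<in> tight_seps k G"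
    using nested_tight.tight[OF nested_tight_levels[OF G], of k]
    by (auto elim!: tree_set_cases)
qed

lemma tree_set_proper:
  assumes G: "G \<in> graph_class" and r: "(A, B) \<in> tree_set k G"
  shows "A \<noteq> B"
proof -
  have "A \<noteq> B" if r: "(A, B) \<in> block_seps k G (levels k G k)" for A B
  proof -
    obtain b where "inseparable k G b" "(A, B) \<in> tight_seps k G" by (rule block_sepsE[OF G r]) blast
    then show ?thesis using inseparable_fsep(2)[of k G b A B]
      by (auto simp: tight_seps_def fsep_def)
  qed
  moreover have "A \<noteq> B" if "(A, B) \<in> levels k G k"
    using that levels_eff[of k G k] eff_sepsD(4) by blast
  ultimately show ?thesis using r by (elim tree_set_cases) auto
qed

text \<open>Irregular profiles may put separations \<open>{V, X}\<close> into the tree set, for which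
  \<open>(X, V) \<le> (V, X)\<close>.\<close>

lemma tree_set_regular:
  assumes G: "G \<in> graph_class" and r: "(A, B) \<in> tree_set k G" "(C, D) \<in> tree_set k G"
    and le: "C \<subseteq> A" "B \<subseteq> D" "D \<subseteq> A" "B \<subseteq> C"
  shows "(C, D) = (A, B) \<or> (C, D) = (B, A)"
proof -
  have f: "fsep k G A B" "fsep k G C D"
    using r tree_set_tight[OF G, of k] by (auto simp: tight_seps_def fsep_def)
  \<comment> \<open>Both orientations of \<open>{C, D}\<close> lie below \<open>(A, B)\<close>, so
    \<open>A\<close> contains \<open>C \<union> D\<close>. Neither orientation of a block separation
    has this form, which leaves the separations that come from profiles.\<close>
  have A: "A = verts G" using le fsepD(4,5)[OF f(1)] fsepD(4)[OF f(2)] by blast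
  have "(A, B) \<notin> block_seps k G (levels k G k)"
  proof
    assume "(A, B) \<in> block_seps k G (levels k G k)"
    then obtain b where "inseparable k G b" "b \<subseteq> B" using block_sepsE[OF G] by metis
    then show False using inseparable_fsep(1)[OF _ f(1)] A fsepD(6)[OF f(1)] by blast
  qed
  moreover have "(B, A) \<notin> block_seps k G (levels k G k)"
    using block_sepsE[OF G, of B A k] A by metis
  ultimately have "(A, B) \<in> levels k G k" using r(1) by (auto elim: tree_set_cases)
  then obtain n where "(A, B) \<in> eff_seps k G n" using levels_eff by blast
  then obtain Q where Q: "profile k G Q" "(A, B) \<in> Q" by (rule eff_sepsE)
  then show ?thesis using irregular_profile[OF Q(1) _ f(2), of B] A le by blast
qed

lemma tree_set_distinguish:
  assumes G: "G \<in> graph_class"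
    and P: "profile k G P" "profile k G Q" "P \<noteq> Q"
  obtains A B where "(A, B) \<in> tree_set k G" "eff_dist G A B P Q"
  using levels_distinguish[OF assms] by (metis UnI1 tree_set_def)

text \<open>The component of \<open>x\<close> in \<open>G - b\<close> is either covered by an
  earlier choice, or uncovered; by \<open>separable_block_comp\<close> it then satisfies the size
  condition in \<open>block_seps\<close>.\<close>

lemma tree_set_block:
  assumes G: "G \<in> graph_class" and b: "separable_block k G b" and x: "x \<in> verts G - b"
  obtains C D where "(C, D) \<in> tree_set k G" "b \<subseteq> D" "x \<in> C - D"
proof -
  let ?N = "levels k G k"
  interpret nested_tight G k ?N by (rule nested_tight_levels[OF G])
  obtain K where K: "is_comp G b K" "x \<in> K" using comp_exists[OF simple x] by blast
  show thesis
  proof (cases "uncovered G ?N b K")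
    case True
    let ?Z = "enlarged ?N b K"
    have "(?Z \<union> nbhd G K, verts G - ?Z) \<in> tree_set k G"
      using True separable_blockD(1)[OF simple b] separable_block_comp[OF b K(1)]
      by (auto simp: tree_set_def Let_def block_seps_def)
    moreover have "b \<subseteq> verts G - ?Z"
      using enlarged_basic(3)[OF True] separable_blockD(2)[OF simple b] unfolding inseparable_def
        by blast
    moreover have "x \<in> (?Z \<union> nbhd G K) - (verts G - ?Z)" using K enlarged_basic(1)[OF True] by blast
    ultimately show ?thesis by (rule that)
  next
    case False
    then obtain C D where "(C, D) \<in> ?N" "b \<subseteq> D" "K \<subseteq> C - D" using K by (auto simp: uncovered_def)
    moreover have "?N \<subseteq> tree_set k G" by (auto simp: tree_set_def Let_def)
    ultimately show ?thesis using that K(2) by blast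
  qed
qed

section \<open>The tree of a nested set of separations\<close>

text \<open>The orientation of \<open>N\<close> that has \<open>s\<close> as a maximal element. The inverse of \<open>s\<close> has to be excluded
  explicitly since it may lie below \<open>s\<close>, namely if \<open>s = (V, X)\<close>.\<close>

definition node_of :: "'a osep set \<Rightarrow> 'a osep \<Rightarrow> 'a node" where
  "node_of N s = {r \<in> N. r \<noteq> prod.swap s \<and> (osep_le r s \<or> osep_le r (prod.swap s))}"

text \<open>Without separations there is no \<open>s\<close> to start from; the tree is then the
  single node \<open>{}\<close>, whose bag is the whole vertex set.\<close>

definition nodes :: "'a osep set \<Rightarrow> 'a node set" where
  "nodes N = (if N = {} then {{}} else node_of N ` N)"

definition sep_tree :: "'a osep set \<Rightarrow> 'a node ugraph" where
  "sep_tree N = \<lparr>verts = nodes N, edges = {{node_of N s, node_of N (prod.swap s)} |s. s \<in> N}\<rparr>"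

definition bag :: "'a ugraph \<Rightarrow> 'a node \<Rightarrow> 'a set" where
  "bag G n = verts G \<inter> (\<Inter>(A, B)\<in>n. B)"

lemma osep_le_refl: "osep_le r r"
  and osep_le_trans: "osep_le r s \<Longrightarrow> osep_le s t \<Longrightarrow> osep_le r t"
  and osep_le_antisym: "osep_le r s \<Longrightarrow> osep_le s r \<Longrightarrow> r = s"
  by (auto simp: osep_le_def prod_eq_iff)

lemma osep_le_swap:
  "osep_le (prod.swap r) (prod.swap s) \<longleftrightarrow> osep_le s r"
  "osep_le (prod.swap r) s \<longleftrightarrow> osep_le (prod.swap s) r"
  "osep_le r (prod.swap s) \<longleftrightarrow> osep_le s (prod.swap r)"
  by (auto simp: osep_le_def)

lemma finite_has_osep_maximal:
  assumes "finite X" "X \<noteq> {}"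
  obtains r where "r \<in> X" "\<And>q. q \<in> X \<Longrightarrow> osep_le r q \<Longrightarrow> q = r"
proof -
  have "\<exists>r\<in>X. \<forall>q\<in>X. q \<noteq> r \<longrightarrow> \<not> osep_less r q"
    by (rule Finite_Set.bex_max_element[OF assms(1) _ _ assms(2)])
      (auto simp: transp_on_def asymp_on_def osep_less_def dest: osep_le_antisym osep_le_trans)
  then show thesis using that unfolding osep_less_def by metis
qed

text \<open>\<open>regular\<close> is what irregular profiles leave of the rule that nothing lies
  above both orientations of a separation: \<open>(V, X)\<close> lies above its own inverse.
  \<open>finite_between\<close> makes intervals finite, but speaks about vertices;
  \<open>finite_or_nonempty\<close> supplies a vertex on each side.\<close>

locale nested_set =
  fixes G :: "'a ugraph" and N :: "'a osep set"
  assumes sep: "(A, B) \<in> N \<Longrightarrow> is_separation G A B"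
    and swap: "s \<in> N \<Longrightarrow> prod.swap s \<in> N"
    and nested: "r \<in> N \<Longrightarrow> s \<in> N \<Longrightarrow> nested r s"
    and proper: "s \<in> N \<Longrightarrow> prod.swap s \<noteq> s"
    and regular: "r \<in> N \<Longrightarrow> s \<in> N \<Longrightarrow> osep_le r s \<Longrightarrow> osep_le (prod.swap r) s \<Longrightarrow> r = s \<or> r = prod.swap s"
    and finite_between: "v \<in> verts G \<Longrightarrow> x \<in> verts G \<Longrightarrow> finite {(A, B) \<in> N. v \<in> A \<and> x \<in> B}"
    and finite_or_nonempty: "finite N \<or> (\<forall>(A, B)\<in>N. A \<noteq> {})"
begin

section \<open>Nodes as consistent orientations\<close>

abbreviation "node \<equiv> node_of N"

lemma node_subset: "node s \<subseteq> N"
  by (auto simp: node_of_def)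

lemma node_self:
  shows "s \<in> N \<Longrightarrow> s \<in> node s" and "prod.swap s \<notin> node s"
proof -
  assume s: "s \<in> N"
  then have "s \<noteq> prod.swap s" using proper[OF s] by metis
  then show "s \<in> node s" using s by (simp add: node_of_def osep_le_refl)
qed (simp add: node_of_def)

lemma node_total:
  assumes "s \<in> N" "r \<in> N"
  shows "r \<in> node s \<or> prod.swap r \<in> node s"
proof (cases "r = s \<or> prod.swap r = s")
  case True
  then show ?thesis using node_self(1)[OF assms(1)] by auto
next
  case False
  then have "r \<noteq> prod.swap s" "prod.swap r \<noteq> prod.swap s" by (metis swap_swap)+
  then show ?thesis
    using nested[OF assms(2,1)] assms swap by (auto simp: node_of_def nested_def)
qed

text \<open>The two inequalities either give \<open>r = s\<close> or \<open>r = prod.swap s\<close>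
  by antisymmetry, or place both orientations of \<open>r\<close> below \<open>s\<close> or below
  its inverse, where \<open>regular\<close> applies.\<close>

lemma node_asym:
  assumes s: "s \<in> N" and r: "r \<in> node s"
  shows "prod.swap r \<notin> node s"
proof
  assume r': "prod.swap r \<in> node s"
  have rN: "r \<in> N" "prod.swap r \<in> N" "r \<noteq> prod.swap s" "r \<noteq> s"
    using r r' by (auto simp: node_of_def)
  have sN: "prod.swap s \<in> N" using swap[OF s] .
  have "osep_le r s \<or> osep_le r (prod.swap s)"
    "osep_le (prod.swap r) s \<or> osep_le (prod.swap r) (prod.swap s)"
    using r r' by (auto simp: node_of_def)
  then consider "osep_le r s" "osep_le (prod.swap r) s" | "osep_le r s" "osep_le s r"
    | "osep_le r (prod.swap s)" "osep_le (prod.swap s) r"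
    | "osep_le r (prod.swap s)" "osep_le (prod.swap r) (prod.swap s)"
    using osep_le_swap by blast
  then show False
  proof cases
    case 1
    then show ?thesis using regular[OF rN(1) s] rN by auto
  next
    case 4
    then show ?thesis using regular[OF rN(1) sN] rN by auto
  qed (use osep_le_antisym rN in blast)+
qed

text \<open>Transitivity fails to give membership only for \<open>r = prod.swap s\<close>. Then
  \<open>regular\<close> forces \<open>r' = s\<close>, or antisymmetry forces
  \<open>r' = prod.swap s\<close>, and both are excluded.\<close>

lemma node_down:
  assumes s: "s \<in> N" and r': "r' \<in> node s" and r: "r \<in> N" "osep_le r r'" "r \<noteq> prod.swap r'"
  shows "r \<in> node s"
proof (rule ccontr)
  assume ns: "r \<notin> node s"
  have r2: "r' \<noteq> prod.swap s" "osep_le r' s \<or> osep_le r' (prod.swap s)" "r' \<in> N"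
    using r' by (auto simp: node_of_def)
  have "osep_le r s \<or> osep_le r (prod.swap s)" using r(2) r2(2) osep_le_trans by blast
  then have rs: "r = prod.swap s" using ns r(1) unfolding node_of_def by blast
  from r2(2) show False
  proof
    assume "osep_le r' s"
    moreover have "osep_le (prod.swap r') s" using r(2) rs osep_le_swap(2)[of r' s] by simp
    ultimately have "r' = s" using regular[OF r2(3) s] r2(1) by blast
    then show False using rs r(3) by simp
  next
    assume "osep_le r' (prod.swap s)"
    then have "r' = prod.swap s" using r(2) rs osep_le_antisym by blast
    then show False using r2(1) by blast
  qed
qed

text \<open>\<open>node_of\<close> treats \<open>s\<close> and its inverse alike except for the one
  excluded element. So an edge of the tree flips exactly one separation.\<close>

lemma node_swap_iff:
  assumes s: "s \<in> N"
  shows "r \<in> node (prod.swap s) \<longleftrightarrow> r = prod.swap s \<or> r \<in> node s \<and> r \<noteq> s"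
proof (cases "r = prod.swap s")
  case True
  then show ?thesis using node_self(1)[OF swap[OF s]] by simp
next
  case False
  then show ?thesis unfolding node_of_def by auto
qed

lemma node_swap: "s \<in> N \<Longrightarrow> node (prod.swap s) = insert (prod.swap s) (node s - {s})"
  using node_swap_iff by blast

lemma node_eqI:
  assumes "s \<in> N" "t \<in> N" "node s \<subseteq> node t"
  shows "node s = node t"
proof (intro equalityI subsetI)
  fix r assume r: "r \<in> node t"
  then have "r \<in> N" using node_subset by blast
  then show "r \<in> node s" using node_total[OF assms(1)] node_asym[OF assms(2) r] assms(3) by blast
qed (use assms in blast)

text \<open>Any maximal element determines its node: another \<open>q\<close> in it is nested with
  \<open>r\<close>, cannot lie above \<open>r\<close> by maximality, nor above the inverse of
  \<open>r\<close> by consistency. Hence any maximal element of a node can be flipped to reach an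
  adjacent node.\<close>

lemma node_of_maximal:
  assumes s: "s \<in> N" and r: "r \<in> node s" and max: "\<And>q. q \<in> node s \<Longrightarrow> osep_le r q \<Longrightarrow> q = r"
  shows "node r = node s"
proof -
  have rN: "r \<in> N" using r node_subset by blast
  have "q \<in> node r" if q: "q \<in> node s" for q
  proof -
    have qN: "q \<in> N" using q node_subset by blast
    have ne: "q \<noteq> prod.swap r" using node_asym[OF s r] q by blast
    have "osep_le q r \<or> osep_le q (prod.swap r) \<or> osep_le (prod.swap r) q \<or> osep_le r q"
      using nested[OF qN rN] osep_le_swap(1)[of q r] osep_le_swap(2)[of q r] unfolding nested_def
        by argo
    moreover have "q \<noteq> r \<Longrightarrow> prod.swap r \<noteq> prod.swap q" by (metis swap_swap)
    ultimately consider "q = r" | "osep_le q r" | "osep_le q (prod.swap r)"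
      | "osep_le (prod.swap r) q" "prod.swap r \<noteq> prod.swap q" | "osep_le r q" by blast
    then show ?thesis
    proof cases
      case 4
      then have "prod.swap r \<in> node s" using node_down[OF s q swap[OF rN]] by simp
      then show ?thesis using node_asym[OF s r] by blast
    next
      case 5
      then show ?thesis using max[OF q] node_self(1)[OF rN] by simp
    qed (use qN ne node_self(1)[OF rN] in \<open>auto simp: node_of_def\<close>)
  qed
  then show ?thesis using node_eqI[OF s rN] by blast
qed

lemma finite_interval:
  assumes "p \<in> N" "q \<in> N"
  shows "finite {r \<in> N. osep_le p r \<and> osep_le r q}"
proof (cases "finite N")
  case False
  obtain A B C D where pq: "p = (A, B)" "q = (C, D)" by (cases p, cases q)
  have "(D, C) \<in> N" using swap[OF assms(2)] pq by simp
  then have "A \<noteq> {}" "D \<noteq> {}" using False finite_or_nonempty assms pq by blast+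
  then obtain v x where vx: "v \<in> A" "x \<in> D" by blast
  have "v \<in> verts G" "x \<in> verts G" using vx sep assms pq by (auto simp: is_separation_def)
  then have "finite {(A, B) \<in> N. v \<in> A \<and> x \<in> B}" by (rule finite_between)
  then show ?thesis by (rule rev_finite_subset) (use vx pq in \<open>auto simp: osep_le_def\<close>)
qed simp

text \<open>If \<open>r\<close> is in the first node and its inverse in the second, then
  \<open>r\<close> lies below \<open>s\<close> or its inverse and above \<open>t\<close> or its
  inverse, so in one of four intervals.\<close>

lemma finite_difference:
  assumes s: "s \<in> N" and t: "t \<in> N"
  shows "finite (node s - node t)"
proof -
  let ?I = "\<lambda>p q. {r \<in> N. osep_le p r \<and> osep_le r q}"
  have "node s - node t \<subseteq> (\<Union>p\<in>{t, prod.swap t}. \<Union>q\<in>{s, prod.swap s}. ?I p q)"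
  proof
    fix r assume r: "r \<in> node s - node t"
    then have rN: "r \<in> N" using node_subset by blast
    then have "prod.swap r \<in> node t" using r node_total[OF t] by blast
    then have "osep_le (prod.swap r) t \<or> osep_le (prod.swap r) (prod.swap t)"
      by (simp add: node_of_def)
    then have "osep_le (prod.swap t) r \<or> osep_le t r" using osep_le_swap by blast
    moreover have "osep_le r s \<or> osep_le r (prod.swap s)" using r by (simp add: node_of_def)
    ultimately show "r \<in> (\<Union>p\<in>{t, prod.swap t}. \<Union>q\<in>{s, prod.swap s}. ?I p q)" using rN by blast
  qed
  moreover have "finite (\<Union>p\<in>{t, prod.swap t}. \<Union>q\<in>{s, prod.swap s}. ?I p q)"
    using finite_interval swap s t by blast
  ultimately show ?thesis by (rule finite_subset)
qed

lemma bag_iff: "W \<subseteq> bag G n \<longleftrightarrow> W \<subseteq> verts G \<and> (\<forall>A B. (A, B) \<in> n \<longrightarrow> W \<subseteq> B)"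
  by (auto simp: bag_def)

text \<open>Such \<open>(A, B)\<close> has \<open>W\<close> in \<open>A\<close>, and
  \<open>B\<close> contains a side of \<open>s\<close>. Fixing a vertex of \<open>W\<close> and one
  on each side of \<open>s\<close> brings \<open>finite_between\<close> to bear.\<close>

lemma finite_bad:
  assumes s: "s \<in> N" and W: "W \<subseteq> verts G" "\<And>A B. (A, B) \<in> N \<Longrightarrow> W \<subseteq> A \<or> W \<subseteq> B"
  shows "finite {(A, B) \<in> node s. \<not> W \<subseteq> B}"
proof (cases "finite N \<or> W = {}")
  case True
  then show ?thesis
  proof
    assume "finite N"
    then show ?thesis by (rule rev_finite_subset) (use node_subset[of s] in auto)
  qed simp
next
  case False
  obtain C D where s': "s = (C, D)" by (cases s)
  have "(D, C) \<in> N" using swap[OF s] s' by simp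
  then have "C \<noteq> {}" "D \<noteq> {}" using False finite_or_nonempty s s' by blast+
  then obtain c d w where cdw: "c \<in> C" "d \<in> D" "w \<in> W" using False by blast
  have V: "c \<in> verts G" "d \<in> verts G" "w \<in> verts G" using cdw W(1) sep s s'
    by (auto simp: is_separation_def)
  have "{(A, B) \<in> node s. \<not> W \<subseteq> B} \<subseteq> {(A, B) \<in> N. w \<in> A \<and> c \<in> B} \<union> {(A, B) \<in> N. w \<in> A \<and> d \<in> B}"
    using W(2) cdw s' by (fastforce simp: node_of_def osep_le_def)
  then show ?thesis using finite_between[OF V(3,1)] finite_between[OF V(3,2)]
    by (meson finite_UnI finite_subset)
qed

section \<open>Walks between nodes\<close>

lemma node_in_nodes: "s \<in> N \<Longrightarrow> node s \<in> nodes N"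
  by (auto simp: nodes_def)

lemma node_edge: "s \<in> N \<Longrightarrow> {node s, node (prod.swap s)} \<in> edges (sep_tree N)"
  unfolding sep_tree_def ugraph.simps by blast

text \<open>One notion for three connectedness claims: the whole tree for \<open>R\<close> and
  \<open>W\<close> empty, the nodes whose bags contain \<open>v\<close> for \<open>W = {v}\<close>,
  and one side of an edge for \<open>R = {(A, B)}\<close>.\<close>

abbreviation region :: "'a osep set \<Rightarrow> 'a set \<Rightarrow> 'a node ugraph" where
  "region R W \<equiv> induced (sep_tree N) {n \<in> nodes N. R \<subseteq> n \<and> W \<subseteq> bag G n}"

text \<open>The walk flips, one at a time, separations that are maximal among those on which the two nodes
  still differ.\<close>

lemma walk:
  assumes "s \<in> N" and t: "t \<in> N" and "R \<subseteq> node s" "R \<subseteq> node t" "W \<subseteq> bag G (node s)"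
    "W \<subseteq> bag G (node t)"
  shows "reachable (region R W) (node s) (node t)"
  using assms
proof (induction "card (node s - node t)" arbitrary: s)
  case 0
  have "node s - node t = {}" using 0 finite_difference by simp
  then have "node s = node t" using node_eqI 0 by blast
  then show ?case using node_in_nodes 0 by (simp add: reachable_def induced_def sep_tree_def)
next
  case (Suc m)
  let ?H = "region R W"
  have fin: "finite (node s - node t)" using finite_difference Suc by blast
  moreover have "node s - node t \<noteq> {}" using Suc(2) by force
  ultimately obtain r where r: "r \<in> node s - node t" "\<And>q. q \<in> node s - node t \<Longrightarrow> osep_le r q \<Longrightarrow> q = r"
    using finite_has_osep_maximal by metis
  have rN: "r \<in> N" using r(1) node_subset by blast
  have "node r = node s"
  proof (rule node_of_maximal[OF Suc.prems(1)])
    show "r \<in> node s" using r by blast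
    fix q assume q: "q \<in> node s" "osep_le r q"
    have "r \<noteq> prod.swap q" using node_asym[OF Suc.prems(1) q(1)] r(1) by blast
    then have "q \<notin> node t" using node_down[OF t _ rN q(2)] r(1) by blast
    then show "q = r" using r(2) q by blast
  qed
  then have flip: "node (prod.swap r) = insert (prod.swap r) (node s - {r})"
    using node_swap[OF rN] by simp
  have rt: "prod.swap r \<in> node t" using node_total[OF t rN] r(1) by blast
  have "node (prod.swap r) - node t = (node s - node t) - {r}" using flip rt by auto
  then have card: "m = card (node (prod.swap r) - node t)" using fin r(1) Suc(2) by simp
  have R: "R \<subseteq> node (prod.swap r)" using flip Suc.prems(3,4) r(1) by blast
  have W: "W \<subseteq> bag G (node (prod.swap r))"
    using Suc.prems(5,6) rt unfolding bag_iff flip by (metis Diff_iff insert_iff)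
  have IH: "reachable ?H (node (prod.swap r)) (node t)"
    by (rule Suc.hyps(1)[OF card swap[OF rN] t R Suc.prems(4) W Suc.prems(6)])
  have "{node s, node (prod.swap r)} \<in> edges ?H"
    using node_edge[OF rN] \<open>node r = node s\<close> node_in_nodes Suc.prems swap[OF rN] R W
    by (simp add: induced_def)
  moreover have "node s \<in> verts ?H" using node_in_nodes Suc.prems
    by (simp add: induced_def sep_tree_def)
  ultimately show ?case
    using IH unfolding reachable_def by (auto intro: converse_rtrancl_into_rtrancl)
qed

text \<open>Starting from \<open>node s\<close>, separations pointing away from \<open>W\<close> are
  flipped one by one, a maximal one first. Those already pointing towards \<open>W\<close> are never
  touched; \<open>edge_side_eq\<close> relies on this to stay on one side of an edge.\<close>

lemma node_containing:
  assumes "s \<in> N" and W: "W \<subseteq> verts G" "\<And>A B. (A, B) \<in> N \<Longrightarrow> W \<subseteq> A \<or> W \<subseteq> B"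
  shows "\<exists>t\<in>N. W \<subseteq> bag G (node t) \<and> (\<forall>A B. (A, B) \<in> node s \<and> W \<subseteq> B \<longrightarrow> (A, B) \<in> node t)"
  using assms(1)
proof (induction "card {(A, B) \<in> node s. \<not> W \<subseteq> B}" arbitrary: s)
  case 0
  then have "{(A, B) \<in> node s. \<not> W \<subseteq> B} = {}" using finite_bad[OF 0(2) W] by simp
  then have "W \<subseteq> bag G (node s)" using W(1) unfolding bag_iff by blast
  then show ?case using 0(2) by blast
next
  case (Suc m)
  let ?bad = "\<lambda>s. {(A, B) \<in> node s. \<not> W \<subseteq> B}"
  have fin: "finite (?bad s)" by (rule finite_bad[OF Suc.prems W])
  moreover have "?bad s \<noteq> {}" using Suc(2) by force
  ultimately obtain r where r: "r \<in> ?bad s" "\<And>q. q \<in> ?bad s \<Longrightarrow> osep_le r q \<Longrightarrow> q = r"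
    by (rule finite_has_osep_maximal) blast
  obtain A B where AB: "r = (A, B)" by (cases r)
  have r': "r \<in> node s" "\<not> W \<subseteq> B" using r(1) AB by auto
  have rN: "r \<in> N" using r' node_subset by blast
  have "node r = node s"
  proof (rule node_of_maximal[OF Suc.prems r'(1)])
    fix q assume q: "q \<in> node s" "osep_le r q"
    obtain C D where CD: "q = (C, D)" by (cases q)
    then have "D \<subseteq> B" using q(2) AB by (simp add: osep_le_def)
    then have "q \<in> ?bad s" using r'(2) q(1) CD by blast
    then show "q = r" using r(2) q by blast
  qed
  then have flip: "node (B, A) = insert (B, A) (node s - {(A, B)})"
    using node_swap[OF rN] AB by simp
  have BA: "(B, A) \<in> N" using swap[OF rN] AB by simp
  have "W \<subseteq> A" using W(2) rN AB r'(2) by blast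
  then have "?bad (B, A) = ?bad s - {r}" unfolding flip AB by auto
  then have "m = card (?bad (B, A))" using fin r(1) Suc(2) by simp
  then obtain t where t: "t \<in> N" "W \<subseteq> bag G (node t)"
    "\<forall>C D. (C, D) \<in> node (B, A) \<and> W \<subseteq> D \<longrightarrow> (C, D) \<in> node t"
    using Suc.hyps(1)[OF _ BA] by blast
  then have "\<forall>A B. (A, B) \<in> node s \<and> W \<subseteq> B \<longrightarrow> (A, B) \<in> node t"
    unfolding flip using r'(2) by blast
  then show ?case using t by blast
qed

lemma vertex_side: "v \<in> verts G \<Longrightarrow> (A, B) \<in> N \<Longrightarrow> {v} \<subseteq> A \<or> {v} \<subseteq> B"
  using sep[of A B] by (auto simp: is_separation_def)

lemma edge_side_of_sep: "simple_graph G \<Longrightarrow> e \<in> edges G \<Longrightarrow> (A, B) \<in> N \<Longrightarrow> e \<subseteq> A \<or> e \<subseteq> B"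
proof -
  assume s: "simple_graph G" "e \<in> edges G" "(A, B) \<in> N"
  then obtain u v where e: "e = {u, v}" unfolding simple_graph_def by (meson card_2_iff)
  have "u \<in> verts G" "v \<in> verts G" using s e by (auto simp: simple_graph_def)
  moreover have "{v, u} \<in> edges G" "{u, v} \<in> edges G" using s(2) e by (simp_all add: insert_commute)
  ultimately show ?thesis using sep[OF s(3)] e unfolding is_separation_def by blast
qed

lemma edge_flip:
  assumes "s \<in> N" "{n, m} \<in> edges (sep_tree N)" "{n, m} \<noteq> {node s, node (prod.swap s)}"
  shows "s \<in> n \<longleftrightarrow> s \<in> m"
proof -
  obtain q where q: "q \<in> N" "{n, m} = {node q, node (prod.swap q)}" using assms(2)
    by (auto simp: sep_tree_def)
  have "q \<noteq> s" using q(2) assms(3) by blast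
  moreover have "q \<noteq> prod.swap s"
  proof
    assume "q = prod.swap s"
    then have "{n, m} = {node (prod.swap s), node s}" using q(2) by simp
    then show False using assms(3) by (simp add: insert_commute)
  qed
  ultimately have "s \<in> node q \<longleftrightarrow> s \<in> node (prod.swap q)"
    using node_swap_iff[OF q(1), of s] by (metis swap_swap)
  then show ?thesis using q(2) by (auto simp: doubleton_eq_iff)
qed

section \<open>The tree and its decomposition\<close>

lemma sep_tree_simple: "simple_graph (sep_tree N)"
proof -
  have "node s \<noteq> node (prod.swap s)" if "s \<in> N" for s
    using node_self(1)[OF that] node_self(2)[of "prod.swap s"] by auto
  then show ?thesis using node_in_nodes swap by (auto simp: simple_graph_def sep_tree_def)
qed

text \<open>The first edge of a cycle flips some \<open>s\<close>, and only this edge of the tree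
  does. No later edge of the cycle coincides with it, as the vertices are distinct and at least
  three, so \<open>s\<close> could not return to its initial orientation.\<close>

lemma sep_tree_acyclic: "\<not> is_cycle (sep_tree N) xs"
proof
  assume c: "is_cycle (sep_tree N) xs"
  let ?n = "length xs"
  have n: "3 \<le> ?n" and d: "distinct xs"
    and e: "\<And>i. i < ?n \<Longrightarrow> {xs ! i, xs ! (Suc i mod ?n)} \<in> edges (sep_tree N)"
    using c by (auto simp: is_cycle_def)
  have n0: "0 < ?n" "1 < ?n" "2 < ?n" using n by linarith+
  have "{xs ! 0, xs ! 1} \<in> edges (sep_tree N)" using e[OF n0(1)] n0(2) by simp
  then obtain s where s: "s \<in> N" "{xs ! 0, xs ! 1} = {node s, node (prod.swap s)}"
    by (auto simp: sep_tree_def)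
  have "s \<in> node s" "s \<notin> node (prod.swap s)" using node_self(1)[OF s(1)] node_self(2)[of
    "prod.swap s"] by auto
  then have ne: "s \<in> xs ! 0 \<longleftrightarrow> s \<notin> xs ! 1" using s(2) by (auto simp: doubleton_eq_iff)
  have step: "s \<in> xs ! i \<longleftrightarrow> s \<in> xs ! (Suc i mod ?n)" if i: "0 < i" "i < ?n" for i
  proof (rule edge_flip[OF s(1) e[OF i(2)]])
    show "{xs ! i, xs ! (Suc i mod ?n)} \<noteq> {node s, node (prod.swap s)}"
    proof
      assume "{xs ! i, xs ! (Suc i mod ?n)} = {node s, node (prod.swap s)}"
      then have eq: "{xs ! i, xs ! (Suc i mod ?n)} = {xs ! 0, xs ! 1}" using s(2) by simp
      then have "xs ! i = xs ! 1" using nth_eq_iff_index_eq[OF d, of i 0] i n0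
        by (auto simp: doubleton_eq_iff)
      then have i1: "i = 1" using nth_eq_iff_index_eq[OF d, of i 1] i n0 by simp
      then have "xs ! 2 = xs ! 0" using eq n0 by (auto simp: doubleton_eq_iff numeral_2_eq_2)
      then show False using nth_eq_iff_index_eq[OF d, of 2 0] n0 by simp
    qed
  qed
  have "s \<in> xs ! 1 \<longleftrightarrow> s \<in> xs ! i" if "1 \<le> i" "i < ?n" for i
    using that
  proof (induction i rule: dec_induct)
    case (step i)
    then show ?case using \<open>\<And>i. 0 < i \<Longrightarrow> i < ?n \<Longrightarrow> _\<close>[of i] by simp
  qed simp
  then have "s \<in> xs ! 1 \<longleftrightarrow> s \<in> xs ! (?n - 1)" using n0 by simp
  also have "\<dots> \<longleftrightarrow> s \<in> xs ! 0" using step[of "?n - 1"] n0 by simp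
  finally show False using ne by blast
qed

lemma reachable_in_tree:
  assumes n: "n \<in> nodes N" "m \<in> nodes N" and "R \<subseteq> n" "R \<subseteq> m" "W \<subseteq> bag G n" "W \<subseteq> bag G m"
  shows "reachable (region R W) n m"
proof (cases "N = {}")
  case True
  then have "n = {}" "m = {}" "nodes N = {{}}" using n by (auto simp: nodes_def)
  then show ?thesis using assms by (simp add: reachable_def induced_def sep_tree_def)
next
  case False
  then obtain s t where "s \<in> N" "n = node s" "t \<in> N" "m = node t" using n by (auto simp: nodes_def)
  then show ?thesis using walk assms by simp
qed

lemma connected_in_tree: "connected_graph (region R W)"
  unfolding connected_graph_def using reachable_in_tree by (simp add: induced_def)

lemma sep_tree_is_tree: "is_tree (sep_tree N)"
proof -
  have "connected_graph (sep_tree N)"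
  proof -
    have e: "e \<subseteq> nodes N" if "e \<in> edges (sep_tree N)" for e
      using sep_tree_simple that by (auto simp: simple_graph_def sep_tree_def)
    have "region {} {} = sep_tree N"
      using e by (auto simp: induced_def sep_tree_def)
    then show ?thesis using connected_in_tree[of "{}" "{}"] by simp
  qed
  moreover have "verts (sep_tree N) \<noteq> {}" by (auto simp: sep_tree_def nodes_def)
  ultimately show ?thesis unfolding is_tree_def using sep_tree_simple sep_tree_acyclic by blast
qed

lemma bag_containing:
  assumes W: "W \<subseteq> verts G" "\<And>A B. (A, B) \<in> N \<Longrightarrow> W \<subseteq> A \<or> W \<subseteq> B"
  obtains n where "n \<in> nodes N" "W \<subseteq> bag G n"
proof (cases "N = {}")
  case True
  then show ?thesis using that[of "{}"] W(1) by (simp add: nodes_def bag_def)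
next
  case False
  then obtain s where "s \<in> N" by blast
  then show ?thesis using node_containing[OF _ W] that node_in_nodes by metis
qed

lemma tree_decomposition:
  assumes s: "simple_graph G"
  shows "is_tree_decomposition G (sep_tree N) (bag G)"
  unfolding is_tree_decomposition_def
proof (intro conjI ballI)
  show "is_tree (sep_tree N)" by (rule sep_tree_is_tree)
  show "bag G t \<subseteq> verts G" for t by (simp add: bag_def)
  have "\<exists>t\<in>nodes N. v \<in> bag G t" if "v \<in> verts G" for v
    using bag_containing[of "{v}"] vertex_side that by (metis empty_subsetI insert_subset)
  then show "(\<Union>t\<in>verts (sep_tree N). verts (induced G (bag G t))) = verts G"
    by (auto simp: induced_def sep_tree_def)
  have "\<exists>t\<in>nodes N. e \<subseteq> bag G t" if "e \<in> edges G" for e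
  proof -
    have "e \<subseteq> verts G" using that s by (simp add: simple_graph_def)
    then show ?thesis using bag_containing[of e] edge_side_of_sep[OF s that] by metis
  qed
  then show "(\<Union>t\<in>verts (sep_tree N). edges (induced G (bag G t))) = edges G"
    by (auto simp: induced_def sep_tree_def)
  fix v
  show "connected_graph (induced (sep_tree N) {t \<in> verts (sep_tree N). v \<in> bag G t})"
    using connected_in_tree[of "{}" "{v}"] by (simp add: sep_tree_def)
qed

text \<open>The component of \<open>node (A, B)\<close> consists of the nodes containing
  \<open>(A, B)\<close>: no other edge flips this separation, and these nodes are connected among
  themselves. Their bags lie in \<open>B\<close> and cover it, since a vertex of \<open>B\<close> is
  reached by flips that leave \<open>(A, B)\<close> alone.\<close>

lemma edge_side_eq:
  assumes AB: "(A, B) \<in> N"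
  shows "edge_side (sep_tree N) (bag G) (node (A, B)) (node (B, A)) = B"
proof -
  let ?e = "{node (A, B), node (B, A)}"
  let ?D = "delete_edge (sep_tree N) ?e"
  have self: "(A, B) \<in> node (A, B)" "(A, B) \<notin> node (B, A)"
    using node_self(1)[OF AB] node_self(2)[of "(B, A)"] by auto
  have "component_of ?D (node (A, B)) = {n \<in> nodes N. (A, B) \<in> n}"
  proof (intro equalityI subsetI)
    fix n assume "n \<in> component_of ?D (node (A, B))"
    then have n: "n \<in> nodes N" "(node (A, B), n) \<in> {(x, y). {x, y} \<in> edges ?D}\<^sup>*"
      by (auto simp: component_of_def reachable_def delete_edge_def sep_tree_def)
    from n(2) have "(A, B) \<in> n"
    proof (induction rule: rtrancl_induct)
      case (step x y)
      then have "{x, y} \<in> edges (sep_tree N)" "{x, y} \<noteq> ?e" by (auto simp: delete_edge_def)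
      then show ?case using edge_flip[OF AB, of x y] step by simp
    qed (rule self)
    then show "n \<in> {n \<in> nodes N. (A, B) \<in> n}" using n by simp
  next
    fix n assume n: "n \<in> {n \<in> nodes N. (A, B) \<in> n}"
    have "reachable (region {(A, B)} {}) (node (A, B)) n"
      using reachable_in_tree[of "node (A, B)" n "{(A, B)}" "{}"] node_in_nodes[OF AB] n self
        by simp
    then have r: "(node (A, B), n) \<in> {(x, y). {x, y} \<in> edges (region {(A, B)} {})}\<^sup>*"
      by (simp add: reachable_def)
    have "{(x, y). {x, y} \<in> edges (region {(A, B)} {})} \<subseteq> {(x, y). {x, y} \<in> edges ?D}"
    proof clarify
      fix x y assume "{x, y} \<in> edges (region {(A, B)} {})"
      then have "{x, y} \<in> edges (sep_tree N)" "(A, B) \<in> x" "(A, B) \<in> y" by (auto simp: induced_def)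
      moreover from this have "{x, y} \<noteq> ?e" using self(2) by (auto simp: doubleton_eq_iff)
      ultimately show "{x, y} \<in> edges ?D" by (simp add: delete_edge_def)
    qed
    then have "(node (A, B), n) \<in> {(x, y). {x, y} \<in> edges ?D}\<^sup>*" using r rtrancl_mono by blast
    then show "n \<in> component_of ?D (node (A, B))"
      using node_in_nodes[OF AB] n by (simp add: component_of_def reachable_def delete_edge_def
        sep_tree_def)
  qed
  moreover have "(\<Union>n\<in>{n \<in> nodes N. (A, B) \<in> n}. bag G n) = B"
  proof (intro equalityI subsetI)
    fix v assume v: "v \<in> B"
    then have vV: "v \<in> verts G" using sep[OF AB] by (auto simp: is_separation_def)
    then obtain t where "t \<in> N" "{v} \<subseteq> bag G (node t)" "(A, B) \<in> node t"
      using node_containing[OF AB, of "{v}"] vertex_side self(1) v by blast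
    then show "v \<in> (\<Union>n\<in>{n \<in> nodes N. (A, B) \<in> n}. bag G n)" using node_in_nodes by blast
  qed (auto simp: bag_def)
  ultimately show ?thesis by (simp add: edge_side_def)
qed

lemma adhesion_set:
  assumes "{n, m} \<in> edges (sep_tree N)"
  obtains A B where "(A, B) \<in> N" "bag G n \<inter> bag G m \<subseteq> A \<inter> B"
proof -
  obtain s where s: "s \<in> N" "{n, m} = {node s, node (prod.swap s)}" using assms
    by (auto simp: sep_tree_def)
  obtain A B where AB: "s = (A, B)" by (cases s)
  have "bag G (node s) \<subseteq> B" "bag G (node (prod.swap s)) \<subseteq> A"
    using node_self(1)[OF s(1)] node_self(1)[OF swap[OF s(1)]] AB by (auto simp: bag_def)
  then have "bag G n \<inter> bag G m \<subseteq> A \<inter> B" using s(2) by (auto simp: doubleton_eq_iff)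
  then show thesis using that s(1) AB by blast
qed

text \<open>\<open>b\<close> orients all of \<open>N\<close>, and any node whose bag contains
  \<open>b\<close> must be this orientation. Each vertex outside \<open>b\<close> is removed from
  its bag by a separation pointing towards \<open>b\<close>.\<close>

lemma bag_eq_unique:
  assumes b: "b \<subseteq> verts G" "\<And>A B. (A, B) \<in> N \<Longrightarrow> b \<subseteq> A \<longleftrightarrow> \<not> b \<subseteq> B"
    and out: "\<And>x. x \<in> verts G - b \<Longrightarrow> \<exists>C D. (C, D) \<in> N \<and> b \<subseteq> D \<and> x \<in> C - D"
  shows "\<exists>t\<in>nodes N. bag G t = b \<and> (\<forall>s\<in>nodes N. b \<subseteq> bag G s \<longrightarrow> s = t)"
proof (cases "N = {}")
  case True
  then have "bag G {} = b" using out b(1) by (auto simp: bag_def)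
  then show ?thesis using True by (simp add: nodes_def)
next
  case False
  then obtain t where t: "t \<in> N" "b \<subseteq> bag G (node t)" using node_containing[OF _ b(1)] b(2) by blast
  have mem: "(A, B) \<in> node t \<longleftrightarrow> b \<subseteq> B" if "(A, B) \<in> N" for A B
  proof -
    have "(A, B) \<in> node t \<or> (B, A) \<in> node t" using node_total[OF t(1) that] by simp
    then show ?thesis using t(2) b(2)[OF that] unfolding bag_iff by blast
  qed
  have "x \<notin> bag G (node t)" if x: "x \<notin> b" for x
  proof
    assume xt: "x \<in> bag G (node t)"
    then obtain C D where "(C, D) \<in> N" "b \<subseteq> D" "x \<in> C - D" using out[of x] x by (auto simp: bag_def)
    then show False using mem[of C D] xt by (auto simp: bag_def)
  qed
  then have "bag G (node t) = b" using t(2) by blast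
  moreover have "n = node t" if n: "n \<in> nodes N" "b \<subseteq> bag G n" for n
  proof -
    obtain s where s: "s \<in> N" "n = node s" using n(1) False by (auto simp: nodes_def)
    have "node s \<subseteq> node t"
    proof clarify
      fix A B assume "(A, B) \<in> node s"
      then show "(A, B) \<in> node t" using mem[of A B] n(2) s(2) node_subset unfolding bag_iff by blast
    qed
    then show ?thesis using node_eqI[OF s(1) t(1)] s(2) by simp
  qed
  ultimately show ?thesis using node_in_nodes[OF t(1)] by blast
qed

end

section \<open>Canonicity\<close>

text \<open>The unordered pairs of the definition are replaced by ordered ones, so that each
  condition can be pulled back along an image map.\<close>

lemma profile_iff:
  "profile k G P \<longleftrightarrow>
    (\<forall>A B. (A, B) \<in> P \<longrightarrow> fsep k G A B) \<and>
    (\<forall>A B. fsep k G A B \<longrightarrow> (A, B) \<in> P \<or> (B, A) \<in> P) \<and>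
    (\<forall>A B. (A, B) \<in> P \<longrightarrow> (B, A) \<notin> P) \<and>
    (\<forall>A B C D. (C, D) \<in> P \<and> fsep k G A B \<and> A \<subseteq> C \<and> D \<subseteq> B \<and> (A, B) \<noteq> (D, C) \<longrightarrow> (A, B) \<in> P) \<and>
    (\<forall>A B C D. (A, B) \<in> P \<and> (C, D) \<in> P \<longrightarrow> (B \<inter> D, A \<union> C) \<notin> P)" (is "_ \<longleftrightarrow> ?a \<and> ?b \<and> ?c \<and> ?d \<and> ?e")
proof
  assume P: "profile k G P"
  have ?a using profile_fsep[OF P] by blast
  moreover have ?b using profile_total[OF P] by blast
  moreover have ?c using profile_asym[OF P] by blast
  moreover have ?d using profile_down[OF P] by blast
  moreover have ?e using profile_corner[OF P] by blast
  ultimately show "?a \<and> ?b \<and> ?c \<and> ?d \<and> ?e" by blast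
next
  assume P: "?a \<and> ?b \<and> ?c \<and> ?d \<and> ?e"
  show "profile k G P"
    unfolding is_profile_def
  proof (intro conjI)
    show "is_orientation (enat k) G P"
      unfolding is_orientation_def
    proof (intro conjI allI impI)
      show "P \<subseteq> oseps (enat k) G"
      proof clarify
        fix A B assume "(A, B) \<in> P"
        then show "(A, B) \<in> oseps (enat k) G" unfolding oseps_iff using P by blast
      qed
      fix A B assume "{A, B} \<in> seps (enat k) G"
      then have "fsep k G A B" by (simp only: seps_iff)
      then have "((A, B) \<in> P) \<noteq> ((B, A) \<in> P)" using P by blast
      then show "\<exists>!s. s \<in> {(A, B), (B, A)} \<and> s \<in> P" by auto
    qed
    show "consistent (enat k) G P"
      unfolding consistent_def
    proof (rule notI, elim exE conjE)
      fix A B C D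
      assume a: "{A, B} \<in> seps (enat k) G" "{A, B} \<noteq> {C, D}" "osep_less (A, B) (C, D)"
        "(B, A) \<in> P" "(C, D) \<in> P"
      have "fsep k G A B" using a(1) by (simp only: seps_iff)
      moreover have "A \<subseteq> C" "D \<subseteq> B" using a(3) by (auto simp: osep_less_def osep_le_def)
      moreover have "(A, B) \<noteq> (D, C)" using a(2) by auto
      ultimately have "(A, B) \<in> P" using P a(5) by blast
      then show False using P a(4) by blast
    qed
    show "\<forall>A B C D. (A, B) \<in> P \<and> (C, D) \<in> P \<longrightarrow> (B \<inter> D, A \<union> C) \<notin> P" using P by blast
  qed
qed

section \<open>Transport along isomorphisms\<close>

definition sepmap :: "('a \<Rightarrow> 'b) \<Rightarrow> 'a osep \<Rightarrow> 'b osep" where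
  "sepmap f = map_prod (image f) (image f)"

lemma sepmap_pair [simp]: "sepmap f (A, B) = (f ` A, f ` B)"
  by (simp add: sepmap_def)

lemma sepmap_swap: "sepmap f (prod.swap r) = prod.swap (sepmap f r)"
  by (cases r) simp

abbreviation vpairs :: "'a ugraph \<Rightarrow> 'a osep set" where
  "vpairs G \<equiv> Pow (verts G) \<times> Pow (verts G)"

lemma edges_sep_tree: "edges (sep_tree N) = (\<lambda>s. {node_of N s, node_of N (prod.swap s)}) ` N"
  unfolding sep_tree_def ugraph.simps by blast

text \<open>\<open>f\<close> is arbitrary outside \<open>verts G\<close>, so images are faithful
  only for subsets of \<open>verts G\<close>; hence the hypotheses
  \<open>\<subseteq> vpairs G\<close>. Two vertex types let the inverse be interpreted as another
  instance.\<close>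

locale giso =
  fixes f :: "'a \<Rightarrow> 'b" and G :: "'a ugraph" and H :: "'b ugraph"
  assumes iso: "graph_iso f G H" and simpleG: "simple_graph G" and simpleH: "simple_graph H"
begin

abbreviation g where
  "g \<equiv> inv_into (verts G) f"

lemma inj: "inj_on f (verts G)"
  and img: "f ` verts G = verts H"
  using iso by (auto simp: graph_iso_def bij_betw_def)

lemma edge_iff: "u \<in> verts G \<Longrightarrow> v \<in> verts G \<Longrightarrow> {f u, f v} \<in> edges H \<longleftrightarrow> {u, v} \<in> edges G"
  using iso by (simp add: graph_iso_def)

lemma inverse: "giso g H G"
proof
  show "graph_iso g H G"
    unfolding graph_iso_def
  proof (intro conjI ballI)
    show "bij_betw g (verts H) (verts G)" using iso bij_betw_inv_into by (auto simp: graph_iso_def)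
    fix u v assume uv: "u \<in> verts H" "v \<in> verts H"
    then have "g u \<in> verts G" "g v \<in> verts G" "f (g u) = u" "f (g v) = v"
      using img by (auto intro: inv_into_into f_inv_into_f)
    then show "{u, v} \<in> edges H \<longleftrightarrow> {g u, g v} \<in> edges G" using edge_iff[of "g u" "g v"] by simp
  qed
qed (rule simpleH simpleG)+

lemma inv_image: "A \<subseteq> verts G \<Longrightarrow> g ` f ` A = A"
  "B \<subseteq> verts H \<Longrightarrow> f ` g ` B = B"
  using inj img by (auto simp: inv_into_image_cancel image_inv_into_cancel)

lemma image_verts: "A \<subseteq> verts G \<Longrightarrow> f ` A \<subseteq> verts H"
  using img by blast

lemma image_simps:
  assumes "A \<subseteq> verts G" "B \<subseteq> verts G"
  shows "f ` A \<subseteq> f ` B \<longleftrightarrow> A \<subseteq> B" "f ` A = f ` B \<longleftrightarrow> A = B" "f ` (A \<inter> B) = f ` A \<inter> f ` B"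
    "f ` (A - B) = f ` A - f ` B" "finite (f ` A) \<longleftrightarrow> finite A" "card (f ` A) = card A"
proof -
  have i: "inj_on f A" by (rule inj_on_subset[OF inj assms(1)])
  show "f ` A = f ` B \<longleftrightarrow> A = B" by (rule inj_on_image_eq_iff[OF inj assms])
  show int: "f ` (A \<inter> B) = f ` A \<inter> f ` B" by (rule inj_on_image_Int[OF inj assms])
  have "f ` A \<subseteq> f ` B \<longleftrightarrow> f ` (A \<inter> B) = f ` A" unfolding int by blast
  also have "\<dots> \<longleftrightarrow> A \<inter> B = A" by (rule inj_on_image_eq_iff[OF inj]) (use assms in blast)+
  finally show "f ` A \<subseteq> f ` B \<longleftrightarrow> A \<subseteq> B" by blast
  show "f ` (A - B) = f ` A - f ` B" by (rule inj_on_image_set_diff[OF inj]) (use assms in blast)+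
  show "finite (f ` A) \<longleftrightarrow> finite A" by (rule finite_image_iff[OF i])
  show "card (f ` A) = card A" by (rule card_image[OF i])
qed

lemma mem_image: "v \<in> verts G \<Longrightarrow> A \<subseteq> verts G \<Longrightarrow> f v \<in> f ` A \<longleftrightarrow> v \<in> A"
  by (rule inj_on_image_mem_iff[OF inj])

lemma sepmap_inj: "inj_on (sepmap f) (vpairs G)"
  by (rule inj_onI) (use image_simps(2) in fastforce)

lemma sepmap_mem: "X \<subseteq> vpairs G \<Longrightarrow> A \<subseteq> verts G \<Longrightarrow> B \<subseteq> verts G \<Longrightarrow> (f ` A, f ` B) \<in> sepmap f ` X \<longleftrightarrow>
    (A, B) \<in> X"
  using inj_on_image_mem_iff[OF sepmap_inj, of "(A, B)" X] by simp

lemma sepmap_vpairs: "X \<subseteq> vpairs G \<Longrightarrow> sepmap f ` X \<subseteq> vpairs H"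
  using image_verts by fastforce

lemma sepmap_inverse: "X \<subseteq> vpairs G \<Longrightarrow> sepmap g ` sepmap f ` X = X"
  "Y \<subseteq> vpairs H \<Longrightarrow> sepmap f ` sepmap g ` Y = Y"
proof -
  assume X: "X \<subseteq> vpairs G"
  have "sepmap g (sepmap f r) = r" if "r \<in> X" for r
  proof -
    obtain A B where r: "r = (A, B)" by (cases r)
    then have "A \<subseteq> verts G" "B \<subseteq> verts G" using that X by blast+
    then show ?thesis by (simp only: r sepmap_pair inv_image(1))
  qed
  then show "sepmap g ` sepmap f ` X = X" by (simp add: image_image)
next
  assume Y: "Y \<subseteq> vpairs H"
  have "sepmap f (sepmap g r) = r" if "r \<in> Y" for r
  proof -
    obtain A B where r: "r = (A, B)" by (cases r)
    then have "A \<subseteq> verts H" "B \<subseteq> verts H" using that Y by blast+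
    then show ?thesis by (simp only: r sepmap_pair inv_image(2))
  qed
  then show "sepmap f ` sepmap g ` Y = Y" by (simp add: image_image)
qed

text \<open>To transport a set of separations it suffices to map it into its counterpart, for every
  isomorphism: the inverse isomorphism gives the other inclusion.\<close>

lemma sepmap_eqI:
  assumes "X \<subseteq> vpairs H" "sepmap f ` Y \<subseteq> X" "sepmap g ` X \<subseteq> Y"
  shows "X = sepmap f ` Y"
proof
  have "X = sepmap f ` sepmap g ` X" using sepmap_inverse(2)[OF assms(1)] by simp
  also have "\<dots> \<subseteq> sepmap f ` Y" using assms(3) by (rule image_mono)
  finally show "X \<subseteq> sepmap f ` Y" .
qed (rule assms)

lemma nested_image:
  "r \<in> vpairs G \<Longrightarrow> s \<in> vpairs G \<Longrightarrow> nested (sepmap f r) (sepmap f s) \<longleftrightarrow> nested r s"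
  "r \<in> vpairs G \<Longrightarrow> s \<in> vpairs G \<Longrightarrow> osep_le (sepmap f r) (sepmap f s) \<longleftrightarrow> osep_le r s"
  by (cases r, cases s, simp add: nested_iff osep_le_def image_simps(1))+

lemma nbhd_image:
  assumes S: "S \<subseteq> verts G"
  shows "nbhd H (f ` S) = f ` nbhd G S"
proof (intro equalityI subsetI)
  fix w assume "w \<in> nbhd H (f ` S)"
  then obtain u where w: "w \<in> verts H" "w \<notin> f ` S" and u: "u \<in> S" "{f u, w} \<in> edges H"
    by (auto simp: nbhd_def)
  obtain v where v: "v \<in> verts G" "w = f v" using w(1) img by blast
  have "{u, v} \<in> edges G" using edge_iff[of u v] u v S by blast
  then show "w \<in> f ` nbhd G S" using v u w(2) by (auto simp: nbhd_def)
next
  fix w assume "w \<in> f ` nbhd G S"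
  then obtain v u where v: "w = f v" "v \<in> verts G" "v \<notin> S" and u: "u \<in> S" "{u, v} \<in> edges G"
    by (auto simp: nbhd_def)
  then have "{f u, f v} \<in> edges H" using edge_iff[of u v] S by blast
  moreover have "f v \<notin> f ` S" using mem_image[OF v(2) S] v(3) by simp
  ultimately show "w \<in> nbhd H (f ` S)" using v u img by (auto simp: nbhd_def)
qed

lemma conn_set_image:
  assumes K: "conn_set G K" "K \<subseteq> verts G"
  shows "conn_set H (f ` K)"
  unfolding conn_set_def
proof (intro conjI allI impI)
  show "f ` K \<noteq> {}" using K by (auto simp: conn_set_def)
  fix S assume S: "S \<subseteq> f ` K" "S \<noteq> {} \<and> nbhd H S \<inter> f ` K = {}"
  then obtain S' where S': "S' \<subseteq> K" "S = f ` S'" by (meson subset_imageE)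
  then have V: "S' \<subseteq> verts G" using K by blast
  have "f ` (nbhd G S' \<inter> K) = {}"
    using S nbhd_image[OF V] S'(2) image_simps(3)[OF nbhd_subset(1)[of G S'] K(2)] by simp
  then have "S' = K" using K(1) S' S(2) unfolding conn_set_def by blast
  then show "S = f ` K" using S' by simp
qed

lemma is_comp_image:
  assumes "is_comp G X K" "X \<subseteq> verts G"
  shows "is_comp H (f ` X) (f ` K)"
proof -
  note K = compD[OF assms(1)]
  have "f ` K \<inter> f ` X = {}" using image_simps(3)[OF K(1) assms(2)] K(2) by simp
  then show ?thesis
    unfolding is_comp_def using conn_set_image[OF K(4,1)] nbhd_image[OF K(1)] K(5) image_verts[OF
      K(1)] by blast
qed

lemma fsep_image:
  assumes "fsep k G A B"
  shows "fsep k H (f ` A) (f ` B)"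
proof -
  note AB = fsepD[OF assms]
  have "f ` A \<union> f ` B = verts H" using AB(4) img by (metis image_Un)
  moreover have "{x, y} \<notin> edges H" if "x \<in> f ` A - f ` B" "y \<in> f ` B - f ` A" for x y
  proof -
    obtain u v where uv: "x = f u" "u \<in> A - B" "y = f v" "v \<in> B - A" using \<open>x \<in> _\<close> \<open>y \<in> _\<close> by blast
    then have "{u, v} \<notin> edges G" using AB(1) by (auto simp: is_separation_def)
    then show ?thesis using edge_iff[of u v] uv AB(5,6) by blast
  qed
  moreover have "f ` A \<inter> f ` B = f ` (A \<inter> B)" using image_simps(3)[OF AB(5,6)] by simp
  moreover have "A \<inter> B \<subseteq> verts G" using AB(5) by blast
  ultimately show ?thesis
    using AB(2,3) image_simps(5,6)[of "A \<inter> B" "A \<inter> B"] by (simp add: fsep_def is_separation_def)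
qed

lemma fsep_pre_image:
  assumes "fsep k H C D"
  obtains A B where "C = f ` A" "D = f ` B" "fsep k G A B"
proof -
  interpret i: giso g H G by (rule inverse)
  have "C = f ` g ` C" "D = f ` g ` D" using inv_image(2) fsepD(5,6)[OF assms] by simp_all
  then show thesis by (rule that[OF _ _ i.fsep_image[OF assms]])
qed

lemma profile_vpairs:
  assumes "profile k G P"
  shows "P \<subseteq> vpairs G"
proof clarify
  fix A B assume "(A, B) \<in> P"
  then show "A \<in> Pow (verts G) \<and> B \<in> Pow (verts G)"
    using fsepD(5,6)[OF profile_fsep[OF assms]] by blast
qed

lemma profile_mem:
  assumes "profile k G P" "A \<subseteq> verts G" "B \<subseteq> verts G"
  shows "(f ` A, f ` B) \<in> sepmap f ` P \<longleftrightarrow> (A, B) \<in> P"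
  by (rule sepmap_mem[OF profile_vpairs[OF assms(1)] assms(2,3)])

lemma profile_image_cases:
  assumes "profile k G P" "(C, D) \<in> sepmap f ` P"
  obtains A B where "C = f ` A" "D = f ` B" "(A, B) \<in> P" "A \<subseteq> verts G" "B \<subseteq> verts G"
  using assms profile_vpairs by fastforce

lemma profile_image:
  assumes P: "profile k G P"
  shows "profile k H (sepmap f ` P)" (is "profile _ _ ?P")
  unfolding profile_iff
proof (intro conjI allI impI)
  fix A B assume "(A, B) \<in> ?P"
  then show "fsep k H A B" using profile_image_cases[OF P] profile_fsep[OF P] fsep_image by metis
next
  fix C D assume "fsep k H C D"
  then obtain A B where "C = f ` A" "D = f ` B" "fsep k G A B" by (rule fsep_pre_image)
  then show "(C, D) \<in> ?P \<or> (D, C) \<in> ?P"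
    using profile_total[OF P] profile_mem[OF P] fsepD(5,6)[of k G A B] by blast
next
  fix C D assume "(C, D) \<in> ?P"
  then obtain A B where "C = f ` A" "D = f ` B" "(A, B) \<in> P" "A \<subseteq> verts G" "B \<subseteq> verts G"
    by (rule profile_image_cases[OF P])
  then show "(D, C) \<notin> ?P" using profile_mem[OF P] profile_asym[OF P] by blast
next
  fix A' B' C' D' assume *: "(C', D') \<in> ?P \<and> fsep k H A' B' \<and> A' \<subseteq> C' \<and> D' \<subseteq> B' \<and>
      (A', B') \<noteq> (D', C')"
  then obtain C D where CD: "C' = f ` C" "D' = f ` D" "(C, D) \<in> P" "C \<subseteq> verts G" "D \<subseteq> verts G"
    using profile_image_cases[OF P] by metis
  obtain A B where AB: "A' = f ` A" "B' = f ` B" "fsep k G A B" using * fsep_pre_image by metis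
  note AB' = fsepD(5,6)[OF AB(3)]
  have "A \<subseteq> C" "D \<subseteq> B" "(A, B) \<noteq> (D, C)"
    using * CD AB AB' image_simps(1)[OF AB'(1) CD(4)] image_simps(1)[OF CD(5) AB'(2)] by auto
  then have "(A, B) \<in> P" using profile_down[OF P CD(3) AB(3)] by blast
  then show "(A', B') \<in> ?P" using AB(1,2) profile_mem[OF P AB'] by simp
next
  fix A' B' C' D' assume *: "(A', B') \<in> ?P \<and> (C', D') \<in> ?P"
  obtain A B where AB: "A' = f ` A" "B' = f ` B" "(A, B) \<in> P" "A \<subseteq> verts G" "B \<subseteq> verts G"
    using profile_image_cases[OF P conjunct1[OF *]] .
  obtain C D where CD: "C' = f ` C" "D' = f ` D" "(C, D) \<in> P" "C \<subseteq> verts G" "D \<subseteq> verts G"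
    using profile_image_cases[OF P conjunct2[OF *]] .
  have "B' \<inter> D' = f ` (B \<inter> D)" "A' \<union> C' = f ` (A \<union> C)"
    using AB CD image_simps(3)[OF AB(5) CD(5)] by (simp_all add: image_Un)
  moreover have "(B \<inter> D, A \<union> C) \<notin> P" by (rule profile_corner[OF P AB(3) CD(3)])
  moreover have "B \<inter> D \<subseteq> verts G" "A \<union> C \<subseteq> verts G" using AB(4,5) CD(4) by blast+
  ultimately show "(B' \<inter> D', A' \<union> C') \<notin> ?P" by (simp only: profile_mem[OF P] simp_thms)
qed

lemma card_separator: "A \<subseteq> verts G \<Longrightarrow> B \<subseteq> verts G \<Longrightarrow> card (f ` A \<inter> f ` B) = card (A \<inter> B)"
  using image_simps(3)[of A B] image_simps(6)[of "A \<inter> B" "A \<inter> B"] by auto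

lemma eff_image:
  assumes P: "profile k G P" "profile k G Q"
    and e: "eff_dist G A B P Q"
  shows "eff_dist H (f ` A) (f ` B) (sepmap f ` P) (sepmap f ` Q)"
proof -
  note P' = profile_image[OF P(1)] profile_image[OF P(2)]
  note AB = fsepD[OF eff_fsep[OF P(1) e]]
  have d: "distinguishes G A B P Q" and min: "\<And>C D. distinguishes G C D P Q \<Longrightarrow>
      card (A \<inter> B) \<le> card (C \<inter> D)"
    using e eff_iff[OF P(1)] by blast+
  have "distinguishes H (f ` A) (f ` B) (sepmap f ` P) (sepmap f ` Q)"
    unfolding distinguishes_iff[OF P'] using d[unfolded distinguishes_iff[OF P]] profile_mem[OF
      P(1)]
      profile_mem[OF P(2)] AB(5,6) by blast
  moreover have "card (f ` A \<inter> f ` B) \<le> card (C' \<inter> D')"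
    if d': "distinguishes H C' D' (sepmap f ` P) (sepmap f ` Q)" for C' D'
  proof -
    have "fsep k H C' D'" by (rule distinguishes_fsep[OF P'(1) d'])
    then obtain C D where CD: "C' = f ` C" "D' = f ` D" "fsep k G C D" by (rule fsep_pre_image)
    note V = fsepD(5,6)[OF CD(3)]
    have "distinguishes G C D P Q"
      unfolding distinguishes_iff[OF P] using d'[unfolded distinguishes_iff[OF P'] CD(1,2)]
        profile_mem[OF P(1) V] profile_mem[OF P(1) V(2,1)] profile_mem[OF P(2) V]
        profile_mem[OF P(2) V(2,1)] by blast
    then show ?thesis using min card_separator[OF V] card_separator[OF AB(5,6)] CD by simp
  qed
  ultimately show ?thesis using eff_iff[OF P'(1)] by blast
qed

lemma eff_seps_vpairs: "eff_seps k G n \<subseteq> vpairs G"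
proof clarify
  fix A B assume "(A, B) \<in> eff_seps k G n"
  then show "A \<in> Pow (verts G) \<and> B \<in> Pow (verts G)" using fsepD(5,6)[OF eff_sepsD(2)] by blast
qed

lemma eff_seps_image_subset: "sepmap f ` eff_seps k G n \<subseteq> eff_seps k H n"
proof clarify
  fix A' B' A B assume s: "(A', B') = sepmap f (A, B)" and AB: "(A, B) \<in> eff_seps k G n"
  then obtain P Q where P: "profile k G P" "profile k G Q"
    "eff_dist G A B P Q" "card (A \<inter> B) = n"
    by (rule_tac eff_sepsE[OF AB]) blast
  have "card (f ` A \<inter> f ` B) = n"
    using card_separator fsepD(5,6)[OF eff_fsep[OF P(1,3)]] P(4) by simp
  then show "(A', B') \<in> eff_seps k H n"
    using s profile_image[OF P(1)] profile_image[OF P(2)] eff_image[OF P(1,2,3)]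
      by (auto simp: eff_seps_def)
qed

lemma eff_seps_image: "eff_seps k H n = sepmap f ` eff_seps k G n"
proof (rule sepmap_eqI)
  interpret i: giso g H G by (rule inverse)
  show "eff_seps k H n \<subseteq> vpairs H" by (rule i.eff_seps_vpairs)
  show "sepmap g ` eff_seps k H n \<subseteq> eff_seps k G n" by (rule i.eff_seps_image_subset)
qed (rule eff_seps_image_subset)

lemma crossing_image:
  assumes r: "r \<in> vpairs G"
  shows "crossing k H n (sepmap f r) = crossing k G n r"
proof -
  have "{t \<in> eff_seps k H n. \<not> nested (sepmap f r) t} = sepmap f ` {t \<in> eff_seps k G n. \<not> nested r
      t}"
    unfolding eff_seps_image using nested_image(1)[OF r] eff_seps_vpairs[of k n] by blast
  moreover have "inj_on (sepmap f) {t \<in> eff_seps k G n. \<not> nested r t}"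
    by (rule inj_on_subset[OF sepmap_inj]) (use eff_seps_vpairs[of k n] in blast)
  ultimately show ?thesis by (simp add: crossing_def card_image)
qed

lemma candidates_vpairs: "profile k G P \<Longrightarrow> candidates G n N P Q \<subseteq> vpairs G"
  using eff_fsep fsepD(5,6) unfolding candidates_def by blast

lemma candidates_image_subset:
  assumes P: "profile k G P" "profile k G Q" and N: "N \<subseteq> vpairs G"
  shows "sepmap f ` candidates G n N P Q \<subseteq> candidates H n (sepmap f ` N) (sepmap f ` P) (sepmap f
      ` Q)"
proof
  fix r' assume "r' \<in> sepmap f ` candidates G n N P Q"
  then obtain r where r: "r' = sepmap f r" "r \<in> candidates G n N P Q" by blast
  obtain A B where AB: "r = (A, B)" by (cases r)
  have e: "eff_dist G A B P Q" "card (A \<inter> B) = n" "\<forall>t\<in>N. nested (A, B) t"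
    using r(2) AB by (auto simp: candidates_def)
  note V = fsepD(5,6)[OF eff_fsep[OF P(1) e(1)]]
  have "\<forall>t\<in>N. nested (sepmap f (A, B)) (sepmap f t)"
    using e(3) nested_image(1)[of "(A, B)"] V N by blast
  then show "r' \<in> candidates H n (sepmap f ` N) (sepmap f ` P) (sepmap f ` Q)"
    using eff_image[OF P e(1)] card_separator[OF V] e(2) r(1) AB by (simp add: candidates_def)
qed

lemma candidates_image:
  assumes P: "profile k G P" "profile k G Q" and N: "N \<subseteq> vpairs G"
  shows "candidates H n (sepmap f ` N) (sepmap f ` P) (sepmap f ` Q) = sepmap f ` candidates G n N
      P Q"
proof (rule sepmap_eqI)
  interpret i: giso g H G by (rule inverse)
  note P' = profile_image[OF P(1)] profile_image[OF P(2)]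
  show "candidates H n (sepmap f ` N) (sepmap f ` P) (sepmap f ` Q) \<subseteq> vpairs H"
    by (rule i.candidates_vpairs[OF P'(1)])
  show "sepmap g ` candidates H n (sepmap f ` N) (sepmap f ` P) (sepmap f ` Q)
      \<subseteq> candidates G n N P Q"
    using i.candidates_image_subset[OF P' sepmap_vpairs[OF N], of n]
    unfolding sepmap_inverse(1)[OF N] sepmap_inverse(1)[OF profile_vpairs[OF P(1)]]
      sepmap_inverse(1)[OF profile_vpairs[OF P(2)]] .
qed (rule candidates_image_subset[OF assms])

lemma optimal_vpairs: "optimal k G n N \<subseteq> vpairs G"
  using optimal_eff eff_seps_vpairs by blast

lemma optimal_image_subset:
  assumes N: "N \<subseteq> vpairs G"
  shows "sepmap f ` optimal k G n N \<subseteq> optimal k H n (sepmap f ` N)"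
proof
  fix r' assume "r' \<in> sepmap f ` optimal k G n N"
  then obtain r where r: "r' = sepmap f r" "r \<in> optimal k G n N" by blast
  then obtain P Q where P: "profile k G P" "profile k G Q" "r \<in> candidates G n N P Q"
    and min: "\<And>q. q \<in> candidates G n N P Q \<Longrightarrow> crossing k G n r \<le> crossing k G n q"
    unfolding optimal_def by blast
  note c = candidates_image[OF P(1,2) N, of n]
  have V: "candidates G n N P Q \<subseteq> vpairs G" by (rule candidates_vpairs[OF P(1)])
  have "crossing k H n r' \<le> crossing k H n q"
    if q: "q \<in> candidates H n (sepmap f ` N) (sepmap f ` P) (sepmap f ` Q)" for q
  proof -
    obtain q' where q': "q = sepmap f q'" "q' \<in> candidates G n N P Q" using q unfolding c by blast
    have "q' \<in> vpairs G" "r \<in> vpairs G" using q'(2) P(3) V by blast+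
    then show ?thesis using min[OF q'(2)] by (simp only: q'(1) r(1) crossing_image)
  qed
  moreover have "r' \<in> candidates H n (sepmap f ` N) (sepmap f ` P) (sepmap f ` Q)"
    using c P(3) r(1) by blast
  ultimately show "r' \<in> optimal k H n (sepmap f ` N)"
    unfolding optimal_def using profile_image[OF P(1)] profile_image[OF P(2)] by blast
qed

lemma optimal_image:
  assumes N: "N \<subseteq> vpairs G"
  shows "optimal k H n (sepmap f ` N) = sepmap f ` optimal k G n N"
proof (rule sepmap_eqI)
  interpret i: giso g H G by (rule inverse)
  show "optimal k H n (sepmap f ` N) \<subseteq> vpairs H" by (rule i.optimal_vpairs)
  show "sepmap g ` optimal k H n (sepmap f ` N) \<subseteq> optimal k G n N"
    using i.optimal_image_subset[OF sepmap_vpairs[OF N], of k n] unfolding sepmap_inverse(1)[OF N] .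
qed (rule optimal_image_subset[OF N])

lemma levels_vpairs: "levels k G n \<subseteq> vpairs G"
  by (induction n) (use optimal_vpairs in auto)

lemma levels_image: "levels k H n = sepmap f ` levels k G n"
  by (induction n) (simp_all add: optimal_image levels_vpairs image_Un)

lemma inseparable_image:
  assumes b: "inseparable k G b"
  shows "inseparable k H (f ` b)"
  unfolding inseparable_def
proof (intro conjI allI impI)
  have bV: "b \<subseteq> verts G" using b by (simp add: inseparable_def)
  show "f ` b \<subseteq> verts H" by (rule image_verts[OF bV])
  have "esize (f ` b) = esize b" by (simp add: esize_def image_simps[OF bV bV])
  then show "enat k \<le> esize (f ` b)" using b by (simp add: inseparable_def)
  fix C D assume "fsep k H C D"
  then obtain A B where AB: "C = f ` A" "D = f ` B" "fsep k G A B" by (rule fsep_pre_image)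
  then have "b \<subseteq> A \<or> b \<subseteq> B" using b by (simp add: inseparable_def)
  then show "f ` b \<subseteq> C \<or> f ` b \<subseteq> D" unfolding AB(1,2) by blast
qed

lemma block_image:
  assumes b: "is_block k G b"
  shows "is_block k H (f ` b)"
proof -
  interpret i: giso g H G by (rule inverse)
  note b' = blockD[OF simpleG b]
  have bV: "b \<subseteq> verts G" using b'(1) by (simp add: inseparable_def)
  have "c = f ` b" if c: "inseparable k H c" "f ` b \<subseteq> c" for c
  proof -
    have cV: "c \<subseteq> verts H" using c(1) by (simp add: inseparable_def)
    have "b = g ` f ` b" using inv_image(1)[OF bV] by simp
    also have "\<dots> \<subseteq> g ` c" using c(2) by (rule image_mono)
    finally have "g ` c = b" using b'(2) i.inseparable_image[OF c(1)] by blast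
    then show ?thesis using inv_image(2)[OF cV] by simp
  qed
  then show ?thesis
    unfolding is_block_def is_inseparable_iff[OF simpleH] using inseparable_image[OF b'(1)] by blast
qed

lemma uncovered_image:
  assumes K: "uncovered G N b K" and N: "N \<subseteq> vpairs G" and b: "b \<subseteq> verts G"
  shows "uncovered H (sepmap f ` N) (f ` b) (f ` K)"
    and "enlarged (sepmap f ` N) (f ` b) (f ` K) = f ` enlarged N b K"
proof -
  have c: "is_comp G b K" using K by (simp add: uncovered_def)
  note KV = compD(1)[OF c]
  have diff: "f ` C - f ` D = f ` (C - D)" and V: "C \<subseteq> verts G" "D \<subseteq> verts G" "C - D \<subseteq> verts G"
    if "(C, D) \<in> N" for C D
    using that N image_simps(4)[of C D] by blast+
  show "uncovered H (sepmap f ` N) (f ` b) (f ` K)"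
    unfolding uncovered_def
  proof (intro conjI allI impI)
    show "is_comp H (f ` b) (f ` K)" by (rule is_comp_image[OF c b])
    fix C' D' assume *: "(C', D') \<in> sepmap f ` N \<and> f ` b \<subseteq> D'"
    then obtain C D where CD: "C' = f ` C" "D' = f ` D" "(C, D) \<in> N" by auto
    then have "b \<subseteq> D" using * image_simps(1)[OF b V(2)] by blast
    then have "\<not> K \<subseteq> C - D" using K CD(3) by (auto simp: uncovered_def)
    then show "\<not> f ` K \<subseteq> C' - D'" unfolding CD(1,2) diff[OF CD(3)] image_simps(1)[OF KV V(3)[OF
      CD(3)]] .
  qed
  have meets: "f ` (C - D) \<inter> f ` K \<noteq> {} \<longleftrightarrow> (C - D) \<inter> K \<noteq> {}" if "(C, D) \<in> N" for C D
    using image_simps(3)[OF V(3)[OF that] KV] by (metis image_is_empty)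
  have "{C - D |C D. (C, D) \<in> sepmap f ` N \<and> f ` b \<subseteq> D \<and> (C - D) \<inter> f ` K \<noteq> {}} =
      image f ` {C - D |C D. (C, D) \<in> N \<and> b \<subseteq> D \<and> (C - D) \<inter> K \<noteq> {}}" (is "?L = ?R")
  proof (intro equalityI subsetI)
    fix X assume "X \<in> ?L"
    then obtain C' D' where X: "X = C' - D'" "(C', D') \<in> sepmap f ` N" "f ` b \<subseteq> D'"
      "(C' - D') \<inter> f ` K \<noteq> {}"
      by blast
    obtain C D where "C' = f ` C" "D' = f ` D" "(C, D) \<in> N" using X(2) by auto
    then have CD: "X = f ` C - f ` D" "(C, D) \<in> N" "f ` b \<subseteq> f ` D" "(f ` C - f ` D) \<inter> f ` K \<noteq> {}"
      using X by simp_all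
    then have "X = f ` (C - D)" "b \<subseteq> D" "(C - D) \<inter> K \<noteq> {}"
      using diff[OF CD(2)] meets[OF CD(2)] image_simps(1)[OF b V(2)[OF CD(2)]] by simp_all
    then show "X \<in> ?R" using CD(2) by blast
  next
    fix X assume "X \<in> ?R"
    then obtain C D where CD: "X = f ` (C - D)" "(C, D) \<in> N" "b \<subseteq> D" "(C - D) \<inter> K \<noteq> {}" by blast
    then have "X = f ` C - f ` D" "f ` b \<subseteq> f ` D" "(f ` C - f ` D) \<inter> f ` K \<noteq> {}"
      using diff[OF CD(2)] meets[OF CD(2)] by (simp_all add: image_mono)
    moreover have "(f ` C, f ` D) \<in> sepmap f ` N" using CD(2) by force
    ultimately show "X \<in> ?L" by blast
  qed
  then show "enlarged (sepmap f ` N) (f ` b) (f ` K) = f ` enlarged N b K"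
    unfolding enlarged_def by (simp add: image_Un image_Union)
qed

lemma block_seps_vpairs:
  assumes "N \<subseteq> vpairs G"
  shows "block_seps k G N \<subseteq> vpairs G"
proof -
  have "enlarged N b K \<subseteq> verts G" if "uncovered G N b K" for b K
    using that assms compD(1) unfolding enlarged_def uncovered_def by fastforce
  then show ?thesis by (auto simp: block_seps_def dest: subsetD[OF nbhd_subset(1)])
qed

lemma block_seps_image_subset:
  assumes N: "N \<subseteq> vpairs G"
  shows "sepmap f ` block_seps k G N \<subseteq> block_seps k H (sepmap f ` N)"
proof
  fix r' assume "r' \<in> sepmap f ` block_seps k G N"
  then obtain b K where b: "is_block k G b" "uncovered G N b K" "finite (nbhd G K)"
    "card (nbhd G K) < k"
    and r': "r' = sepmap f (enlarged N b K \<union> nbhd G K, verts G - enlarged N b K)"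
    by (auto simp: block_seps_def)
  have bV: "b \<subseteq> verts G" using b(1) by (simp add: is_block_def is_inseparable_def)
  have KV: "K \<subseteq> verts G" using b(2) compD(1) unfolding uncovered_def by blast
  note u = uncovered_image[OF b(2) N bV]
  have n: "nbhd H (f ` K) = f ` nbhd G K" by (rule nbhd_image[OF KV])
  have "enlarged N b K \<subseteq> verts G" using N KV unfolding enlarged_def by fastforce
  then have "f ` (verts G - enlarged N b K) = verts H - f ` enlarged N b K"
    using image_simps(4)[of "verts G" "enlarged N b K"] img by simp
  then have "r' = (enlarged (sepmap f ` N) (f ` b) (f ` K) \<union> nbhd H (f ` K), verts H - enlarged
      (sepmap f ` N) (f ` b) (f ` K))"
    unfolding r' u(2) n by (simp add: image_Un)
  moreover have "finite (nbhd H (f ` K))" "card (nbhd H (f ` K)) < k"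
    unfolding n using b(3,4) image_simps(5,6)[OF nbhd_subset(1) nbhd_subset(1), of K] by simp_all
  ultimately show "r' \<in> block_seps k H (sepmap f ` N)"
    unfolding block_seps_def using block_image[OF b(1)] u(1) by blast
qed

lemma block_seps_image:
  assumes N: "N \<subseteq> vpairs G"
  shows "block_seps k H (sepmap f ` N) = sepmap f ` block_seps k G N"
proof (rule sepmap_eqI)
  interpret i: giso g H G by (rule inverse)
  show "block_seps k H (sepmap f ` N) \<subseteq> vpairs H"
    by (rule i.block_seps_vpairs[OF sepmap_vpairs[OF N]])
  show "sepmap g ` block_seps k H (sepmap f ` N) \<subseteq> block_seps k G N"
    using i.block_seps_image_subset[OF sepmap_vpairs[OF N], of k]
      unfolding sepmap_inverse(1)[OF N] .
qed (rule block_seps_image_subset[OF N])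

lemma tree_set_image: "tree_set k H = sepmap f ` tree_set k G"
  unfolding tree_set_def Let_def levels_image block_seps_image[OF levels_vpairs] image_Un
    image_image
    sepmap_swap ..

lemma tree_set_vpairs: "tree_set k G \<subseteq> vpairs G"
proof -
  have "block_seps k G (levels k G k) \<subseteq> vpairs G" by (rule block_seps_vpairs[OF levels_vpairs])
  then show ?thesis using levels_vpairs[of k k] by (auto simp: tree_set_def Let_def)
qed

lemma node_of_image:
  assumes N: "N \<subseteq> vpairs G" and s: "s \<in> N"
  shows "node_of (sepmap f ` N) (sepmap f s) = sepmap f ` node_of N s"
proof -
  have sV: "s \<in> vpairs G" "prod.swap s \<in> vpairs G" using s N by auto
  have iff: "sepmap f r \<in> node_of (sepmap f ` N) (sepmap f s) \<longleftrightarrow> r \<in> node_of N s" if "r \<in> N" for r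
  proof -
    have r: "r \<in> vpairs G" "sepmap f r \<in> sepmap f ` N" using that N by blast+
    show ?thesis
      unfolding node_of_def mem_Collect_eq sepmap_swap[symmetric] nested_image(2)[OF r(1) sV(1)]
        nested_image(2)[OF r(1) sV(2)] inj_on_eq_iff[OF sepmap_inj r(1) sV(2)]
      using that r(2) by simp
  qed
  have "node_of N s \<subseteq> N" "node_of (sepmap f ` N) (sepmap f s) \<subseteq> sepmap f ` N"
    unfolding node_of_def by blast+
  then show ?thesis using iff by blast
qed

text \<open>An isomorphism acts on nodes by images. That this is injective on sets of oriented
  vertex pairs gives the bijection of nodes and makes it reflect edges.\<close>

lemma sep_tree_iso:
  assumes N: "N \<subseteq> vpairs G" and sw: "\<And>s. s \<in> N \<Longrightarrow> prod.swap s \<in> N"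
  shows "graph_iso (image (sepmap f)) (sep_tree N) (sep_tree (sepmap f ` N))"
    and "n \<in> nodes N \<Longrightarrow> bag H (sepmap f ` n) = f ` bag G n"
proof -
  let ?h = "image (sepmap f)"
  have nodesV: "nodes N \<subseteq> Pow (vpairs G)"
    using N by (auto simp: nodes_def node_of_def)
  have inj_h: "inj_on ?h (nodes N)"
    by (rule inj_on_subset[OF inj_on_image_Pow[OF sepmap_inj] nodesV])
  have nodes: "nodes (sepmap f ` N) = ?h ` nodes N"
    using node_of_image[OF N] by (auto simp: nodes_def image_image)
  have node_swap: "node_of (sepmap f ` N) (prod.swap (sepmap f s)) = ?h (node_of N (prod.swap s))"
    if "s \<in> N" for s
    using node_of_image[OF N sw[OF that]] sepmap_swap by metis
  have edges: "edges (sep_tree (sepmap f ` N)) = image ?h ` edges (sep_tree N)"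
  proof -
    have "edges (sep_tree (sepmap f ` N)) =
        (\<lambda>s. {node_of (sepmap f ` N) (sepmap f s), node_of (sepmap f ` N) (prod.swap (sepmap f
          s))}) ` N"
      unfolding edges_sep_tree image_image ..
    also have "\<dots> = (\<lambda>s. ?h ` {node_of N s, node_of N (prod.swap s)}) ` N"
      by (rule image_cong[OF refl]) (simp only: node_of_image[OF N] node_swap image_insert
        image_empty)
    also have "\<dots> = image ?h ` edges (sep_tree N)" unfolding edges_sep_tree image_image ..
    finally show ?thesis .
  qed
  have eV: "e \<subseteq> nodes N" if "e \<in> edges (sep_tree N)" for e
    using that sw by (auto simp: sep_tree_def nodes_def)
  show "graph_iso ?h (sep_tree N) (sep_tree (sepmap f ` N))"
    unfolding graph_iso_def
  proof (intro conjI ballI)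
    show "bij_betw ?h (verts (sep_tree N)) (verts (sep_tree (sepmap f ` N)))"
      using inj_h nodes by (simp add: bij_betw_def sep_tree_def)
    fix u v assume "u \<in> verts (sep_tree N)" "v \<in> verts (sep_tree N)"
    then have uv: "{u, v} \<subseteq> nodes N" by (simp add: sep_tree_def)
    have "{?h u, ?h v} \<in> edges (sep_tree (sepmap f ` N)) \<longleftrightarrow>
        ?h ` {u, v} \<in> image ?h ` edges (sep_tree N)"
      by (simp add: edges)
    also have "\<dots> \<longleftrightarrow> {u, v} \<in> edges (sep_tree N)"
      using inj_on_image_eq_iff[OF inj_h uv eV] by blast
    finally show "{u, v} \<in> edges (sep_tree N) \<longleftrightarrow> {?h u, ?h v} \<in> edges (sep_tree (sepmap f ` N))" ..
  qed
  show "bag H (sepmap f ` n) = f ` bag G n" if n: "n \<in> nodes N"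
  proof (intro equalityI subsetI)
    fix y assume y: "y \<in> bag H (sepmap f ` n)"
    then obtain x where x: "x \<in> verts G" "y = f x" using img by (auto simp: bag_def)
    have "x \<in> B" if AB: "(A, B) \<in> n" for A B
    proof -
      have "f x \<in> f ` B" using y x(2) AB by (force simp: bag_def)
      moreover have "B \<subseteq> verts G" using AB n nodesV by blast
      ultimately show ?thesis using mem_image[OF x(1)] by blast
    qed
    then show "y \<in> f ` bag G n" using x by (auto simp: bag_def)
  next
    fix y assume "y \<in> f ` bag G n"
    then show "y \<in> bag H (sepmap f ` n)" using img by (fastforce simp: bag_def)
  qed
qed

end

section \<open>The theorem\<close>

lemma nested_set_tree_set:
  assumes G: "G \<in> graph_class"
  shows "nested_set G (tree_set k G)"
proof
  let ?N = "tree_set k G"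
  have tight: "?N \<subseteq> tight_seps k G" by (rule tree_set_tight[OF G])
  show sep: "is_separation G A B" if "(A, B) \<in> ?N" for A B using that tight
    by (auto simp: tight_seps_def)
  show swap: "prod.swap s \<in> ?N" if "s \<in> ?N" for s using that tree_set_swap by (cases s) simp
  show "nested r s" if "r \<in> ?N" "s \<in> ?N" for r s by (rule tree_set_nested[OF G that])
  show "prod.swap s \<noteq> s" if "s \<in> ?N" for s using tree_set_proper[OF G] that by (cases s) auto
  show "r = s \<or> r = prod.swap s"
    if "r \<in> ?N" "s \<in> ?N" "osep_le r s" "osep_le (prod.swap r) s" for r s
    using that tree_set_regular[OF G] by (cases r, cases s) (auto simp: osep_le_def)
  show "finite {(A, B) \<in> ?N. v \<in> A \<and> x \<in> B}" if "v \<in> verts G" "x \<in> verts G" for v x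
    by (rule finite_subset[OF _ finite_tight_seps_between[OF G that, of k]]) (use tight in auto)
  show "finite ?N \<or> (\<forall>(A, B)\<in>?N. A \<noteq> {})"
  proof (cases "\<exists>B. ({}, B) \<in> ?N")
    case True
    \<comment> \<open>Every separation and its inverse lie below \<open>(V, {})\<close>, so
      regularity leaves nothing but this pair.\<close>
    then obtain B where B: "({}, B) \<in> ?N" by blast
    then have BV: "B = verts G" "(B, {}) \<in> ?N" using sep tree_set_swap
      by (auto simp: is_separation_def)
    have "(C, D) \<in> {(B, {}), ({}, B)}" if CD: "(C, D) \<in> ?N" for C D
      using tree_set_regular[OF G BV(2) CD] sep[OF CD] BV(1) by (auto simp: is_separation_def)
    then have "?N \<subseteq> {(B, {}), ({}, B)}" by auto
    then show ?thesis using finite_subset by blast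
  qed auto
qed

lemma canonical_sep_tree: "canonical_on graph_class (\<lambda>G. (sep_tree (tree_set k G), bag G))"
  unfolding canonical_on_def prod.case
proof (intro ballI allI impI)
  fix G H :: "'a ugraph" and f :: "'a \<Rightarrow> 'a"
  assume GH: "G \<in> graph_class" "H \<in> graph_class" "graph_iso f G H"
  then interpret giso f G H by unfold_locales (simp_all add: graph_class_def)
  interpret N: nested_set G "tree_set k G" by (rule nested_set_tree_set[OF GH(1)])
  note i = sep_tree_iso[OF tree_set_vpairs[of k] N.swap]
  show "\<exists>h. graph_iso h (sep_tree (tree_set k G)) (sep_tree (tree_set k H)) \<and>
      (\<forall>t\<in>verts (sep_tree (tree_set k G)). bag H (h t) = f ` bag G t)"
    unfolding tree_set_image using i by (intro exI[of _
      "image (sepmap f)"]) (simp add: sep_tree_def)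
qed

theorem theorem4:
  fixes k :: nat
  shows "\<exists>\<Psi> :: 'a ugraph \<Rightarrow> ('a node, 'a) treedec.
    canonical_on graph_class \<Psi> \<and>
    (\<forall>G\<in>graph_class. \<forall>T V. \<Psi> G = (T, V) \<longrightarrow>
       is_tree_decomposition G T V \<and>
       adhesion_less T V k \<and>
       (\<forall>P Q. is_profile (enat k) G P \<and> is_profile (enat k) G Q \<and> P \<noteq> Q \<longrightarrow>
          td_efficiently_distinguishes G T V P Q) \<and>
       (\<forall>b. separable_block k G b \<longrightarrow>
          (\<exists>t\<in>verts T. V t = b \<and> (\<forall>s\<in>verts T. b \<subseteq> V s \<longrightarrow> s = t))))"
proof (intro exI conjI ballI allI impI)
  let ?\<Psi> = "\<lambda>G. (sep_tree (tree_set k G), bag G)"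
  show "canonical_on graph_class ?\<Psi>" by (rule canonical_sep_tree)
  fix G :: "'a ugraph" and T V assume G: "G \<in> graph_class" and "?\<Psi> G = (T, V)"
  then have TV: "T = sep_tree (tree_set k G)" "V = bag G" by simp_all
  interpret N: nested_set G "tree_set k G" by (rule nested_set_tree_set[OF G])
  have s: "simple_graph G" using G by (simp add: graph_class_def)
  have fsep: "fsep k G A B" if "(A, B) \<in> tree_set k G" for A B
    using that tree_set_tight[OF G, of k] by (auto simp: tight_seps_def fsep_def)
  show "is_tree_decomposition G T V" unfolding TV by (rule N.tree_decomposition[OF s])
  show "adhesion_less T V k"
    unfolding adhesion_less_def TV
  proof (intro allI impI)
    fix n m assume "{n, m} \<in> edges (sep_tree (tree_set k G))"
    then obtain A B where AB: "(A, B) \<in> tree_set k G" "bag G n \<inter> bag G m \<subseteq> A \<inter> B"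
      by (rule N.adhesion_set)
    then show "esize (bag G n \<inter> bag G m) < enat k"
      unfolding esize_less_iff using card_subset_less[OF AB(2)] fsepD(2,3)[OF fsep[OF AB(1)]]
        by blast
  qed
  show "td_efficiently_distinguishes G T V P Q"
    if PQ: "profile k G P \<and> profile k G Q \<and> P \<noteq> Q" for P Q
  proof -
    obtain A B where AB: "(A, B) \<in> tree_set k G" "eff_dist G A B P Q"
      using tree_set_distinguish[OF G] PQ by metis
    let ?s = "node_of (tree_set k G) (A, B)" and ?t = "node_of (tree_set k G) (B, A)"
    have "{?s, ?t} \<in> edges T" using N.node_edge[OF AB(1)] by (simp add: TV)
    moreover have "edge_side T V ?s ?t = B" "edge_side T V ?t ?s = A"
      unfolding TV using N.edge_side_eq AB(1) tree_set_swap by blast+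
    ultimately show ?thesis
      unfolding td_efficiently_distinguishes_def using AB(2) eff_commute(1)[of G A B] by metis
  qed
  show "\<exists>t\<in>verts T. V t = b \<and> (\<forall>s\<in>verts T. b \<subseteq> V s \<longrightarrow> s = t)" if b: "separable_block k G b" for b
  proof -
    have i: "inseparable k G b" by (rule separable_blockD(2)[OF s b])
    have "\<exists>C D. (C, D) \<in> tree_set k G \<and> b \<subseteq> D \<and> x \<in> C - D" if "x \<in> verts G - b" for x
      using tree_set_block[OF G b that] by metis
    moreover have "b \<subseteq> verts G" using i by (simp add: inseparable_def)
    ultimately have "\<exists>t\<in>nodes (tree_set k G). bag G t = b \<and>
        (\<forall>s\<in>nodes (tree_set k G). b \<subseteq> bag G s \<longrightarrow> s = t)"
      using inseparable_fsep(1)[OF i fsep] by (intro N.bag_eq_unique)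
    then show ?thesis unfolding TV by (simp add: sep_tree_def)
  qed
qed

end
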